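(* Let $m\ge1$ be an integer and let $\lambda$ be a random partition under the order $m$ symmetric minimal multicritical measure $\mathbb{P}^{\mathrm{s},m}_\theta$, with edge coefficient $b$. As $\theta\to\infty$, the rescaled profile $\psi_{\lambda,\theta}$ converges in probability, in the supremum norm, to $$\Omega^{\mathrm{s},m}(x)=\begin{cases}x+2b-\frac2\pi\int_{-b}^x\chi(v)\,dv, & x\in[-b,b],\\ |x|, & |x|>b,\end{cases}$$ where $\chi(x)\in[0,\pi]$ satisfies $$\int_0^{\chi(x)}\sin^{2m-1}\phi\,d\phi=\frac{(-1)^{m+1}}{2^{2m-1}}\binom{2m-1}{m}x,\qquad x\in[-b,b].$$
   Context: A partition is a finite non-increasing sequence $\lambda=(\lambda_1\ge\lambda_2\ge\cdots\ge\lambda_{\ell(\lambda)})$ of positive integers, with $\lambda_i:=0$ for $i>\ell(\lambda)$. Its conjugate $\lambda'$ has parts $\lambda'_j=\#\{i:\lambda_i\ge j\}$. For a sequence $t=(t_1,t_2,\ldots)$ (Miwa times), define $h_k[t]$ by $\sum_k h_k[t]z^k=\exp\left[\sum_{r\ge1}t_rz^r\right]$ (so $h_k[t]=0$ for $k<0$, $h_0[t]=1$), and the Schur function $s_\lambda[t]=\det_{1\le i,j\le\ell(\lambda)}h_{\lambda_i-i+j}[t]$. Order $m$ symmetric minimal multicritical measure, $\theta>0$: the probability measure on partitions $\mathbb{P}^{\mathrm{s},m}_\theta(\lambda)=e^{-\theta^2\sum_r r\gamma_r^2}s_\lambda[\theta\gamma]^2$ with $\theta\gamma=(\theta\gamma_1,\theta\gamma_2,\ldots)$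 and $$\gamma_{2r-1}=\frac{(-1)^{r+1}}{(2r-1)^2}\binom{2m-1}{m-r}\Big/\binom{2m-1}{m-1}\ \ (r=1,\ldots,m),\qquad\gamma_{2r-1}=0\ \ (r>m),\qquad\gamma_{2r}=0\ \ (r\ge1).$$ Its edge coefficient is $b=2\sum_{r\ge1}r\gamma_r=\dfrac{2^{4m-1}(m!)^4}{m((2m)!)^2}$. Rescaled profile: $\psi_{\lambda,\theta}:\mathbb{R}\to\mathbb{R}$ is the continuous piecewise linear curve (slopes $\pm1$) tracing the upper boundary of the Young diagram of $\lambda$ in the Russian convention, rescaled by $1/\theta$: it is obtained from the boundary relations $v=\frac1\theta\lambda_{\lfloor\theta u\rfloor+1}$ $(u>0)$, $u=\frac1\theta\lambda'_{\lfloor\theta v\rfloor+1}$ $(v>0)$ by setting $x=v-u$, $\psi_{\lambda,\theta}(x)=u+v$. Equivalently, with $S(\lambda)=\{\lambda_i-i+\frac12:i\ge1\}$, $\psi_{\lambda,\theta}(x)=x+\frac2\theta\#\{k\in S(\lambda):k>\theta x\}$ for $x\in\frac1\theta\mathbb{Z}$, with linear interpolation in between. Convergence in probability in the supremum norm means $\sup_{x}|\psi_{\lambda,\theta}(x)-\Omega^{\mathrm{s},m}(x)|\to0$ in probability.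
   Formalization: The printed equation for χ has no solution in [0,π] on half of [−b,b], since its right side is negative there; the right side is corrected to 2^{−(2m−1)} C(2m−1,m)(b − x), dropping the sign (−1)^{m+1} and restoring the integration constant b. *)

theory Defs
  imports
    "HOL-Probability.Probability"
    "HOL-Computational_Algebra.Formal_Power_Series"
    "Jordan_Normal_Form.Determinant"
begin

definition partitions :: "nat list set" where
  "partitions = {l. sorted_wrt (\<ge>) l \<and> 0 \<notin> set l}"

text \<open>Parts are indexed from 1 and vanish beyond the length; the index 0 is never used.\<close>

definition part :: "nat list \<Rightarrow> nat \<Rightarrow> nat" where
  "part l i = (if 1 \<le> i \<and> i \<le> length l then l ! (i - 1) else 0)"

text \<open>\<open>miwa_h t k\<close> is the coefficient of \<open>z ^ k\<close> in \<open>exp (\<Sum>r\<ge>1. t r * z ^ r)\<close>. The series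
  in the exponent has no constant term, so the formal composition is meaningful.\<close>

definition miwa_h :: "(nat \<Rightarrow> real) \<Rightarrow> int \<Rightarrow> real" where
  "miwa_h t k =
     (if k < 0 then 0
      else fps_nth (fps_exp 1 oo Abs_fps (\<lambda>r. if r = 0 then 0 else t r)) (nat k))"

text \<open>Matrix indices start at 0 here, which leaves the difference \<open>j - i\<close> unchanged.\<close>

definition schur :: "nat list \<Rightarrow> (nat \<Rightarrow> real) \<Rightarrow> real" where
  "schur l t =
     Determinant.det (mat (length l) (length l)
       (\<lambda>(i, j). miwa_h t (int (part l (i + 1)) - int i + int j)))"

text \<open>The odd index \<open>k = 2 * r - 1\<close> with \<open>1 \<le> r \<le> m\<close> carries the only nonzero coefficients.\<close>

definition multicrit_coeff :: "nat \<Rightarrow> nat \<Rightarrow> real" where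
  "multicrit_coeff m k =
     (if odd k \<and> (k + 1) div 2 \<le> m
      then let r = (k + 1) div 2 in
        (-1) ^ (r + 1) / (2 * real r - 1)\<^sup>2
          * (real ((2 * m - 1) choose (m - r)) / real ((2 * m - 1) choose (m - 1)))
      else 0)"

text \<open>Both series below have finitely many nonzero terms, and their terms at \<open>r = 0\<close> vanish.\<close>

definition multicrit_edge :: "nat \<Rightarrow> real" where
  "multicrit_edge m = 2 * (\<Sum>r. real r * multicrit_coeff m r)"

definition multicrit_measure :: "nat \<Rightarrow> real \<Rightarrow> nat list measure" where
  "multicrit_measure m \<theta> =
     density (count_space partitions)
       (\<lambda>l. ennreal (exp (- \<theta>\<^sup>2 * (\<Sum>r. real r * (multicrit_coeff m r)\<^sup>2))
                      * (schur l (\<lambda>r. \<theta> * multicrit_coeff m r))\<^sup>2))"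

definition particles :: "nat list \<Rightarrow> real set" where
  "particles l = {real (part l i) - real i + 1 / 2 | i. i \<ge> 1}"

text \<open>Height of the rescaled boundary curve at the lattice point \<open>n / \<theta>\<close>.\<close>

definition lattice_height :: "nat list \<Rightarrow> real \<Rightarrow> int \<Rightarrow> real" where
  "lattice_height l \<theta> n =
     of_int n / \<theta> + 2 / \<theta> * real (card {k \<in> particles l. k > of_int n})"

definition profile :: "nat list \<Rightarrow> real \<Rightarrow> real \<Rightarrow> real" where
  "profile l \<theta> x =
     (1 - frac (\<theta> * x)) * lattice_height l \<theta> \<lfloor>\<theta> * x\<rfloor>
       + frac (\<theta> * x) * lattice_height l \<theta> (\<lfloor>\<theta> * x\<rfloor> + 1)"

text \<open>The equation for \<open>chi\<close> is the integrated form of \<open>2 * (\<Sum>r. r * \<gamma> r * cos (r * chi x)) = x\<close>: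
  the left side decreases from \<open>b\<close> at \<open>chi = 0\<close> to \<open>- b\<close> at \<open>chi = pi\<close>, where \<open>b\<close> is the edge, and
  \<open>chi / pi\<close> is the limiting particle density. The integration constant \<open>b\<close> and the absence of a
  sign depending on \<open>m\<close> matter: with \<open>(- 1) ^ (m + 1) * x\<close> in place of \<open>b - x\<close> the right side
  would be negative on half of the interval, while the integral is nonnegative.\<close>

definition limit_angle :: "nat \<Rightarrow> (real \<Rightarrow> real) \<Rightarrow> bool" where
  "limit_angle m chi \<longleftrightarrow>
     (\<forall>x \<in> {- multicrit_edge m .. multicrit_edge m}.
        chi x \<in> {0..pi} \<and>
        integral {0..chi x} (\<lambda>\<phi>. sin \<phi> ^ (2 * m - 1))
          = real ((2 * m - 1) choose m) / 2 ^ (2 * m - 1) * (multicrit_edge m - x))"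

definition limit_profile :: "nat \<Rightarrow> (real \<Rightarrow> real) \<Rightarrow> real \<Rightarrow> real" where
  "limit_profile m chi x =
     (let b = multicrit_edge m in
      if x \<in> {- b .. b} then x + 2 * b - 2 / pi * integral {- b .. x} chi else \<bar>x\<bar>)"

end

theory Submission
  imports Defs
begin

text \<open>The numbers \<open>a\<^sub>i = \<lambda>\<^sub>i\<^sub>+\<^sub>1 - i\<close> (\<open>0 \<le> i < N\<close>) of a partition with at most \<open>N\<close> parts form a
  biorthogonal ensemble: \<open>s\<^sub>\<lambda> = det (h (a\<^sub>i + j))\<close>, so by the Cauchy--Binet formula the exponential
  moments of the counts \<open>card {i. a\<^sub>i > n}\<close> are ratios of Gram determinants. By Hadamard's inequality
  such a ratio is at most \<open>exp (z M\<^sub>n)\<close>, where \<open>M\<^sub>n\<close> is the mean count, so the count concentrates on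
  \<open>M\<^sub>n\<close> by Chernoff bounds, without a variance estimate.

  Let \<open>J k\<close> be the Laurent coefficients of \<open>exp (\<Sum>r. t r * (z ^ r - z ^ (- r)))\<close>. By Bessel's inequality
  the one-point function at \<open>a\<close> is at most \<open>\<Sum>m\<ge>a. (J m)\<^sup>2\<close>, and since it sums to \<open>N\<close> this is sharp as
  \<open>N \<rightarrow> \<infinity>\<close>. It yields \<open>M\<^sub>n = (\<Sum>m. max 0 (m - n) * (J m)\<^sup>2)\<close>, and also (through the mean size under a
  rescaling of the times) the inequality \<open>\<Sum>\<lambda>. s\<^sub>\<lambda>\<^sup>2 \<le> exp (\<Sum>r. r * (t r)\<^sup>2)\<close> that is needed to
  normalize. For \<open>t = \<theta> \<gamma>\<close> the relation \<open>k * J k = (\<Sum>r. r * t r * (J (k - r) + J (k + r)))\<close> shows that the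
  moments of the probability weights \<open>(J k)\<^sup>2\<close>, rescaled by \<open>\<theta>\<close>, tend to those of
  \<open>D \<phi> = 2 (\<Sum>r. r * \<gamma> r * cos (r \<phi>))\<close> for uniform \<open>\<phi>\<close>. Hence \<open>M\<^sub>n / \<theta>\<close> tends to
  \<open>1 / \<pi> * (\<integral> max 0 (D \<phi> - x) d\<phi>)\<close>, whose derivative in \<open>x\<close> is \<open>- \<chi> x / \<pi>\<close> because \<open>D (\<chi> x) = x\<close>.\<close>

section \<open>Gram determinants\<close>

text \<open>A determinantal count is distributed as a sum of independent Bernoulli variables, so the
  mean of \<open>(1 + z) ^ count\<close> is at most \<open>exp (z * M)\<close> for either sign of
  \<open>z\<close>; the determinant bound is this estimate in finite dimension. As \<open>M\<close>
  is of order \<open>\<theta>\<close>, a fixed small \<open>z\<close> already makes deviations of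
  order \<open>\<theta>\<close> exponentially unlikely. The obstacle is negative \<open>z\<close>:
  it calls for a lower bound on the mean, whereas Bessel's inequality only bounds from above.
  Truncation to \<open>N\<close> rows resolves it, because the total mass is then exactly
  \<open>N\<close> and an upper bound below the level is a lower bound above it, up to an error of
  order \<open>1 / N\<close> given by the variance of the weights \<open>(J k)\<^sup>2\<close>. The
  sequence \<open>J\<close> comes from the quotient \<open>H z / H (1 / z)\<close> with
  \<open>H z = exp (\<Sum>r. t r * z ^ r)\<close>: it has modulus one on the unit circle, hence
  orthonormal translates, and it reproduces the coefficients of \<open>H\<close>. The weights
  \<open>(J k)\<^sup>2\<close> in general charge an unbounded set while their rescaled limit has
  bounded support, so the test functions are squeezed between polynomials on the whole line.\<close>

definition dt :: "nat \<Rightarrow> (nat \<Rightarrow> nat \<Rightarrow> real) \<Rightarrow> real" where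
  "dt N M = Determinant.det (mat N N (\<lambda>(i, j). M i j))"

lemma dt_cong: "(\<And>i j. i < N \<Longrightarrow> j < N \<Longrightarrow> A i j = B i j) \<Longrightarrow> dt N A = dt N B"
  unfolding dt_def by (intro arg_cong[where f = Determinant.det] eq_matI) auto

lemma dt_expand:
  "dt N M = (\<Sum>p | p permutes {0..<N}. signof p * (\<Prod>i = 0..<N. M i (p i)))"
proof -
  have "dt N M = (\<Sum>p | p permutes {0..<N}.
      signof p * (\<Prod>i = 0..<N. mat N N (\<lambda>(i, j). M i j) $$ (i, p i)))"
    unfolding dt_def by (rule det_def') auto
  also have "\<dots> = (\<Sum>p | p permutes {0..<N}. signof p * (\<Prod>i = 0..<N. M i (p i)))"
  proof (intro sum.cong refl arg_cong2[where f = "(*)"] prod.cong)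
    fix p i assume "p \<in> {p. p permutes {0..<N}}" "i \<in> {0..<N}"
    then show "mat N N (\<lambda>(i, j). M i j) $$ (i, p i) = M i (p i)"
      using permutes_in_image[of p "{0..<N}" i] by auto
  qed
  finally show ?thesis .
qed

text \<open>By the Leibniz expansion the determinant is a polynomial in its entries, so it commutes
  with the limits that define infinite sums of entries.\<close>

lemma tendsto_dt:
  assumes "\<And>i j. i < N \<Longrightarrow> j < N \<Longrightarrow> ((\<lambda>x. M x i j) \<longlongrightarrow> M' i j) F"
  shows "((\<lambda>x. dt N (M x)) \<longlongrightarrow> dt N M') F"
  unfolding dt_expand
proof (intro tendsto_sum tendsto_mult tendsto_const tendsto_prod assms)
  fix p i assume "p \<in> {p. p permutes {0..<N}}" "i \<in> {0..<N}"
  then show "i < N" "p i < N"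
    using permutes_in_image[of p "{0..<N}" i] by auto
qed

lemma dt_mult: "dt N (\<lambda>i j. \<Sum>k<N. A i k * B k j) = dt N A * dt N B"
proof -
  have "mat N N (\<lambda>(i, j). \<Sum>k<N. A i k * B k j)
      = mat N N (\<lambda>(i, j). A i j) * mat N N (\<lambda>(i, j). B i j)"
    by (rule eq_matI) (auto simp: scalar_prod_def lessThan_atLeast0)
  then show ?thesis
    unfolding dt_def by (simp add: det_mult[of _ N])
qed

lemma dt_transpose: "dt N (\<lambda>i j. A j i) = dt N A"
proof -
  have "mat N N (\<lambda>(i, j). A j i) = transpose_mat (mat N N (\<lambda>(i, j). A i j))"
    by (rule eq_matI) auto
  then show ?thesis
    unfolding dt_def by (simp add: det_transpose[of _ N])
qed

lemma dt_lower_triangular: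
  assumes "\<And>i k. i < k \<Longrightarrow> k < N \<Longrightarrow> L i k = 0"
  shows "dt N L = (\<Prod>i<N. L i i)"
  unfolding dt_def
  by (subst det_lower_triangular[where n = N])
    (use assms in \<open>auto simp: prod_list_diag_prod lessThan_atLeast0\<close>)

lemma dt_scale: "dt N (\<lambda>i j. r i * A i j * s j) = (\<Prod>i<N. r i) * dt N A * (\<Prod>i<N. s i)"
proof -
  have "(\<Prod>i = 0..<N. r i * A i (p i) * s (p i))
      = (\<Prod>i<N. r i) * (\<Prod>i = 0..<N. A i (p i)) * (\<Prod>i<N. s i)" if "p permutes {0..<N}" for p
    using prod.permute[OF that, of s] by (simp add: prod.distrib lessThan_atLeast0 comp_def)
  then show ?thesis
    unfolding dt_expand by (simp add: sum_distrib_left sum_distrib_right mult_ac)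
qed

lemma dt_inverse:
  assumes "dt N L \<noteq> 0"
  obtains T where "\<And>i j. i < N \<Longrightarrow> j < N \<Longrightarrow> (\<Sum>k<N. T i k * L k j) = (if i = j then 1 else 0)"
    and "dt N T * dt N L = 1"
proof -
  let ?L = "mat N N (\<lambda>(i, j). L i j)"
  have "?L \<in> Units (ring_mat TYPE(real) N ())"
    using assms by (intro det_non_zero_imp_unit) (auto simp: dt_def)
  then obtain B where B: "B \<in> carrier_mat N N" "B * ?L = 1\<^sub>m N"
    unfolding Units_def ring_mat_def by auto
  have *: "(\<Sum>k<N. B $$ (i, k) * L k j) = (if i = j then 1 else 0)" if "i < N" "j < N" for i j
  proof -
    have "(B * ?L) $$ (i, j) = (\<Sum>k<N. B $$ (i, k) * L k j)"
      using that B(1) by (auto simp: scalar_prod_def lessThan_atLeast0)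
    with B(2) that show ?thesis by simp
  qed
  have "dt N (\<lambda>i j. B $$ (i, j)) * dt N L = dt N (\<lambda>i j. if i = j then 1 else 0)"
    unfolding dt_mult[symmetric] by (intro dt_cong) (simp add: *)
  also have "\<dots> = 1"
    by (subst dt_lower_triangular) auto
  finally show ?thesis
    using * by (intro that[of "\<lambda>i k. B $$ (i, k)"]) auto
qed

section \<open>Positive semidefinite forms and Hadamard's inequality\<close>

definition qform :: "nat \<Rightarrow> (nat \<Rightarrow> nat \<Rightarrow> real) \<Rightarrow> (nat \<Rightarrow> real) \<Rightarrow> real" where
  "qform N M c = (\<Sum>i<N. \<Sum>j<N. c i * c j * M i j)"

lemma qform_Suc:
  assumes "\<And>j. j < N \<Longrightarrow> M (Suc j) 0 = M 0 (Suc j)"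
  shows "qform (Suc N) M c = M 0 0 * (c 0)\<^sup>2 + 2 * c 0 * (\<Sum>i<N. c (Suc i) * M 0 (Suc i))
    + qform N (\<lambda>i j. M (Suc i) (Suc j)) (\<lambda>i. c (Suc i))"
proof -
  have "(\<Sum>j<N. c (Suc j) * c 0 * M (Suc j) 0) = c 0 * (\<Sum>i<N. c (Suc i) * M 0 (Suc i))"
    unfolding sum_distrib_left by (intro sum.cong) (auto simp: assms)
  moreover have "(\<Sum>j<N. c 0 * c (Suc j) * M 0 (Suc j)) = c 0 * (\<Sum>i<N. c (Suc i) * M 0 (Suc i))"
    unfolding sum_distrib_left by (intro sum.cong) auto
  ultimately show ?thesis
    unfolding qform_def sum.lessThan_Suc_shift by (simp add: sum.distrib power2_eq_square)
qed

text \<open>For a nonzero slope the witness is the point where the affine function equals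
  -1.\<close>

lemma affine_nonneg_imp_zero:
  fixes s q :: real
  assumes "\<And>x. 0 \<le> 2 * x * s + q"
  shows "s = 0"
proof (rule ccontr)
  assume "s \<noteq> 0"
  then show False using assms[of "- (q + 1) / (2 * s)"] by (simp add: field_simps)
qed

text \<open>Induction on the Schur complement of the entry at (0, 0). The form is only semidefinite,
  so this pivot may vanish; its whole row then vanishes, and since division by zero gives zero the
  same formulas for \<open>M'\<close> and \<open>L'\<close> cover both cases.\<close>

lemma cholesky:
  assumes "\<And>i j. M i j = M j i" and "\<And>c. 0 \<le> qform N M c"
  shows "\<exists>L. (\<forall>i<N. \<forall>j<N. M i j = (\<Sum>k<N. L i k * L j k)) \<and> (\<forall>i k. i < k \<longrightarrow> L i k = 0)"
  using assms
proof (induction N arbitrary: M)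
  case 0
  then show ?case by (intro exI[of _ "\<lambda>_ _. 0"]) auto
next
  case (Suc N)
  define a where "a = M 0 0"
  define v where "v i = M 0 (Suc i)" for i
  have sym: "M (Suc j) 0 = v j" for j
    using Suc.prems(1)[of "Suc j" 0] by (simp add: v_def)
  have form: "0 \<le> a * x\<^sup>2 + 2 * x * (\<Sum>i<N. c i * v i) + qform N (\<lambda>i j. M (Suc i) (Suc j)) c"
    for x c
    using Suc.prems(2)[of "\<lambda>i. case i of 0 \<Rightarrow> x | Suc i \<Rightarrow> c i"]
    by (simp add: qform_Suc sym v_def[symmetric] a_def[symmetric])
  have a: "0 \<le> a"
    using form[of 1 "\<lambda>_. 0"] by (simp add: qform_def)
  have v0: "v j = 0" if "a = 0" "j < N" for j
  proof (rule affine_nonneg_imp_zero)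
    fix x
    have "(\<Sum>i<N. (if i = j then 1 else 0) * v i) = v j"
      using that(2) by (subst sum.remove[of _ j]) auto
    then show "0 \<le> 2 * x * v j + qform N (\<lambda>i j. M (Suc i) (Suc j)) (\<lambda>i. if i = j then 1 else 0)"
      using form[of x "\<lambda>i. if i = j then 1 else 0"] that(1) by simp
  qed
  define M' where "M' i j = M (Suc i) (Suc j) - v i * v j / a" for i j
  have "qform N M' c = qform N (\<lambda>i j. M (Suc i) (Suc j)) c - (\<Sum>i<N. c i * v i)\<^sup>2 / a" for c
    by (simp add: qform_def M'_def power2_eq_square sum_product right_diff_distrib
        sum_subtractf sum_divide_distrib mult_ac)
  \<comment> \<open>The first point given to \<open>form\<close> minimizes it in the first
    coordinate, and the minimum is the form of the Schur complement.\<close>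
  moreover have "0 \<le> qform N (\<lambda>i j. M (Suc i) (Suc j)) c - (\<Sum>i<N. c i * v i)\<^sup>2 / a" for c
    using form[of "- (\<Sum>i<N. c i * v i) / a" c] form[of 0 c] a
    by (cases "a = 0") (auto simp: power2_eq_square field_simps)
  ultimately have "0 \<le> qform N M' c" for c
    by simp
  moreover have "M' i j = M' j i" for i j
    using Suc.prems(1)[of "Suc i" "Suc j"] by (simp add: M'_def mult.commute)
  ultimately obtain L where L: "\<And>i j. i < N \<Longrightarrow> j < N \<Longrightarrow> M' i j = (\<Sum>k<N. L i k * L j k)"
      and L0: "\<And>i k. i < k \<Longrightarrow> L i k = 0"
    using Suc.IH[of M'] by blast
  define L' where "L' i k = (case i of 0 \<Rightarrow> if k = 0 then sqrt a else 0
      | Suc i \<Rightarrow> (case k of 0 \<Rightarrow> v i / sqrt a | Suc k \<Rightarrow> L i k))" for i k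
  have sq: "sqrt a * sqrt a = a"
    using a by simp
  have col: "sqrt a * (v i / sqrt a) = v i" if "i < N" for i
    using v0[of i] that by (cases "a = 0") auto
  have corner: "M (Suc i) (Suc j) = v i / sqrt a * (v j / sqrt a) + (\<Sum>k<N. L i k * L j k)"
    if "i < N" "j < N" for i j
    unfolding L[OF that, symmetric] M'_def by (simp add: sq a)
  have "M i j = (\<Sum>k<Suc N. L' i k * L' j k)" if ij: "i < Suc N" "j < Suc N" for i j
  proof (cases i; cases j)
    assume "i = 0" "j = 0"
    then show ?thesis
      using sq by (simp add: L'_def a_def del: sum.lessThan_Suc add: sum.lessThan_Suc_shift)
  next
    fix j' assume "i = 0" "j = Suc j'"
    then show ?thesis
      using ij col[of j'] by (simp add: L'_def v_def sum.lessThan_Suc_shift del: sum.lessThan_Suc)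
  next
    fix i' assume "i = Suc i'" "j = 0"
    then show ?thesis
      using ij col[of i'] sym[of i']
      by (simp add: L'_def sum.lessThan_Suc_shift mult.commute del: sum.lessThan_Suc)
  next
    fix i' j' assume "i = Suc i'" "j = Suc j'"
    then show ?thesis
      using ij corner[of i' j'] by (simp add: L'_def sum.lessThan_Suc_shift del: sum.lessThan_Suc)
  qed
  moreover have "L' i k = 0" if "i < k" for i k
    using that L0 by (cases i; cases k) (auto simp: L'_def)
  ultimately show ?case by blast
qed

lemma dt_gram: "dt N (\<lambda>i j. \<Sum>k<N. L i k * L j k) = (dt N L)\<^sup>2"
  using dt_mult[of N L "\<lambda>i j. L j i"] by (simp only: dt_transpose[of N L] power2_eq_square)

text \<open>A triangular factor turns the determinant into
  \<open>\<Prod>i<N. (L i i)\<^sup>2\<close>, and each factor is one of the squares that add up to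
  the diagonal entry \<open>M i i\<close>.\<close>

lemma hadamard:
  assumes "\<And>i j. M i j = M j i" and "\<And>c. 0 \<le> qform N M c"
  shows "dt N M \<le> (\<Prod>i<N. M i i)"
proof -
  obtain L where L: "\<And>i j. i < N \<Longrightarrow> j < N \<Longrightarrow> M i j = (\<Sum>k<N. L i k * L j k)"
      and L0: "\<And>i k. i < k \<Longrightarrow> L i k = 0"
    using cholesky[OF assms] by metis
  have "dt N M = (dt N L)\<^sup>2"
    unfolding dt_gram[symmetric] by (rule dt_cong) (rule L)
  also have "\<dots> = (\<Prod>i<N. (L i i)\<^sup>2)"
    by (simp add: dt_lower_triangular L0 prod_power_distrib)
  also have "\<dots> \<le> (\<Prod>i<N. M i i)"
  proof (intro prod_mono conjI)
    fix i assume "i \<in> {..<N}"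
    then show "(L i i)\<^sup>2 \<le> M i i"
      using member_le_sum[of i "{..<N}" "\<lambda>k. (L i k)\<^sup>2"] by (auto simp: L power2_eq_square)
  qed auto
  finally show ?thesis .
qed

lemma has_sum_finite_sum:
  fixes f :: "'i \<Rightarrow> 'a \<Rightarrow> 'b :: topological_comm_monoid_add"
  assumes "\<And>i. i \<in> I \<Longrightarrow> (f i has_sum s i) A"
  shows "((\<lambda>a. \<Sum>i\<in>I. f i a) has_sum (\<Sum>i\<in>I. s i)) A"
  using assms by (induction I rule: infinite_finite_induct) (auto intro: has_sum_add)

text \<open>The function \<open>\<kappa>\<close> is the Christoffel function of the biorthogonal ensemble with weight
  functions \<open>\<phi> _ i\<close>, that is, its one-point correlation function. After whitening the Gram matrix,
  the determinant bound is Hadamard's inequality together with \<open>x \<le> exp (x - 1)\<close>.\<close>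

lemma christoffel_bound:
  fixes \<phi> :: "'a \<Rightarrow> nat \<Rightarrow> real"
  defines "G \<equiv> \<lambda>w i j. \<Sum>\<^sub>\<infinity>a. w a * \<phi> a i * \<phi> a j"
  assumes summ: "\<And>i j. (\<lambda>a. \<phi> a i * \<phi> a j) summable_on UNIV"
    and pos: "dt N (G (\<lambda>_. 1)) \<noteq> 0"
  obtains \<kappa> where "\<And>a. 0 \<le> \<kappa> a" and "(\<kappa> has_sum real N) UNIV"
    and "\<And>a. \<exists>c. \<kappa> a = (\<Sum>i<N. c i * \<phi> a i) \<and> \<kappa> a = qform N (G (\<lambda>_. 1)) c"
    and "\<And>w. (\<And>a. 0 \<le> w a) \<Longrightarrow>
      (\<And>i j. (\<lambda>a. w a * \<phi> a i * \<phi> a j) summable_on UNIV) \<Longrightarrow>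
      (\<lambda>a. w a * \<kappa> a) summable_on UNIV \<and>
      dt N (G w) \<le> dt N (G (\<lambda>_. 1)) * exp ((\<Sum>\<^sub>\<infinity>a. w a * \<kappa> a) - real N)"
proof -
  have G_has_sum: "((\<lambda>a. w a * \<phi> a i * \<phi> a j) has_sum G w i j) UNIV"
    if "(\<lambda>a. w a * \<phi> a i * \<phi> a j) summable_on UNIV" for w i j
    unfolding G_def using that by (rule has_sum_infsum)
  have bilinear: "((\<lambda>a. w a * (\<Sum>i<N. c i * \<phi> a i) * (\<Sum>j<N. d j * \<phi> a j)) has_sum
      (\<Sum>i<N. \<Sum>j<N. c i * d j * G w i j)) UNIV"
    if "\<And>i j. (\<lambda>a. w a * \<phi> a i * \<phi> a j) summable_on UNIV" for w c d
  proof -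
    have "((\<lambda>a. \<Sum>i<N. \<Sum>j<N. c i * d j * (w a * \<phi> a i * \<phi> a j)) has_sum
        (\<Sum>i<N. \<Sum>j<N. c i * d j * G w i j)) UNIV"
      by (intro has_sum_finite_sum has_sum_cmult_right G_has_sum that)
    then show ?thesis
      by (simp add: sum_product sum_distrib_left mult_ac)
  qed
  have psd: "0 \<le> qform N (G w) c"
    if "\<And>a. 0 \<le> w a" "\<And>i j. (\<lambda>a. w a * \<phi> a i * \<phi> a j) summable_on UNIV" for w c
    unfolding qform_def
    by (rule has_sum_nonneg[OF bilinear[OF that(2), of c c]]) (simp_all add: that(1) mult.assoc)
  have sym: "G w i j = G w j i" for w i j
    unfolding G_def by (simp add: mult_ac)
  have summ1: "(\<lambda>a. 1 * \<phi> a i * \<phi> a j) summable_on UNIV" for i j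
    using summ by simp
  obtain L where L: "\<And>i j. i < N \<Longrightarrow> j < N \<Longrightarrow> G (\<lambda>_. 1) i j = (\<Sum>k<N. L i k * L j k)"
  proof -
    have "\<exists>L. (\<forall>i<N. \<forall>j<N. G (\<lambda>_. 1) i j = (\<Sum>k<N. L i k * L j k)) \<and> (\<forall>i k. i < k \<longrightarrow> L i k = 0)"
      by (rule cholesky[OF sym psd]) (simp_all add: summ)
    then show ?thesis
      using that by blast
  qed
  have detG: "dt N (G (\<lambda>_. 1)) = (dt N L)\<^sup>2"
    unfolding dt_gram[symmetric] by (rule dt_cong) (rule L)
  with pos have "dt N L \<noteq> 0" by auto
  then obtain T where T: "\<And>i j. i < N \<Longrightarrow> j < N \<Longrightarrow> (\<Sum>k<N. T i k * L k j) = (if i = j then 1 else 0)"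
      and detT: "dt N T * dt N L = 1"
    by (rule dt_inverse) blast
  have white: "(\<Sum>i<N. \<Sum>j<N. T k i * T l j * G (\<lambda>_. 1) i j) = (if k = l then 1 else 0)"
    if "k < N" "l < N" for k l
  proof -
    have "(\<Sum>i<N. \<Sum>j<N. T k i * T l j * G (\<lambda>_. 1) i j)
        = (\<Sum>i<N. \<Sum>j<N. \<Sum>r<N. (T k i * L i r) * (T l j * L j r))"
      by (intro sum.cong refl) (simp add: L sum_distrib_left mult_ac)
    also have "\<dots> = (\<Sum>i<N. \<Sum>r<N. \<Sum>j<N. (T k i * L i r) * (T l j * L j r))"
      by (rule sum.cong[OF refl], rule sum.swap)
    also have "\<dots> = (\<Sum>r<N. \<Sum>i<N. \<Sum>j<N. (T k i * L i r) * (T l j * L j r))"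
      by (rule sum.swap)
    also have "\<dots> = (\<Sum>r<N. (\<Sum>i<N. T k i * L i r) * (\<Sum>j<N. T l j * L j r))"
      by (simp add: sum_product)
    also have "\<dots> = (\<Sum>r<N. if k = r then (if l = r then 1 else 0) else 0)"
      using that by (intro sum.cong) (auto simp: T)
    also have "\<dots> = (if k = l then 1 else 0)"
      using that by simp
    finally show ?thesis .
  qed
  \<comment> \<open>Orthonormal basis of the span of the functions \<open>\<phi> _ i\<close>;
    \<open>\<kappa>\<close> is the diagonal of its reproducing kernel.\<close>
  define \<psi> where "\<psi> a k = (\<Sum>i<N. T k i * \<phi> a i)" for a k
  define \<kappa> where "\<kappa> a = (\<Sum>k<N. (\<psi> a k)\<^sup>2)" for a
  have \<psi>_has_sum: "((\<lambda>a. w a * (\<psi> a k * \<psi> a l)) has_sum (\<Sum>i<N. \<Sum>j<N. T k i * T l j * G w i j)) UNIV"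
    if "\<And>i j. (\<lambda>a. w a * \<phi> a i * \<phi> a j) summable_on UNIV" for w k l
    unfolding \<psi>_def mult.assoc[symmetric] by (rule bilinear[OF that])
  have \<kappa>_has_sum: "((\<lambda>a. w a * \<kappa> a) has_sum (\<Sum>k<N. \<Sum>i<N. \<Sum>j<N. T k i * T k j * G w i j)) UNIV"
    if "\<And>i j. (\<lambda>a. w a * \<phi> a i * \<phi> a j) summable_on UNIV" for w
    unfolding \<kappa>_def sum_distrib_left power2_eq_square
    by (intro has_sum_finite_sum \<psi>_has_sum that)
  show ?thesis
  proof (rule that)
    show "0 \<le> \<kappa> a" for a
      unfolding \<kappa>_def by (simp add: sum_nonneg)
    show "(\<kappa> has_sum real N) UNIV"
      using \<kappa>_has_sum[OF summ1] by (simp add: white)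
    show "\<exists>c. \<kappa> a = (\<Sum>i<N. c i * \<phi> a i) \<and> \<kappa> a = qform N (G (\<lambda>_. 1)) c" for a
    proof (intro exI conjI)
      \<comment> \<open>Coefficients of the reproducing kernel at \<open>a\<close>. Its value at
        \<open>a\<close> equals its squared norm, which is why the single number
        \<open>\<kappa> a\<close> has both representations.\<close>
      let ?c = "\<lambda>i. \<Sum>k<N. \<psi> a k * T k i"
      show "\<kappa> a = (\<Sum>i<N. ?c i * \<phi> a i)"
      proof -
        have "\<kappa> a = (\<Sum>k<N. \<Sum>i<N. \<psi> a k * T k i * \<phi> a i)"
          unfolding \<kappa>_def power2_eq_square
          by (subst (2) \<psi>_def) (simp only: sum_distrib_left mult.assoc)
        also have "\<dots> = (\<Sum>i<N. ?c i * \<phi> a i)"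
          unfolding sum_distrib_right by (rule sum.swap)
        finally show ?thesis .
      qed
      have "?c i * ?c j * G (\<lambda>_. 1) i j
          = (\<Sum>k<N. \<Sum>l<N. \<psi> a k * \<psi> a l * (T k i * T l j * G (\<lambda>_. 1) i j))" for i j
        by (subst sum_product) (simp add: sum_distrib_left mult_ac)
      then have "qform N (G (\<lambda>_. 1)) ?c
          = (\<Sum>i<N. \<Sum>j<N. \<Sum>k<N. \<Sum>l<N. \<psi> a k * \<psi> a l * (T k i * T l j * G (\<lambda>_. 1) i j))"
        unfolding qform_def by simp
      also have "\<dots> = (\<Sum>i<N. \<Sum>k<N. \<Sum>j<N. \<Sum>l<N. \<psi> a k * \<psi> a l * (T k i * T l j * G (\<lambda>_. 1) i j))"
        by (rule sum.cong[OF refl], rule sum.swap)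
      also have "\<dots> = (\<Sum>k<N. \<Sum>i<N. \<Sum>l<N. \<Sum>j<N. \<psi> a k * \<psi> a l * (T k i * T l j * G (\<lambda>_. 1) i j))"
        by (subst sum.swap) (rule sum.cong[OF refl], rule sum.cong[OF refl], rule sum.swap)
      also have "\<dots> = (\<Sum>k<N. \<Sum>l<N. \<Sum>i<N. \<Sum>j<N. \<psi> a k * \<psi> a l * (T k i * T l j * G (\<lambda>_. 1) i j))"
        by (rule sum.cong[OF refl], rule sum.swap)
      also have "\<dots> = (\<Sum>k<N. \<Sum>l<N. \<psi> a k * \<psi> a l *
          (\<Sum>i<N. \<Sum>j<N. T k i * T l j * G (\<lambda>_. 1) i j))"
        by (simp only: sum_distrib_left)
      also have "\<dots> = (\<Sum>k<N. \<Sum>l<N. \<psi> a k * \<psi> a l * (if k = l then 1 else 0))"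
        by (intro sum.cong refl) (simp add: white)
      also have "\<dots> = \<kappa> a"
        unfolding \<kappa>_def by (simp add: power2_eq_square if_distrib cong: if_cong)
      finally show "\<kappa> a = qform N (G (\<lambda>_. 1)) ?c" by simp
    qed
    fix w :: "'a \<Rightarrow> real"
    assume w: "\<And>a. 0 \<le> w a"
      "\<And>i j. (\<lambda>a. w a * \<phi> a i * \<phi> a j) summable_on UNIV"
    \<comment> \<open>Weighted Gram matrix in the orthonormal basis: its determinant is the ratio of
      the two Gram determinants, and its trace is the sum of
      \<open>w a * \<kappa> a\<close>.\<close>
    define H where "H k l = (\<Sum>i<N. \<Sum>j<N. T k i * T l j * G w i j)" for k l
    have H_has_sum: "((\<lambda>a. w a * (\<psi> a k * \<psi> a l)) has_sum H k l) UNIV" for k l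
      unfolding H_def by (rule \<psi>_has_sum[OF w(2)])
    have "dt N H = dt N (\<lambda>k l. \<Sum>i<N. T k i * (\<Sum>j<N. G w i j * T l j))"
      by (rule dt_cong) (simp add: H_def sum_distrib_left mult_ac)
    also have "\<dots> = dt N T * (dt N (G w) * dt N T)"
      using dt_mult[of N T "\<lambda>i l. \<Sum>j<N. G w i j * T l j"] dt_mult[of N "G w" "\<lambda>j l. T l j"]
      by (simp only: dt_transpose[of N T])
    finally have "(dt N L)\<^sup>2 * dt N H = (dt N T * dt N L)\<^sup>2 * dt N (G w)"
      by (simp add: power2_eq_square mult_ac)
    then have "dt N (G w) = (dt N L)\<^sup>2 * dt N H"
      by (simp add: detT)
    moreover have "dt N H \<le> (\<Prod>k<N. H k k)"
    proof (rule hadamard)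
      show "H i j = H j i" for i j
        unfolding H_def by (subst sum.swap) (simp add: sym[of w] mult_ac)
      show "0 \<le> qform N H c" for c
      proof (rule has_sum_nonneg)
        have "((\<lambda>a. \<Sum>i<N. \<Sum>j<N. c i * c j * (w a * (\<psi> a i * \<psi> a j))) has_sum qform N H c) UNIV"
          unfolding qform_def by (intro has_sum_finite_sum has_sum_cmult_right H_has_sum)
        then show "((\<lambda>a. w a * (\<Sum>i<N. c i * \<psi> a i)\<^sup>2) has_sum qform N H c) UNIV"
          by (simp add: sum_product sum_distrib_left power2_eq_square mult_ac)
      qed (simp add: w(1))
    qed
    moreover have "(\<Prod>k<N. H k k) \<le> (\<Prod>k<N. exp (H k k - 1))"
    proof (intro prod_mono conjI)
      fix k
      show "0 \<le> H k k"
        by (rule has_sum_nonneg[OF H_has_sum[of k k]]) (simp add: w(1))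
      show "H k k \<le> exp (H k k - 1)"
        using exp_ge_add_one_self[of "H k k - 1"] by simp
    qed
    moreover have "(\<Prod>k<N. exp (H k k - 1)) = exp ((\<Sum>k<N. H k k) - real N)"
      by (simp add: exp_sum[symmetric] sum_subtractf)
    moreover have \<kappa>w: "((\<lambda>a. w a * \<kappa> a) has_sum (\<Sum>k<N. H k k)) UNIV"
      unfolding H_def by (rule \<kappa>_has_sum[OF w(2)])
    ultimately show "(\<lambda>a. w a * \<kappa> a) summable_on UNIV \<and>
        dt N (G w) \<le> dt N (G (\<lambda>_. 1)) * exp ((\<Sum>\<^sub>\<infinity>a. w a * \<kappa> a) - real N)"
      unfolding detG infsumI[OF \<kappa>w]
      using has_sum_imp_summable[OF \<kappa>w] by (simp add: mult_left_mono)
  qed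
qed

section \<open>The Cauchy--Binet inequality\<close>

lemma dt_row_permute:
  assumes "p permutes {0..<N}"
  shows "dt N (\<lambda>i j. A (p i) j) = signof p * dt N A"
proof -
  have "mat N N (\<lambda>(i, j). A (p i) j) = mat N N (\<lambda>(i, j). mat N N (\<lambda>(i, j). A i j) $$ (p i, j))"
    using permutes_in_image[OF assms] by (intro eq_matI) auto
  then show ?thesis
    unfolding dt_def using det_permute_rows[of "mat N N (\<lambda>(i, j). A i j)" N p] assms by simp
qed

text \<open>Only one inequality of the Cauchy--Binet formula is needed. Expanding the determinant over all
  maps \<open>{0..<N} \<rightarrow> B\<close> and symmetrizing gives \<open>N!\<close> times a sum of squares, in which the rows \<open>f x\<close> and
  their permutations occur as distinct terms.\<close>

lemma cauchy_binet_le: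
  fixes \<phi> :: "'a \<Rightarrow> nat \<Rightarrow> real" and w :: "'a \<Rightarrow> real"
  assumes B: "finite B" and w: "\<And>a. 0 \<le> w a"
    and F: "finite F" "\<And>x i. x \<in> F \<Longrightarrow> i < N \<Longrightarrow> f x i \<in> B"
    and inj: "\<And>x y p q. x \<in> F \<Longrightarrow> y \<in> F \<Longrightarrow> p permutes {0..<N} \<Longrightarrow> q permutes {0..<N} \<Longrightarrow>
      (\<forall>i<N. f x (p i) = f y (q i)) \<Longrightarrow> x = y \<and> p = q"
  shows "(\<Sum>x\<in>F. (dt N (\<lambda>i j. \<phi> (f x i) j))\<^sup>2 * (\<Prod>i<N. w (f x i)))
    \<le> dt N (\<lambda>i j. \<Sum>a\<in>B. w a * \<phi> a i * \<phi> a j)"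
proof -
  define P where "P = {p. p permutes {0..<N}}"
  define E where "E = {0..<N} \<rightarrow>\<^sub>E B"
  define d where "d g = dt N (\<lambda>i j. \<phi> (g i) j)" for g
  define W where "W g = (\<Prod>i = 0..<N. w (g i))" for g
  have finP: "finite P" and finE: "finite E"
    unfolding P_def E_def using B by (auto intro: finite_permutations finite_PiE)
  have cardP: "card P = fact N"
    unfolding P_def by (subst card_permutations[of _ N]) auto
  define r where "r g p = restrict (\<lambda>i. g (p i)) {0..<N}" for g :: "nat \<Rightarrow> 'a" and p :: "nat \<Rightarrow> nat"
  have d_cong: "d g = d g'" if "\<And>i. i < N \<Longrightarrow> g i = g' i" for g g'
    unfolding d_def by (rule dt_cong) (simp add: that)
  have d_r: "d (r g p) = signof p * d g" if "p \<in> P" for g p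
    using that dt_row_permute[of p N "\<lambda>i j. \<phi> (g i) j"] unfolding P_def
    by (subst d_cong[of "r g p" "\<lambda>i. g (p i)"]) (auto simp: r_def d_def)
  have W_r: "W (r g p) = W g" if "p \<in> P" for g p
  proof -
    have "W (r g p) = (\<Prod>i = 0..<N. w (g (p i)))"
      unfolding W_def r_def by (rule prod.cong) auto
    also have "\<dots> = W g"
      unfolding W_def using that prod.permute[of p "{0..<N}" "\<lambda>i. w (g i)"] by (simp add: P_def comp_def)
    finally show ?thesis .
  qed
  have r_bij: "bij_betw (\<lambda>g. r g p) E E" if "p \<in> P" for p
  proof (rule bij_betwI[where g = "\<lambda>g. r g (Hilbert_Choice.inv p)"])
    have p: "p permutes {0..<N}" "Hilbert_Choice.inv p permutes {0..<N}"
      using that permutes_inv by (auto simp: P_def)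
    have *: "r g q \<in> E" if "g \<in> E" "q permutes {0..<N}" for g q
      using that permutes_in_image[OF that(2)] by (auto simp: E_def r_def PiE_iff)
    show "(\<lambda>g. r g p) \<in> E \<rightarrow> E" "(\<lambda>g. r g (Hilbert_Choice.inv p)) \<in> E \<rightarrow> E"
      using * p by auto
    show "r (r g p) (Hilbert_Choice.inv p) = g" "r (r g (Hilbert_Choice.inv p)) p = g" if "g \<in> E" for g
      using that permutes_in_image[OF p(1)] permutes_in_image[OF p(2)] permutes_inverses[OF p(1)]
      by (auto simp: r_def E_def fun_eq_iff PiE_iff extensional_def)
  qed
  have "dt N (\<lambda>i j. \<Sum>a\<in>B. w a * \<phi> a i * \<phi> a j)
      = (\<Sum>p\<in>P. signof p * (\<Sum>g\<in>E. \<Prod>i = 0..<N. w (g i) * \<phi> (g i) i * \<phi> (g i) (p i)))"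
    unfolding dt_expand P_def E_def using B by (subst prod_sum_PiE) auto
  also have "\<dots> = (\<Sum>g\<in>E. \<Sum>p\<in>P. W g * (\<Prod>i = 0..<N. \<phi> (g i) i) *
      (signof p * (\<Prod>i = 0..<N. \<phi> (g i) (p i))))"
    unfolding sum_distrib_left W_def
    by (subst sum.swap) (simp add: prod.distrib mult_ac)
  also have "\<dots> = (\<Sum>g\<in>E. W g * (\<Prod>i = 0..<N. \<phi> (g i) i) * d g)"
    unfolding sum_distrib_left[symmetric] d_def dt_expand P_def ..
  finally have det: "dt N (\<lambda>i j. \<Sum>a\<in>B. w a * \<phi> a i * \<phi> a j)
    = (\<Sum>g\<in>E. W g * (\<Prod>i = 0..<N. \<phi> (g i) i) * d g)" .
  have "fact N * dt N (\<lambda>i j. \<Sum>a\<in>B. w a * \<phi> a i * \<phi> a j)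
      = (\<Sum>p\<in>P. \<Sum>g\<in>E. W g * (\<Prod>i = 0..<N. \<phi> (g i) i) * d g)"
    unfolding det by (simp add: cardP)
  \<comment> \<open>Rearranging the rows of \<open>g\<close> by \<open>p\<close> permutes
    \<open>E\<close>, fixes \<open>W\<close> and multiplies \<open>d\<close> by the sign of
    \<open>p\<close>, so the sum over \<open>p\<close> completes the diagonal product to a second
    determinant.\<close>
  also have "\<dots> = (\<Sum>p\<in>P. \<Sum>g\<in>E. W (r g p) * (\<Prod>i = 0..<N. \<phi> (r g p i) i) * d (r g p))"
    by (rule sum.cong[OF refl], rule sum.reindex_bij_betw[symmetric, OF r_bij])
  also have "\<dots> = (\<Sum>p\<in>P. \<Sum>g\<in>E. W g * d g * (signof p * (\<Prod>i = 0..<N. \<phi> (g (p i)) i)))"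
    by (intro sum.cong refl) (simp add: d_r W_r, simp add: r_def)
  also have "\<dots> = (\<Sum>g\<in>E. \<Sum>p\<in>P. W g * d g * (signof p * (\<Prod>i = 0..<N. \<phi> (g (p i)) i)))"
    by (rule sum.swap)
  also have "\<dots> = (\<Sum>g\<in>E. W g * d g * d g)"
  proof (rule sum.cong[OF refl])
    fix g
    have "(\<Sum>p\<in>P. signof p * (\<Prod>i = 0..<N. \<phi> (g (p i)) i)) = dt N (\<lambda>i j. \<phi> (g j) i)"
      unfolding dt_expand P_def ..
    also have "\<dots> = d g"
      unfolding d_def by (rule dt_transpose)
    finally show "(\<Sum>p\<in>P. W g * d g * (signof p * (\<Prod>i = 0..<N. \<phi> (g (p i)) i))) = W g * d g * d g"
      unfolding sum_distrib_left[symmetric] by simp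
  qed
  finally have total: "fact N * dt N (\<lambda>i j. \<Sum>a\<in>B. w a * \<phi> a i * \<phi> a j) = (\<Sum>g\<in>E. W g * (d g)\<^sup>2)"
    by (simp add: power2_eq_square mult.assoc)
  have injr: "inj_on (\<lambda>(x, p). r (f x) p) (F \<times> P)"
  proof (rule inj_onI, clarify)
    fix x p y q assume *: "x \<in> F" "y \<in> F" "p \<in> P" "q \<in> P" "r (f x) p = r (f y) q"
    have "f x (p i) = f y (q i)" if "i < N" for i
      using fun_cong[OF *(5), of i] that by (simp add: r_def)
    then show "x = y \<and> p = q"
      using inj[of x y p q] * by (simp add: P_def)
  qed
  have sign2: "(real_of_int (sign p))\<^sup>2 = 1" for p :: "nat \<Rightarrow> nat"
    by (simp add: sign_def)
  \<comment> \<open>Here \<open>fact N\<close> is the number of rearrangements of one row family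
    \<open>f x\<close>, all with the same weight and the same squared determinant.\<close>
  have "fact N * (\<Sum>x\<in>F. (d (f x))\<^sup>2 * W (f x)) = (\<Sum>x\<in>F. \<Sum>p\<in>P. W (r (f x) p) * (d (r (f x) p))\<^sup>2)"
    unfolding sum_distrib_left
    by (intro sum.cong refl) (simp add: d_r W_r power_mult_distrib cardP sign2 mult_ac)
  also have "\<dots> = (\<Sum>z\<in>F \<times> P. (\<lambda>g. W g * (d g)\<^sup>2) ((\<lambda>(x, p). r (f x) p) z))"
    by (simp add: sum.cartesian_product case_prod_unfold)
  also have "\<dots> = (\<Sum>g\<in>(\<lambda>(x, p). r (f x) p) ` (F \<times> P). W g * (d g)\<^sup>2)"
    by (rule sum.reindex[OF injr, symmetric, unfolded comp_def])
  also have "\<dots> \<le> (\<Sum>g\<in>E. W g * (d g)\<^sup>2)"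
  proof (rule sum_mono2[OF finE])
    show "(\<lambda>(x, p). r (f x) p) ` (F \<times> P) \<subseteq> E"
      using F(2) permutes_in_image by (fastforce simp: E_def r_def P_def)
    show "0 \<le> W g * (d g)\<^sup>2" for g
      unfolding W_def by (intro mult_nonneg_nonneg prod_nonneg) (auto simp: w)
  qed
  finally have "(\<Sum>x\<in>F. (d (f x))\<^sup>2 * W (f x)) \<le> dt N (\<lambda>i j. \<Sum>a\<in>B. w a * \<phi> a i * \<phi> a j)"
    unfolding total[symmetric] by simp
  then show ?thesis
    unfolding d_def W_def by (simp add: lessThan_atLeast0)
qed

text \<open>Limit of \<open>cauchy_binet_le\<close> along finite sets \<open>B\<close>: the left
  side is independent of \<open>B\<close> as soon as \<open>B\<close> contains the finitely many
  rows \<open>f x i\<close>.\<close>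

lemma cauchy_binet_infsum_le:
  fixes \<phi> :: "'a \<Rightarrow> nat \<Rightarrow> real" and w :: "'a \<Rightarrow> real"
  assumes summ: "\<And>i j. (\<lambda>a. w a * \<phi> a i * \<phi> a j) summable_on UNIV"
    and w: "\<And>a. 0 \<le> w a" and F: "finite F"
    and inj: "\<And>x y p q. x \<in> F \<Longrightarrow> y \<in> F \<Longrightarrow> p permutes {0..<N} \<Longrightarrow> q permutes {0..<N} \<Longrightarrow>
      (\<forall>i<N. f x (p i) = f y (q i)) \<Longrightarrow> x = y \<and> p = q"
  shows "(\<Sum>x\<in>F. (dt N (\<lambda>i j. \<phi> (f x i) j))\<^sup>2 * (\<Prod>i<N. w (f x i)))
    \<le> dt N (\<lambda>i j. \<Sum>\<^sub>\<infinity>a. w a * \<phi> a i * \<phi> a j)"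
proof (rule tendsto_lowerbound)
  show "((\<lambda>B. dt N (\<lambda>i j. \<Sum>a\<in>B. w a * \<phi> a i * \<phi> a j)) \<longlongrightarrow>
      dt N (\<lambda>i j. \<Sum>\<^sub>\<infinity>a. w a * \<phi> a i * \<phi> a j)) (finite_subsets_at_top UNIV)"
    by (intro tendsto_dt infsum_tendsto summ)
  have "\<forall>\<^sub>F B in finite_subsets_at_top UNIV. finite B \<and> (\<Union>x\<in>F. f x ` {..<N}) \<subseteq> B"
    using F by (subst eventually_finite_subsets_at_top) (auto intro!: exI[of _ "\<Union>x\<in>F. f x ` {..<N}"])
  then show "\<forall>\<^sub>F B in finite_subsets_at_top UNIV.
      (\<Sum>x\<in>F. (dt N (\<lambda>i j. \<phi> (f x i) j))\<^sup>2 * (\<Prod>i<N. w (f x i)))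
      \<le> dt N (\<lambda>i j. \<Sum>a\<in>B. w a * \<phi> a i * \<phi> a j)"
    by (rule eventually_mono) (intro cauchy_binet_le w F inj, auto)
qed simp

section \<open>Summation over the integers and Laurent recurrences\<close>

lemma summable_poly_geometric:
  fixes c :: real
  assumes "0 \<le> c" "c < 1"
  shows "summable (\<lambda>n. real n ^ p * c ^ n)"
proof -
  obtain d where d: "c < d" "d < 1" using dense[OF assms(2)] by auto
  have "(\<lambda>n. (1 + 1 / real n) ^ p * c) \<longlonglongrightarrow> (1 + 0) ^ p * c"
    by (intro tendsto_intros lim_1_over_n)
  then have "\<forall>\<^sub>F n in sequentially. (1 + 1 / real n) ^ p * c < d"
    using d(1) by (intro order_tendstoD(2)) auto
  then obtain n0 where n0: "\<And>n. n \<ge> n0 \<Longrightarrow> (1 + 1 / real n) ^ p * c < d"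
    unfolding eventually_sequentially by auto
  show ?thesis
  proof (rule summable_ratio_test[OF d(2)])
    fix n assume n: "max 1 n0 \<le> n"
    then have "real (Suc n) = (1 + 1 / real n) * real n"
      by (simp add: field_simps)
    then have "real (Suc n) ^ p * c ^ Suc n = ((1 + 1 / real n) ^ p * c) * (real n ^ p * c ^ n)"
      by (simp only: power_mult_distrib) simp
    also have "\<dots> \<le> d * (real n ^ p * c ^ n)"
      using n n0[of n] assms by (intro mult_right_mono) auto
    finally show "norm (real (Suc n) ^ p * c ^ Suc n) \<le> d * norm (real n ^ p * c ^ n)"
      using assms by simp
  qed
qed

lemma summable_on_int_abs:
  fixes f :: "nat \<Rightarrow> real"
  assumes "summable f" "\<And>n. 0 \<le> f n"
  shows "(\<lambda>k::int. f (nat \<bar>k\<bar>)) summable_on UNIV"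
proof -
  have f: "f summable_on UNIV"
    using assms by (intro norm_summable_imp_summable_on) simp
  have "(\<lambda>k::int. f (nat \<bar>k\<bar>)) summable_on range int"
    by (subst summable_on_reindex) (auto simp: comp_def f)
  moreover have "(\<lambda>k::int. f (nat \<bar>k\<bar>)) summable_on range (\<lambda>n. - int n)"
    by (subst summable_on_reindex) (auto simp: comp_def f inj_on_def)
  ultimately have "(\<lambda>k::int. f (nat \<bar>k\<bar>)) summable_on (range int \<union> range (\<lambda>n. - int n))"
    by (rule summable_on_union)
  moreover have "range int \<union> range (\<lambda>n. - int n) = UNIV"
    by (auto intro: int_cases2)
  ultimately show ?thesis by simp
qed

lemma summable_on_int_poly_geometric:
  fixes c :: real
  assumes "0 \<le> c" "c < 1"
  shows "(\<lambda>k::int. \<bar>real_of_int k\<bar> ^ p * c ^ nat \<bar>k\<bar>) summable_on UNIV"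
  using summable_on_int_abs[OF summable_poly_geometric[OF assms, of p]] assms(1) by simp

lemma summable_on_bounded_by:
  fixes f g :: "'a \<Rightarrow> real"
  assumes "g summable_on A" "\<And>x. x \<in> A \<Longrightarrow> \<bar>f x\<bar> \<le> g x"
  shows "f summable_on A"
  by (rule abs_summable_summable, rule summable_on_comparison_test[OF assms(1)])
    (use assms(2) in auto)

lemma summable_on_abs_real:
  fixes f :: "'a \<Rightarrow> real"
  shows "f summable_on A \<Longrightarrow> (\<lambda>x. \<bar>f x\<bar>) summable_on A"
  by (subst (asm) summable_on_iff_abs_summable_on_real) simp

lemma summable_on_bounded_mult:
  fixes f g :: "'a \<Rightarrow> real"
  assumes "g summable_on A" "\<And>x. x \<in> A \<Longrightarrow> \<bar>f x\<bar> \<le> C"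
  shows "(\<lambda>x. f x * g x) summable_on A"
proof (rule summable_on_bounded_by)
  show "(\<lambda>x. C * \<bar>g x\<bar>) summable_on A"
    using assms(1) by (intro summable_on_cmult_right summable_on_abs_real)
qed (auto simp: abs_mult intro!: mult_right_mono assms)

lemma summable_on_imp_bounded:
  fixes f :: "'a \<Rightarrow> real"
  assumes "f summable_on UNIV"
  obtains C where "\<And>x. \<bar>f x\<bar> \<le> C"
proof
  show "\<bar>f x\<bar> \<le> infsum (\<lambda>x. \<bar>f x\<bar>) UNIV" for x
    using finite_sum_le_infsum[OF summable_on_abs_real[OF assms], of "{x}"] by simp
qed

lemma bij_int_shift: "bij_betw (\<lambda>k::int. k + d) UNIV UNIV"
  by (rule bij_betwI[of _ _ _ "\<lambda>k. k - d"]) auto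

lemma has_sum_int_shift:
  fixes f :: "int \<Rightarrow> 'b :: {comm_monoid_add, topological_space}"
  shows "((\<lambda>k. f (k + d)) has_sum s) UNIV \<longleftrightarrow> (f has_sum s) UNIV"
  by (rule has_sum_reindex_bij_betw[OF bij_int_shift])

lemma infsum_int_shift:
  fixes f :: "int \<Rightarrow> 'b :: {comm_monoid_add, t2_space}"
  shows "(\<Sum>\<^sub>\<infinity>k. f (k + d)) = infsum f UNIV"
  by (rule infsum_reindex_bij_betw[OF bij_int_shift])

lemma summable_on_int_shift:
  fixes f :: "int \<Rightarrow> 'b :: {comm_monoid_add, t2_space}"
  shows "(\<lambda>k. f (k + d)) summable_on UNIV \<longleftrightarrow> f summable_on UNIV"
  by (rule summable_on_reindex_bij_betw[OF bij_int_shift])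

section \<open>Correlations of sequences on the integers\<close>

lemma summable_on_prod:
  fixes f g :: "int \<Rightarrow> real"
  assumes "f summable_on UNIV" "g summable_on UNIV"
  shows "(\<lambda>(i, j). f i * g j) summable_on UNIV \<times> UNIV"
proof -
  have "(\<lambda>z. norm (f (fst z) * g (snd z))) summable_on (UNIV \<times> UNIV)"
  proof (rule summable_on_SigmaI[where g = "\<lambda>i. \<bar>f i\<bar> * (\<Sum>\<^sub>\<infinity>j. \<bar>g j\<bar>)"])
    show "((\<lambda>j. norm (f (fst (i, j)) * g (snd (i, j)))) has_sum \<bar>f i\<bar> * (\<Sum>\<^sub>\<infinity>j. \<bar>g j\<bar>)) UNIV" for i
      unfolding fst_conv snd_conv real_norm_def abs_mult
      by (intro has_sum_cmult_right has_sum_infsum summable_on_abs_real assms)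
    show "(\<lambda>i. \<bar>f i\<bar> * (\<Sum>\<^sub>\<infinity>j. \<bar>g j\<bar>)) summable_on UNIV"
      by (intro summable_on_cmult_left summable_on_abs_real assms)
  qed auto
  then show ?thesis
    unfolding case_prod_unfold by (rule abs_summable_summable)
qed

text \<open>The coefficient of \<open>z ^ k\<close> in \<open>F z * G (1 / z)\<close>, where
  \<open>F\<close> and \<open>G\<close> are the Laurent series with coefficients \<open>f\<close>
  and \<open>g\<close>.\<close>

definition corr :: "(int \<Rightarrow> real) \<Rightarrow> (int \<Rightarrow> real) \<Rightarrow> int \<Rightarrow> real" where
  "corr f g k = (\<Sum>\<^sub>\<infinity>i. f (k + i) * g i)"

lemma corr_summable:
  fixes f g :: "int \<Rightarrow> real"
  assumes "f summable_on UNIV" "g summable_on UNIV"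
  shows "(\<lambda>i. f (k + i) * g i) summable_on UNIV"
proof -
  obtain C where "\<And>x. \<bar>f x\<bar> \<le> C" using summable_on_imp_bounded[OF assms(1)] by auto
  then show ?thesis by (intro summable_on_bounded_mult assms) auto
qed

lemma corr_has_sum:
  assumes "f summable_on UNIV" "g summable_on UNIV"
  shows "((\<lambda>i. f (k + i) * g i) has_sum corr f g k) UNIV"
  unfolding corr_def by (intro has_sum_infsum corr_summable assms)

text \<open>Evaluation of \<open>F z * G (1 / z)\<close> at \<open>z = 1\<close>, by Fubini after
  the shear \<open>(k, i) \<mapsto> (k + i, i)\<close>.\<close>

lemma infsum_corr:
  assumes f: "f summable_on UNIV" and g: "g summable_on UNIV"
  shows "((\<lambda>k. corr f g k) has_sum (infsum f UNIV * infsum g UNIV)) UNIV"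
proof -
  have bij: "bij_betw (\<lambda>(k, i). (k + i, i)) (UNIV \<times> UNIV) (UNIV \<times> (UNIV :: int set))"
    by (rule bij_betwI[of _ _ _ "\<lambda>(k, i). (k - i, i)"]) auto
  have "((\<lambda>(i, j). f i * g j) has_sum (infsum f UNIV * infsum g UNIV)) (UNIV \<times> UNIV)"
    using f g
    by (intro has_sum_SigmaI[where g = "\<lambda>i. f i * infsum g UNIV"] summable_on_prod)
      (auto intro!: has_sum_cmult_right has_sum_cmult_left)
  then have "((\<lambda>z. (\<lambda>(i, j). f i * g j) ((\<lambda>(k, i). (k + i, i)) z)) has_sum
      (infsum f UNIV * infsum g UNIV)) (UNIV \<times> UNIV)"
    by (subst has_sum_reindex_bij_betw[OF bij])
  then have "((\<lambda>(k, i). f (k + i) * g i) has_sum (infsum f UNIV * infsum g UNIV)) (UNIV \<times> UNIV)"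
    by (simp add: case_prod_unfold)
  then show ?thesis
    by (rule has_sum_SigmaD) (simp add: corr_has_sum f g)
qed

text \<open>Associativity of \<open>F z * G (1 / z) * U (1 / z)\<close>. Reflecting \<open>g\<close>
  turns its correlation with \<open>u\<close> into the ordinary product \<open>U z * G z\<close>,
  which the outer \<open>corr\<close> evaluates at \<open>1 / z\<close>.\<close>

lemma corr_corr:
  assumes f: "f summable_on UNIV" and g: "g summable_on UNIV" and u: "u summable_on UNIV"
  shows "corr (corr f g) u m = corr f (corr u (\<lambda>i. g (- i))) m"
proof -
  obtain C where C: "\<And>x. \<bar>g x\<bar> \<le> C" using summable_on_imp_bounded[OF g] by auto
  have "(\<lambda>z. g (snd z - fst z) * (\<lambda>(i, j). u i * f j) (fst z, snd z + m)) summable_on UNIV \<times> UNIV"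
  proof (rule summable_on_bounded_mult)
    show "(\<lambda>z. (\<lambda>(i, j). u i * f j) (fst z, snd z + m)) summable_on UNIV \<times> UNIV"
      using summable_on_prod[OF u, of "\<lambda>k. f (k + m)"] f
      by (simp add: summable_on_int_shift case_prod_unfold)
  qed (rule C)
  then have s: "(\<lambda>(i, n). f (m + n) * g (n - i) * u i) summable_on UNIV \<times> UNIV"
    by (simp add: case_prod_unfold mult_ac add_ac)
  have "corr (corr f g) u m = (\<Sum>\<^sub>\<infinity>i. (\<Sum>\<^sub>\<infinity>j. f (m + i + j) * g j) * u i)"
    unfolding corr_def ..
  also have "\<dots> = (\<Sum>\<^sub>\<infinity>i. (\<Sum>\<^sub>\<infinity>n. f (m + n) * g (n - i)) * u i)"
  proof (rule infsum_cong)
    fix i :: int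
    show "(\<Sum>\<^sub>\<infinity>j. f (m + i + j) * g j) * u i = (\<Sum>\<^sub>\<infinity>n. f (m + n) * g (n - i)) * u i"
      using infsum_int_shift[of "\<lambda>n. f (m + n) * g (n - i)" i] by (simp add: add_ac)
  qed
  also have "\<dots> = (\<Sum>\<^sub>\<infinity>i. \<Sum>\<^sub>\<infinity>n. f (m + n) * g (n - i) * u i)"
    by (simp add: infsum_cmult_left')
  also have "\<dots> = (\<Sum>\<^sub>\<infinity>n. \<Sum>\<^sub>\<infinity>i. f (m + n) * g (n - i) * u i)"
    by (rule infsum_swap_banach) (use s in simp)
  also have "\<dots> = (\<Sum>\<^sub>\<infinity>n. f (m + n) * (\<Sum>\<^sub>\<infinity>i. u i * g (n - i)))"
    by (simp add: infsum_cmult_right'[symmetric] mult_ac)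
  also have "\<dots> = corr f (corr u (\<lambda>i. g (- i))) m"
    unfolding corr_def
  proof (rule infsum_cong)
    fix n :: int
    show "f (m + n) * (\<Sum>\<^sub>\<infinity>i. u i * g (n - i)) = f (m + n) * (\<Sum>\<^sub>\<infinity>i. u (n + i) * g (- i))"
      using infsum_int_shift[of "\<lambda>i. u i * g (n - i)" n] by (simp add: add_ac)
  qed
  finally show ?thesis .
qed

text \<open>The relation \<open>euler_rec R \<alpha> f\<close> says that the Laurent series \<open>F\<close> with coefficients \<open>f\<close> satisfies
  \<open>z F'(z) = (\<Sum>r. \<alpha> r z ^ r) F(z)\<close>.\<close>

definition euler_rec :: "int set \<Rightarrow> (int \<Rightarrow> real) \<Rightarrow> (int \<Rightarrow> real) \<Rightarrow> bool" where
  "euler_rec R \<alpha> f \<longleftrightarrow> (\<forall>k. of_int k * f k = (\<Sum>r\<in>R. \<alpha> r * f (k - r)))"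

text \<open>The product rule for \<open>z * d / dz\<close> applied to
  \<open>F z * G (1 / z)\<close>; the inversion of \<open>z\<close> produces the minus sign. On
  coefficients it is the splitting \<open>k = (k + i) - i\<close>.\<close>

lemma corr_euler_rec:
  assumes f: "f summable_on UNIV" and g: "g summable_on UNIV"
    and rec: "euler_rec R \<alpha> f" "euler_rec S \<beta> g"
  shows "of_int k * corr f g k = (\<Sum>r\<in>R. \<alpha> r * corr f g (k - r)) - (\<Sum>r\<in>S. \<beta> r * corr f g (k + r))"
proof -
  have 1: "((\<lambda>i. \<Sum>r\<in>R. \<alpha> r * (f (k - r + i) * g i)) has_sum (\<Sum>r\<in>R. \<alpha> r * corr f g (k - r))) UNIV"
    by (intro has_sum_finite_sum has_sum_cmult_right corr_has_sum f g)
  have 2: "((\<lambda>i. \<Sum>r\<in>S. \<beta> r * (f (k + i) * g (i - r))) has_sum (\<Sum>r\<in>S. \<beta> r * corr f g (k + r))) UNIV"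
  proof (intro has_sum_finite_sum has_sum_cmult_right)
    fix r
    have "((\<lambda>i. f (k + r + (i + - r)) * g (i + - r)) has_sum corr f g (k + r)) UNIV"
      using has_sum_int_shift[of "\<lambda>i. f (k + r + i) * g i" "- r"] corr_has_sum[OF f g] by blast
    then show "((\<lambda>i. f (k + i) * g (i - r)) has_sum corr f g (k + r)) UNIV"
      by simp
  qed
  have "(\<Sum>r\<in>R. \<alpha> r * (f (k - r + i) * g i)) + - (\<Sum>r\<in>S. \<beta> r * (f (k + i) * g (i - r)))
      = of_int k * (f (k + i) * g i)" for i
  proof -
    have "(\<Sum>r\<in>R. \<alpha> r * (f (k - r + i) * g i)) = of_int (k + i) * f (k + i) * g i"
    proof -
      have "of_int (k + i) * f (k + i) = (\<Sum>r\<in>R. \<alpha> r * f (k + i - r))"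
        using rec(1) unfolding euler_rec_def by blast
      moreover have "k + i - r = k - r + i" for r by simp
      ultimately show ?thesis by (simp only: sum_distrib_right mult.assoc)
    qed
    moreover have "(\<Sum>r\<in>S. \<beta> r * (f (k + i) * g (i - r))) = f (k + i) * (of_int i * g i)"
    proof -
      have "of_int i * g i = (\<Sum>r\<in>S. \<beta> r * g (i - r))"
        using rec(2) unfolding euler_rec_def by blast
      then show ?thesis by (simp add: sum_distrib_left mult_ac)
    qed
    ultimately show ?thesis by (simp add: algebra_simps)
  qed
  then have "((\<lambda>i. of_int k * (f (k + i) * g i)) has_sum
      ((\<Sum>r\<in>R. \<alpha> r * corr f g (k - r)) + - (\<Sum>r\<in>S. \<beta> r * corr f g (k + r)))) UNIV"
    using has_sum_add[OF 1 has_sum_cmult_right[OF 2, of "-1"]] by simp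
  moreover have "((\<lambda>i. of_int k * (f (k + i) * g i)) has_sum (of_int k * corr f g k)) UNIV"
    by (intro has_sum_cmult_right corr_has_sum f g)
  ultimately show ?thesis
    using has_sum_unique by fastforce
qed

text \<open>The factor \<open>k\<close> on the left of the recurrence makes the coefficients decay
  faster than any geometric sequence. A step back by at most \<open>R\<close> costs at most
  \<open>1 / c ^ R\<close>, which this factor absorbs as soon as \<open>k \<ge> S / c ^ R\<close>;
  smaller \<open>k\<close> go into the constant \<open>A\<close>.\<close>

lemma euler_rec_geometric_bound:
  assumes "euler_rec {1..R} \<alpha> f" "\<And>k. k < 0 \<Longrightarrow> f k = 0" and c: "0 < c" "c \<le> 1"
  obtains A where "0 \<le> A" and "\<And>k. \<bar>f k\<bar> \<le> A * c ^ nat \<bar>k\<bar>"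
proof -
  define S where "S = (\<Sum>r=1..R. \<bar>\<alpha> r\<bar>)"
  define k0 where "k0 = nat \<lceil>S / c ^ nat R\<rceil>"
  define A where "A = (\<Sum>k\<le>k0. \<bar>f (int k)\<bar> / c ^ k)"
  have A0: "0 \<le> A"
    unfolding A_def using c by (intro sum_nonneg) auto
  have nonneg: "\<bar>f (int k)\<bar> \<le> A * c ^ k" for k
  proof (induction k rule: less_induct)
    case (less k)
    show ?case
    proof (cases "k \<le> k0")
      case True
      then have "\<bar>f (int k)\<bar> / c ^ k \<le> A"
        unfolding A_def using c by (intro member_le_sum[of k "{..k0}" "\<lambda>k. \<bar>f (int k)\<bar> / c ^ k"]) auto
      then show ?thesis using c by (simp add: field_simps)
    next
      case False
      then have k: "0 < k" "S / c ^ nat R \<le> real k" by (auto simp: k0_def) linarith+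
      have bound: "\<bar>f (int k - r)\<bar> \<le> A * c ^ k / c ^ nat R" if "r \<in> {1..R}" for r
      proof (cases "r \<le> int k")
        case True
        define j where "j = nat (int k - r)"
        have j: "int k - r = int j" "j < k" "k \<le> j + nat R" using True that by (auto simp: j_def)
        have "c ^ (j + nat R) \<le> c ^ k" using c j by (intro power_decreasing) auto
        then have "A * c ^ j \<le> A * c ^ k / c ^ nat R"
          using c A0 by (simp add: field_simps power_add mult_left_mono)
        then show ?thesis using less[OF j(2)] j(1) by simp
      next
        case False
        then show ?thesis using assms(2)[of "int k - r"] c A0 by simp
      qed
      have "real k * \<bar>f (int k)\<bar> = \<bar>\<Sum>r=1..R. \<alpha> r * f (int k - r)\<bar>"
        using assms(1) unfolding euler_rec_def
        by (metis abs_mult abs_of_nat of_int_of_nat_eq)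
      also have "\<dots> \<le> (\<Sum>r=1..R. \<bar>\<alpha> r\<bar> * (A * c ^ k / c ^ nat R))"
        using mult_left_mono[OF bound]
        by (intro order.trans[OF sum_abs] sum_mono) (simp add: abs_mult)
      also have "\<dots> = S / c ^ nat R * (A * c ^ k)"
        unfolding S_def by (simp add: sum_distrib_right sum_divide_distrib)
      also have "\<dots> \<le> real k * (A * c ^ k)"
        using k c A0 by (intro mult_right_mono) auto
      finally show ?thesis using k(1) by simp
    qed
  qed
  show thesis
  proof (rule that[OF A0])
    show "\<bar>f k\<bar> \<le> A * c ^ nat \<bar>k\<bar>" for k
    proof (cases "0 \<le> k")
      case True
      then show ?thesis using nonneg[of "nat k"] by simp
    next
      case False
      then show ?thesis using assms(2)[of k] A0 c by simp
    qed
  qed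
qed

text \<open>Half of the decay rate pays for the sum: \<open>(1 / 4) ^ \<bar>i\<bar>\<close> is the
  product of two factors \<open>(1 / 2) ^ \<bar>i\<bar>\<close>, one of which joins
  \<open>(1 / 2) ^ \<bar>k + i\<bar>\<close> to give \<open>(1 / 2) ^ \<bar>k\<bar>\<close> while
  the other is summed. The constant is explicit because it has to be uniform under a rescaling of
  the times.\<close>

lemma corr_geometric_bound:
  assumes f: "\<And>k. \<bar>f k\<bar> \<le> A * (1 / 4) ^ nat \<bar>k\<bar>" and g: "\<And>k. \<bar>g k\<bar> \<le> B * (1 / 4) ^ nat \<bar>k\<bar>"
  shows "\<bar>corr f g k\<bar> \<le> A * B * (\<Sum>\<^sub>\<infinity>i::int. (1 / 2) ^ nat \<bar>i\<bar>) * (1 / 2) ^ nat \<bar>k\<bar>"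
proof -
  have AB: "0 \<le> A" "0 \<le> B" using f[of 0] g[of 0] by auto
  have geo: "(\<lambda>i::int. (1 / 2 :: real) ^ nat \<bar>i\<bar>) summable_on UNIV"
    using summable_on_int_poly_geometric[of "1 / 2" 0] by simp
  have bound: "norm (f (k + i) * g i) \<le> A * B * (1 / 2) ^ nat \<bar>k\<bar> * (1 / 2) ^ nat \<bar>i\<bar>" for i
  proof -
    have q: "(1 / 4 :: real) ^ n = (1 / 2) ^ n * (1 / 2) ^ n" for n
      by (simp add: power_mult_distrib[symmetric])
    have "norm (f (k + i) * g i) \<le> (A * (1 / 4) ^ nat \<bar>k + i\<bar>) * (B * (1 / 4) ^ nat \<bar>i\<bar>)"
      unfolding real_norm_def abs_mult using AB by (intro mult_mono f g) auto
    also have "\<dots> \<le> A * B * ((1 / 2) ^ nat \<bar>k + i\<bar> * ((1 / 2) ^ nat \<bar>i\<bar> * (1 / 2) ^ nat \<bar>i\<bar>))"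
    proof -
      have "(1 / 4 :: real) ^ nat \<bar>k + i\<bar> \<le> (1 / 2) ^ nat \<bar>k + i\<bar>"
        by (intro power_mono) auto
      then show ?thesis using AB by (simp add: q mult_ac mult_left_mono mult_right_mono)
    qed
    also have "(1 / 2 :: real) ^ nat \<bar>k + i\<bar> * ((1 / 2) ^ nat \<bar>i\<bar> * (1 / 2) ^ nat \<bar>i\<bar>)
        = (1 / 2) ^ (nat \<bar>k + i\<bar> + nat \<bar>i\<bar>) * (1 / 2) ^ nat \<bar>i\<bar>"
      by (simp add: power_add)
    also have "A * B * \<dots> \<le> A * B * ((1 / 2) ^ nat \<bar>k\<bar> * (1 / 2) ^ nat \<bar>i\<bar>)"
      using AB by (intro mult_left_mono mult_right_mono power_decreasing) auto
    finally show ?thesis by (simp add: mult_ac)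
  qed
  have "norm (corr f g k) \<le> (\<Sum>\<^sub>\<infinity>i. A * B * (1 / 2) ^ nat \<bar>k\<bar> * (1 / 2) ^ nat \<bar>i\<bar>)"
    unfolding corr_def
  proof (rule norm_infsum_le)
    show "((\<lambda>i. A * B * (1 / 2) ^ nat \<bar>k\<bar> * (1 / 2) ^ nat \<bar>i\<bar>) has_sum
        (\<Sum>\<^sub>\<infinity>i. A * B * (1 / 2) ^ nat \<bar>k\<bar> * (1 / 2) ^ nat \<bar>i\<bar>)) UNIV"
      by (intro has_sum_infsum summable_on_cmult_right geo)
    show "((\<lambda>i. f (k + i) * g i) has_sum (\<Sum>\<^sub>\<infinity>i. f (k + i) * g i)) UNIV"
      using summable_on_bounded_by[OF summable_on_cmult_right[OF geo, of "A * B * (1 / 2) ^ nat \<bar>k\<bar>"],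
          of "\<lambda>i. f (k + i) * g i"] bound by (intro has_sum_infsum) simp
  qed (rule bound)
  then show ?thesis
    unfolding infsum_cmult_right' by (simp add: mult_ac)
qed

section \<open>The coefficients of the Miwa series\<close>

lemma miwa_h_neg: "k < 0 \<Longrightarrow> miwa_h t k = 0"
  by (simp add: miwa_h_def)

lemma miwa_h_0: "miwa_h t 0 = 1"
  by (simp add: miwa_h_def)

lemma miwa_h_scale: "miwa_h (\<lambda>r. q ^ r * t r) k = q ^ nat k * miwa_h t k"
proof -
  define T where "T = Abs_fps (\<lambda>r. if r = 0 then 0 else t r)"
  have "Abs_fps (\<lambda>r. if r = 0 then 0 else q ^ r * t r) = T oo (fps_const q * fps_X)"
    unfolding fps_compose_linear T_def by (rule fps_ext) simp
  then have "fps_exp 1 oo Abs_fps (\<lambda>r. if r = 0 then 0 else q ^ r * t r)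
      = (fps_exp 1 oo T) oo (fps_const q * fps_X)"
    by (simp add: fps_compose_assoc[symmetric] T_def)
  then show ?thesis
    by (simp add: miwa_h_def fps_compose_linear T_def[symmetric])
qed

text \<open>Coefficients of \<open>H' = H * T'\<close> for \<open>H = exp T\<close>.\<close>

lemma miwa_h_euler:
  assumes "\<And>r. r > R \<Longrightarrow> t r = 0"
  shows "euler_rec {1..int R} (\<lambda>r. of_int r * t (nat r)) (miwa_h t)"
  unfolding euler_rec_def
proof
  fix k :: int
  define T where "T = Abs_fps (\<lambda>r. if r = 0 then 0 else t r)"
  define H where "H = fps_exp 1 oo T"
  have h: "miwa_h t k = (if k < 0 then 0 else fps_nth H (nat k))" for k
    by (simp add: miwa_h_def H_def T_def)
  have H': "fps_deriv H = H * fps_deriv T"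
    unfolding H_def by (subst fps_compose_deriv) (simp_all add: T_def)
  show "of_int k * miwa_h t k = (\<Sum>r=1..int R. of_int r * t (nat r) * miwa_h t (k - r))"
  proof (cases "k \<le> 0")
    case True
    then show ?thesis by (cases "k = 0") (auto simp: miwa_h_neg intro!: sum.neutral)
  next
    case False
    then obtain n where k: "k = int (Suc n)"
      by (metis gr0_implies_Suc not_le zero_less_imp_eq_int)
    have "of_int k * miwa_h t k = fps_nth (fps_deriv H) n"
      by (simp add: h k nat_add_distrib algebra_simps)
    also have "\<dots> = (\<Sum>i=0..n. fps_nth H i * fps_nth (fps_deriv T) (n - i))"
      by (simp add: H' fps_mult_nth)
    also have "\<dots> = (\<Sum>r\<in>{1..k}. of_int r * t (nat r) * miwa_h t (k - r))"
      by (rule sum.reindex_bij_witness[of _ "\<lambda>r. nat (k - r)" "\<lambda>i. k - int i"])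
        (auto simp: h k T_def nat_diff_distrib of_nat_diff Suc_diff_le nat_add_distrib algebra_simps)
    also have "\<dots> = (\<Sum>r\<in>{1..k} \<inter> {1..int R}. of_int r * t (nat r) * miwa_h t (k - r))"
      using assms by (intro sum.mono_neutral_right) auto
    also have "\<dots> = (\<Sum>r=1..int R. of_int r * t (nat r) * miwa_h t (k - r))"
      by (intro sum.mono_neutral_left) (auto simp: miwa_h_neg)
    finally show ?thesis .
  qed
qed

text \<open>The second series is \<open>exp (- \<Sum>r. t r * z ^ r)\<close>, and the correlation
  evaluates it at \<open>1 / z\<close>; this gives the \<open>J k\<close> of the overview. If only
  \<open>t 1\<close> is nonzero, they are the Bessel functions of order \<open>k\<close> at
  \<open>2 * t 1\<close>.\<close>

definition miwa_J :: "(nat \<Rightarrow> real) \<Rightarrow> int \<Rightarrow> real" where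
  "miwa_J t = corr (miwa_h t) (miwa_h (\<lambda>r. - t r))"

text \<open>The shift \<open>s = 0\<close> gives the moments of the weights
  \<open>(J k)\<^sup>2\<close>, but raising \<open>p\<close> couples different shifts, so all of
  them are carried along.\<close>

definition miwa_moment :: "(nat \<Rightarrow> real) \<Rightarrow> nat \<Rightarrow> int \<Rightarrow> real" where
  "miwa_moment t p s = (\<Sum>\<^sub>\<infinity>k. of_int k ^ p * miwa_J t k * miwa_J t (k - s))"

lemma summable_on_geometric_bound:
  assumes "\<And>k :: int. \<bar>f k\<bar> \<le> A * c ^ nat \<bar>k\<bar>" "0 \<le> c" "c < 1"
  shows "(\<lambda>k. of_int k ^ p * f k :: real) summable_on UNIV"
proof (rule summable_on_bounded_by)
  show "(\<lambda>k::int. A * (\<bar>real_of_int k\<bar> ^ p * c ^ nat \<bar>k\<bar>)) summable_on UNIV"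
    by (intro summable_on_cmult_right summable_on_int_poly_geometric assms)
  fix k :: int
  show "\<bar>of_int k ^ p * f k\<bar> \<le> A * (\<bar>real_of_int k\<bar> ^ p * c ^ nat \<bar>k\<bar>)"
    using mult_left_mono[OF assms(1)[of k], of "\<bar>real_of_int k\<bar> ^ p"]
    by (simp add: abs_mult power_abs mult_ac)
qed

text \<open>Finite support makes the exponent a polynomial, so its exponential is entire and the
  coefficients decay at any geometric rate.\<close>

locale miwa =
  fixes t :: "nat \<Rightarrow> real" and R :: nat
  assumes finite_support: "\<And>r. r > R \<Longrightarrow> t r = 0"
begin

abbreviation "h \<equiv> miwa_h t"
abbreviation "e \<equiv> miwa_h (\<lambda>r. - t r)"
abbreviation "J \<equiv> miwa_J t"
abbreviation "Z \<equiv> \<Sum>r=1..R. real r * (t r)\<^sup>2"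

lemma h_bound: obtains A where "0 \<le> A" and "\<And>k. \<bar>h k\<bar> \<le> A * (1 / 4) ^ nat \<bar>k\<bar>"
  by (rule euler_rec_geometric_bound[OF miwa_h_euler[OF finite_support] miwa_h_neg, where c = "1 / 4"]) auto

lemma e_euler: "euler_rec {1..int R} (\<lambda>r. - (of_int r * t (nat r))) e"
  using miwa_h_euler[of R "\<lambda>r. - t r"] finite_support by simp

lemma e_bound: obtains A where "0 \<le> A" and "\<And>k. \<bar>e k\<bar> \<le> A * (1 / 4) ^ nat \<bar>k\<bar>"
  by (rule euler_rec_geometric_bound[OF e_euler miwa_h_neg, where c = "1 / 4"]) auto

lemma summable_h: "h summable_on UNIV"
proof -
  obtain A where "\<And>k. \<bar>h k\<bar> \<le> A * (1 / 4) ^ nat \<bar>k\<bar>" using h_bound by blast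
  from summable_on_geometric_bound[OF this, of 0] show ?thesis by simp
qed

lemma summable_e: "e summable_on UNIV"
proof -
  obtain A where "\<And>k. \<bar>e k\<bar> \<le> A * (1 / 4) ^ nat \<bar>k\<bar>" using e_bound by blast
  from summable_on_geometric_bound[OF this, of 0] show ?thesis by simp
qed

lemma J_bound: obtains A where "0 \<le> A" and "\<And>k. \<bar>J k\<bar> \<le> A * (1 / 2) ^ nat \<bar>k\<bar>"
proof -
  obtain A where A: "0 \<le> A" "\<And>k. \<bar>h k\<bar> \<le> A * (1 / 4) ^ nat \<bar>k\<bar>" using h_bound by blast
  obtain B where B: "0 \<le> B" "\<And>k. \<bar>e k\<bar> \<le> B * (1 / 4) ^ nat \<bar>k\<bar>" using e_bound by blast
  show thesis
    using corr_geometric_bound[of h A e B] A B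
    by (intro that[of "A * B * (\<Sum>\<^sub>\<infinity>i::int. (1 / 2) ^ nat \<bar>i\<bar>)"] mult_nonneg_nonneg infsum_nonneg)
      (auto simp: miwa_J_def)
qed

lemma summable_J: "J summable_on UNIV"
proof -
  obtain A where "\<And>k. \<bar>J k\<bar> \<le> A * (1 / 2) ^ nat \<bar>k\<bar>" using J_bound by blast
  from summable_on_geometric_bound[OF this, of 0] show ?thesis by simp
qed

text \<open>The logarithmic derivative of \<open>J\<close> is
  \<open>\<Sum>r. r * t r * (z ^ r + z ^ (- r))\<close>: the minus signs of the exponent and of the
  substitution \<open>1 / z\<close> cancel.\<close>

lemma J_euler: "of_int k * J k = (\<Sum>r=1..int R. of_int r * t (nat r) * (J (k - r) + J (k + r)))"
  using corr_euler_rec[OF summable_h summable_e miwa_h_euler[OF finite_support] e_euler, where k = k]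
  by (simp add: miwa_J_def sum.distrib sum_negf distrib_left)

text \<open>The same relation as one sum over a symmetric range. Its coefficients are even in
  \<open>r\<close>, which produces the cancellation in \<open>corr_J_J\<close>.\<close>

lemma J_euler_rec: "euler_rec {- int R..int R} (\<lambda>r. of_int \<bar>r\<bar> * t (nat \<bar>r\<bar>)) J"
  unfolding euler_rec_def
proof
  fix k
  let ?f = "\<lambda>r. of_int \<bar>r\<bar> * t (nat \<bar>r\<bar>) * J (k - r)"
  have "sum ?f {- int R..int R} = sum ?f ({1..int R} \<union> {- int R..- 1})"
    by (rule sum.mono_neutral_right) auto
  also have "\<dots> = sum ?f {1..int R} + sum ?f {- int R..- 1}"
    by (rule sum.union_disjoint) auto
  also have "sum ?f {- int R..- 1} = (\<Sum>r=1..int R. of_int r * t (nat r) * J (k + r))"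
    by (rule sum.reindex_bij_witness[of _ uminus uminus]) auto
  also have "sum ?f {1..int R} = (\<Sum>r=1..int R. of_int r * t (nat r) * J (k - r))"
    by (rule sum.cong) auto
  finally show "of_int k * J k = sum ?f {- int R..int R}"
    by (simp add: J_euler sum.distrib distrib_left)
qed

text \<open>The product of \<open>exp T\<close> and \<open>exp (- T)\<close>, where the reflection
  of \<open>e\<close> undoes the inversion in \<open>corr\<close>. The logarithmic derivatives
  cancel, which kills the coefficients with \<open>k \<noteq> 0\<close>; at \<open>k = 0\<close> one
  term remains, since both series start at index 0.\<close>

lemma corr_h_inverse: "corr h (\<lambda>i. e (- i)) k = (if k = 0 then 1 else 0)"
proof -
  let ?e = "\<lambda>i. e (- i)"
  have s: "?e summable_on UNIV"
    using summable_on_reindex_bij_betw[of uminus UNIV UNIV e] summable_e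
    by (simp add: bij_uminus)
  have "euler_rec {- int R..- 1} (\<lambda>r. - (of_int r * t (nat (- r)))) ?e"
    unfolding euler_rec_def
  proof
    fix k :: int
    have "of_int (- k) * e (- k) = (\<Sum>r=1..int R. - (of_int r * t (nat r)) * e (- k - r))"
      using e_euler unfolding euler_rec_def by blast
    moreover have "(\<Sum>r=1..int R. - (of_int r * t (nat r)) * e (- k - r))
        = (\<Sum>r\<in>{- int R..- 1}. of_int r * t (nat (- r)) * e (- (k - r)))"
      by (rule sum.reindex_bij_witness[of _ uminus uminus]) auto
    ultimately show "of_int k * e (- k)
        = (\<Sum>r\<in>{- int R..- 1}. - (of_int r * t (nat (- r))) * e (- (k - r)))"
      by (simp add: sum_negf)
  qed
  from corr_euler_rec[OF summable_h s miwa_h_euler[OF finite_support] this, where k = k]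
  have "of_int k * corr h ?e k = (\<Sum>r=1..int R. of_int r * t (nat r) * corr h ?e (k - r))
      + (\<Sum>r\<in>{- int R..- 1}. of_int r * t (nat (- r)) * corr h ?e (k + r))"
    by (simp add: sum_negf)
  also have "(\<Sum>r\<in>{- int R..- 1}. of_int r * t (nat (- r)) * corr h ?e (k + r))
      = - (\<Sum>r=1..int R. of_int r * t (nat r) * corr h ?e (k - r))"
    unfolding sum_negf[symmetric] by (rule sum.reindex_bij_witness[of _ uminus uminus]) auto
  finally have "k \<noteq> 0 \<Longrightarrow> corr h ?e k = 0" by simp
  moreover have "corr h ?e 0 = 1"
  proof -
    have "corr h ?e 0 = (\<Sum>\<^sub>\<infinity>i\<in>{0}. h (0 + i) * e (- i))"
      unfolding corr_def
    proof (rule infsum_cong_neutral)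
      fix x :: int assume "x \<in> UNIV - {0}"
      then show "h (0 + x) * e (- x) = 0"
        by (cases "x < 0") (auto simp: miwa_h_neg)
    qed auto
    then show ?thesis by (simp add: miwa_h_0)
  qed
  ultimately show ?thesis by simp
qed

lemma corr_delta: "corr f (\<lambda>n. if n = 0 then 1 else 0) m = f m"
proof -
  have "corr f (\<lambda>n. if n = 0 then 1 else 0) m = (\<Sum>\<^sub>\<infinity>i\<in>{0}. f (m + i) * (if i = 0 then 1 else 0))"
    unfolding corr_def by (rule infsum_cong_neutral) auto
  then show ?thesis by simp
qed

text \<open>Multiplying the quotient \<open>H z / H (1 / z)\<close> by \<open>H (1 / z)\<close>
  gives back \<open>H z\<close>.\<close>

lemma corr_J_h: "corr J h m = h m"
proof -
  have "corr J h m = corr h (corr h (\<lambda>i. e (- i))) m"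
    unfolding miwa_J_def by (rule corr_corr[OF summable_h summable_e summable_h])
  also have "corr h (\<lambda>i. e (- i)) = (\<lambda>n. if n = 0 then 1 else 0)"
    by (rule ext) (rule corr_h_inverse)
  also have "corr h \<dots> m = h m"
    by (rule corr_delta)
  finally show ?thesis .
qed

text \<open>Orthonormality of the translates of \<open>J\<close>, that is, modulus one on the unit
  circle. Invariance of the logarithmic derivative under \<open>z \<mapsto> 1 / z\<close>
  annihilates the coefficients with \<open>k \<noteq> 0\<close>, and the remaining one is found by
  evaluation at \<open>z = 1\<close>.\<close>

lemma corr_J_J: "corr J J k = (if k = 0 then 1 else 0)"
proof -
  have zero: "corr J J k = 0" if "k \<noteq> 0" for k
  proof -
    have "of_int k * corr J J k = (\<Sum>r\<in>{- int R..int R}. of_int \<bar>r\<bar> * t (nat \<bar>r\<bar>) * corr J J (k - r))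
        - (\<Sum>r\<in>{- int R..int R}. of_int \<bar>r\<bar> * t (nat \<bar>r\<bar>) * corr J J (k + r))"
      by (rule corr_euler_rec[OF summable_J summable_J J_euler_rec J_euler_rec])
    also have "(\<Sum>r\<in>{- int R..int R}. of_int \<bar>r\<bar> * t (nat \<bar>r\<bar>) * corr J J (k + r))
        = (\<Sum>r\<in>{- int R..int R}. of_int \<bar>r\<bar> * t (nat \<bar>r\<bar>) * corr J J (k - r))"
      by (rule sum.reindex_bij_witness[of _ uminus uminus]) auto
    finally show ?thesis using that by simp
  qed
  have e': "(\<lambda>i. e (- i)) summable_on UNIV" "infsum (\<lambda>i. e (- i)) UNIV = infsum e UNIV"
    using summable_on_reindex_bij_betw[of uminus UNIV UNIV e] summable_e
      infsum_reindex_bij_betw[of uminus UNIV UNIV e] by (simp_all add: bij_uminus)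
  have delta: "((\<lambda>k::int. if k = 0 then c else 0) has_sum (c :: real)) UNIV" for c
    using has_sum_cong_neutral[of "{0::int}" UNIV "\<lambda>k. if k = 0 then c else 0" "\<lambda>k. if k = 0 then c else 0" c]
    by (auto intro: has_sum_finiteI)
  have "infsum h UNIV * infsum e UNIV = 1"
    using has_sum_unique[OF infsum_corr[OF summable_h e'(1)]] delta[of 1]
    by (simp add: corr_h_inverse e'(2))
  moreover have "infsum J UNIV = infsum h UNIV * infsum e UNIV"
    unfolding miwa_J_def by (rule infsumI) (rule infsum_corr[OF summable_h summable_e])
  moreover have "(corr J J has_sum corr J J 0) UNIV"
    using delta[of "corr J J 0"] zero by (simp add: has_sum_cong[of UNIV "corr J J" "\<lambda>k. if k = 0 then corr J J 0 else 0"])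
  then have "infsum J UNIV * infsum J UNIV = corr J J 0"
    using has_sum_unique[OF infsum_corr[OF summable_J summable_J]] by simp
  ultimately show ?thesis using zero by simp
qed

lemma moment_summable: "(\<lambda>k. of_int k ^ p * J k * J (k - s)) summable_on UNIV"
proof -
  obtain A where A: "\<And>k. \<bar>J k\<bar> \<le> A * (1 / 2) ^ nat \<bar>k\<bar>" using J_bound by blast
  obtain C where C: "\<And>k. \<bar>J k\<bar> \<le> C" using summable_on_imp_bounded[OF summable_J] by auto
  have "(\<lambda>k. J (k - s) * (of_int k ^ p * J k)) summable_on UNIV"
    by (rule summable_on_bounded_mult[OF summable_on_geometric_bound[OF A] C]) auto
  then show ?thesis by (simp add: mult_ac)
qed

lemma moment_0: "miwa_moment t 0 s = (if s = 0 then 1 else 0)"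
proof -
  have "miwa_moment t 0 s = corr J J (- s)"
    unfolding miwa_moment_def corr_def by (simp add: mult.commute add.commute)
  then show ?thesis by (simp add: corr_J_J)
qed

text \<open>Split one factor \<open>k\<close> as \<open>s + (k - s)\<close> and apply
  \<open>J_euler\<close> to \<open>J (k - s)\<close>.\<close>

lemma moment_Suc:
  "miwa_moment t (Suc p) s = of_int s * miwa_moment t p s
    + (\<Sum>r=1..int R. of_int r * t (nat r) * (miwa_moment t p (s + r) + miwa_moment t p (s - r)))"
proof -
  have m: "((\<lambda>k. of_int k ^ p * J k * J (k - s)) has_sum miwa_moment t p s) UNIV" for s
    unfolding miwa_moment_def by (intro has_sum_infsum moment_summable)
  have "((\<lambda>k. of_int s * (of_int k ^ p * J k * J (k - s))
      + (\<Sum>r=1..int R. of_int r * t (nat r) * (of_int k ^ p * J k * J (k - (s + r))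
          + of_int k ^ p * J k * J (k - (s - r)))))
    has_sum (of_int s * miwa_moment t p s
    + (\<Sum>r=1..int R. of_int r * t (nat r) * (miwa_moment t p (s + r) + miwa_moment t p (s - r))))) UNIV"
    by (intro has_sum_add has_sum_cmult_right has_sum_finite_sum m)
  moreover have "of_int s * (of_int k ^ p * J k * J (k - s))
      + (\<Sum>r=1..int R. of_int r * t (nat r) * (of_int k ^ p * J k * J (k - (s + r))
          + of_int k ^ p * J k * J (k - (s - r))))
      = of_int k ^ Suc p * J k * J (k - s)" for k
  proof -
    have "(\<Sum>r=1..int R. of_int r * t (nat r) * (of_int k ^ p * J k * J (k - (s + r))
          + of_int k ^ p * J k * J (k - (s - r))))
        = of_int k ^ p * J k * (of_int (k - s) * J (k - s))"
      unfolding J_euler sum_distrib_left by (intro sum.cong refl) (simp add: algebra_simps)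
    then show ?thesis by (simp add: algebra_simps)
  qed
  ultimately show ?thesis
    unfolding miwa_moment_def[of t "Suc p"] by (simp only: infsumI)
qed

lemma moment_1: "miwa_moment t 1 s = of_int \<bar>s\<bar> * t (nat \<bar>s\<bar>)"
proof -
  have "of_int r * t (nat r) * (miwa_moment t 0 (s + r) + miwa_moment t 0 (s - r))
      = (if r = \<bar>s\<bar> then of_int r * t (nat r) else 0)" if "r \<in> {1..int R}" for r
    using that by (auto simp: moment_0)
  then have "miwa_moment t 1 s = (\<Sum>r=1..int R. if r = \<bar>s\<bar> then of_int r * t (nat r) else 0)"
    unfolding One_nat_def moment_Suc[of 0] by (simp add: moment_0)
  also have "\<dots> = of_int \<bar>s\<bar> * t (nat \<bar>s\<bar>)"
    using finite_support[of "nat \<bar>s\<bar>"] by (auto simp: nat_less_iff not_le)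
  finally show ?thesis .
qed

text \<open>The first moment at shift 0 vanishes, so this is the variance of the weights
  \<open>(J k)\<^sup>2\<close>. Half of it is the derivative at \<open>s = 0\<close> of
  \<open>\<Sum>r. r * exp (s * r) * (t r)\<^sup>2\<close>, which is how it enters the
  normalization.\<close>

lemma moment_2_0: "miwa_moment t 2 0 = 2 * (\<Sum>r=1..R. (real r * t r)\<^sup>2)"
proof -
  have "miwa_moment t 2 0 = (\<Sum>r=1..int R. 2 * (of_int r * t (nat r))\<^sup>2)"
    using moment_Suc[of 1 0] moment_1
    by (auto intro!: sum.cong simp: numeral_2_eq_2[symmetric] power2_eq_square)
  also have "\<dots> = (\<Sum>r=1..R. 2 * (real r * t r)\<^sup>2)"
    by (rule sum.reindex_bij_witness[of _ int nat]) auto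
  finally show ?thesis by (simp add: sum_distrib_left)
qed

end

section \<open>One-point function\<close>

lemma has_sum_cauchy_schwarz:
  fixes f g :: "'a \<Rightarrow> real"
  assumes "((\<lambda>x. f x * g x) has_sum s) A" "((\<lambda>x. (f x)\<^sup>2) has_sum a) A" "((\<lambda>x. (g x)\<^sup>2) has_sum b) A"
  shows "s\<^sup>2 \<le> a * b"
proof (rule tendsto_le)
  show "((\<lambda>F. (\<Sum>x\<in>F. f x * g x)\<^sup>2) \<longlongrightarrow> s\<^sup>2) (finite_subsets_at_top A)"
    using assms(1) by (intro tendsto_intros) (simp add: has_sum_def)
  show "((\<lambda>F. (\<Sum>x\<in>F. (f x)\<^sup>2) * (\<Sum>x\<in>F. (g x)\<^sup>2)) \<longlongrightarrow> a * b) (finite_subsets_at_top A)"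
    using assms(2,3) by (intro tendsto_intros) (simp_all add: has_sum_def)
  show "\<forall>\<^sub>F F in finite_subsets_at_top A. (\<Sum>x\<in>F. f x * g x)\<^sup>2 \<le> (\<Sum>x\<in>F. (f x)\<^sup>2) * (\<Sum>x\<in>F. (g x)\<^sup>2)"
    by (intro always_eventually allI Cauchy_Schwarz_ineq_sum)
qed simp

text \<open>Gram matrix of the shifts of \<open>h\<close> for the weight \<open>w\<close>. With the
  constant weight 1 its entries depend on \<open>i - j\<close> only, hence the abbreviation
  \<open>toeplitz\<close>.\<close>

definition miwa_gram :: "(nat \<Rightarrow> real) \<Rightarrow> (int \<Rightarrow> real) \<Rightarrow> nat \<Rightarrow> nat \<Rightarrow> real" where
  "miwa_gram t w i j = (\<Sum>\<^sub>\<infinity>a. w a * miwa_h t (a + int i) * miwa_h t (a + int j))"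

abbreviation toeplitz :: "(nat \<Rightarrow> real) \<Rightarrow> nat \<Rightarrow> nat \<Rightarrow> real" where
  "toeplitz t \<equiv> miwa_gram t (\<lambda>_. 1)"

text \<open>The sum over \<open>a > n\<close> of the one-point bounds \<open>corr_kernel a\<close>:
  each \<open>m\<close> occurs once for every \<open>a\<close> with
  \<open>n < a \<le> m\<close>.\<close>

definition miwa_mean :: "(nat \<Rightarrow> real) \<Rightarrow> int \<Rightarrow> real" where
  "miwa_mean t n = (\<Sum>\<^sub>\<infinity>m. of_int (max 0 (m - n)) * (miwa_J t m)\<^sup>2)"

text \<open>Affine in \<open>z\<close>, so the weighted sum of a one-point function of mass
  \<open>N\<close> is \<open>N + z * S\<close>, with \<open>S\<close> its mass above
  \<open>n\<close>.\<close>

definition step_weight :: "int \<Rightarrow> real \<Rightarrow> int \<Rightarrow> real" where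
  "step_weight n z a = (if a > n then 1 + z else 1)"

lemma sum_indicator_le:
  fixes a :: int assumes "finite F"
  shows "(\<Sum>a\<in>F. if a \<le> m then if n < a then 1 else 0 else (0 :: real)) \<le> of_int (max 0 (m - n))"
proof -
  have "(\<Sum>a\<in>F. if a \<le> m then if n < a then 1 else 0 else (0 :: real)) = (\<Sum>a\<in>F \<inter> {n<..m}. 1)"
    using assms by (intro sum.mono_neutral_cong_right) auto
  also have "\<dots> \<le> real (card {n<..m})"
    using card_mono[of "{n<..m}" "F \<inter> {n<..m}"] by simp
  also have "\<dots> = of_int (max 0 (m - n))"
    by simp
  finally show ?thesis .
qed

context miwa
begin

lemma summable_hh: "(\<lambda>a. h (a + i) * h (a + j)) summable_on UNIV"
proof -
  have "(\<lambda>a. h (i - j + (a + j)) * h (a + j)) summable_on UNIV"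
    using summable_on_int_shift[of "\<lambda>a. h (i - j + a) * h a" j] corr_summable[OF summable_h summable_h]
    by blast
  then show ?thesis by (simp add: add.commute)
qed

lemma summable_whh:
  assumes "\<And>a. \<bar>w a\<bar> \<le> C"
  shows "(\<lambda>a. w a * h (a + i) * h (a + j)) summable_on UNIV"
  using summable_on_bounded_mult[OF summable_hh assms] by (simp add: mult.assoc)

text \<open>The Gram matrix is of Toeplitz type, so it is also the Gram matrix of the reversed shifts.\<close>

lemma gram_quadratic_form:
  "((\<lambda>k. (\<Sum>j<N. c j * h (k - int j))\<^sup>2) has_sum qform N (toeplitz t) c) UNIV"
proof -
  have "((\<lambda>k. h (k - int i) * h (k - int j)) has_sum toeplitz t i j) UNIV" for i j
  proof -
    have "((\<lambda>a. h (a + int j) * h (a + int i)) has_sum toeplitz t i j) UNIV"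
      unfolding miwa_gram_def using summable_hh[of "int i" "int j"] by (simp add: mult.commute)
    then show ?thesis
      by (subst (asm) has_sum_int_shift[of _ "- int i - int j", symmetric]) (simp add: algebra_simps)
  qed
  then have "((\<lambda>k. \<Sum>i<N. \<Sum>j<N. c i * c j * (h (k - int i) * h (k - int j)))
      has_sum qform N (toeplitz t) c) UNIV"
    unfolding qform_def by (intro has_sum_finite_sum has_sum_cmult_right)
  then show ?thesis
    by (simp add: power2_eq_square sum_product mult_ac)
qed

lemma summable_J2: "(\<lambda>m. of_int m ^ p * (J m)\<^sup>2) summable_on UNIV"
  using moment_summable[of p 0] by (simp add: power2_eq_square mult.assoc)

lemma moment_has_sum: "((\<lambda>m. of_int m ^ p * (J m)\<^sup>2) has_sum miwa_moment t p 0) UNIV"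
  using has_sum_infsum[OF summable_J2[of p]] by (simp add: miwa_moment_def power2_eq_square mult.assoc)

lemma summable_J2_linear:
  assumes "\<And>m. \<bar>W m\<bar> \<le> \<bar>of_int m\<bar> + C"
  shows "(\<lambda>m. W m * (J m)\<^sup>2) summable_on UNIV"
proof (rule summable_on_bounded_by)
  show "(\<lambda>m. \<bar>of_int m ^ 1 * (J m)\<^sup>2\<bar> + C * (of_int m ^ 0 * (J m)\<^sup>2)) summable_on UNIV"
    by (intro summable_on_add summable_on_abs_real summable_on_cmult_right summable_J2)
  show "\<bar>W m * (J m)\<^sup>2\<bar> \<le> \<bar>of_int m ^ 1 * (J m)\<^sup>2\<bar> + C * (of_int m ^ 0 * (J m)\<^sup>2)" for m
    using mult_right_mono[OF assms[of m], of "(J m)\<^sup>2"] by (simp add: abs_mult distrib_right)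
qed

lemma mean_has_sum: "((\<lambda>m. of_int (max 0 (m - n)) * (J m)\<^sup>2) has_sum miwa_mean t n) UNIV"
  unfolding miwa_mean_def
  by (intro has_sum_infsum summable_J2_linear[of _ "\<bar>of_int n\<bar>"]) (auto simp: max_def)

definition corr_kernel :: "int \<Rightarrow> real" where
  "corr_kernel a = (\<Sum>\<^sub>\<infinity>m. (if a \<le> m then 1 else 0) * (J m)\<^sup>2)"

lemma corr_kernel_has_sum: "((\<lambda>m. (if a \<le> m then 1 else 0) * (J m)\<^sup>2) has_sum corr_kernel a) UNIV"
  unfolding corr_kernel_def
  by (intro has_sum_infsum summable_J2_linear[of _ 1]) auto

text \<open>Since \<open>h = corr J h\<close>, a function \<open>a \<mapsto> (\<Sum>j. c j * h (a + j))\<close> is expanded in the orthonormal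
  family of translates of \<open>J\<close>, and the coefficient vector has the norm of the function.\<close>

lemma kernel_bound:
  assumes \<kappa>: "\<kappa> = (\<Sum>i<N. c i * h (a + int i))" "\<kappa> = qform N (toeplitz t) c" "0 \<le> \<kappa>"
  shows "\<kappa> \<le> corr_kernel a"
proof -
  define d where "d k = (\<Sum>j<N. c j * h (k - int j))" for k
  have "((\<lambda>k. J (a + k) * h (k - int i)) has_sum h (a + int i)) UNIV" for i
  proof -
    have "((\<lambda>n. J (a + int i + (n + - int i)) * h (n + - int i)) has_sum h (a + int i)) UNIV"
      using has_sum_int_shift[of "\<lambda>n. J (a + int i + n) * h n" "- int i"]
        corr_has_sum[OF summable_J summable_h, of "a + int i"] corr_J_h by auto
    then show ?thesis by simp
  qed
  then have "((\<lambda>k. \<Sum>i<N. c i * (J (a + k) * h (k - int i))) has_sum \<kappa>) UNIV"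
    unfolding \<kappa>(1) by (intro has_sum_finite_sum has_sum_cmult_right)
  moreover have "(\<Sum>i<N. c i * (J (a + k) * h (k - int i))) = (if 0 \<le> k then 1 else 0) * J (a + k) * d k" for k
  proof -
    have "(\<Sum>i<N. c i * (J (a + k) * h (k - int i))) = J (a + k) * d k"
      unfolding d_def by (simp add: sum_distrib_left mult_ac)
    \<comment> \<open>This restricts the expansion to \<open>k \<ge> 0\<close>, so only the
      \<open>J m\<close> with \<open>m \<ge> a\<close> enter, and the bound is
      \<open>corr_kernel a\<close> rather than the full norm 1.\<close>
    moreover have "d k = 0" if "k < 0"
      unfolding d_def using that by (intro sum.neutral) (auto simp: miwa_h_neg)
    ultimately show ?thesis by auto
  qed
  ultimately have 1: "((\<lambda>k. ((if 0 \<le> k then 1 else 0) * J (a + k)) * d k) has_sum \<kappa>) UNIV"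
    by simp
  have "((\<lambda>k. (if a \<le> k + a then 1 else 0) * (J (k + a))\<^sup>2) has_sum corr_kernel a) UNIV"
    using corr_kernel_has_sum[of a] by (subst has_sum_int_shift)
  then have 2: "((\<lambda>k. ((if 0 \<le> k then 1 else 0) * J (a + k))\<^sup>2) has_sum corr_kernel a) UNIV"
    by (rule back_subst[of "\<lambda>f. (f has_sum _) UNIV"]) (auto simp: add.commute)
  have "((\<lambda>k. (d k)\<^sup>2) has_sum \<kappa>) UNIV"
    unfolding d_def \<kappa>(2) by (rule gram_quadratic_form)
  \<comment> \<open>\<open>\<kappa>\<close> is both the pairing and the squared norm of
    \<open>d\<close>, so one factor cancels.\<close>
  from has_sum_cauchy_schwarz[OF 1 2 this] have "\<kappa> * \<kappa> \<le> corr_kernel a * \<kappa>"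
    by (simp add: power2_eq_square)
  moreover have "0 \<le> corr_kernel a"
    by (rule has_sum_nonneg[OF corr_kernel_has_sum]) auto
  ultimately show ?thesis
    using \<kappa>(3) by (cases "\<kappa> = 0") auto
qed

text \<open>Exchange of sums: \<open>corr_kernel a\<close> collects the \<open>m \<ge> a\<close>, so
  a weight \<open>w\<close> on the \<open>a\<close> becomes on \<open>m\<close> the cumulative
  weight of all \<open>a \<le> m\<close>, which \<open>W\<close> dominates.\<close>

lemma kernel_sum_bound:
  assumes F: "finite F" and w: "\<And>a. a \<in> F \<Longrightarrow> 0 \<le> w a" and \<kappa>: "\<And>a. a \<in> F \<Longrightarrow> \<kappa> a \<le> corr_kernel a"
    and W: "\<And>m. (\<Sum>a\<in>F. if a \<le> m then w a else 0) \<le> W m"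
    and S: "((\<lambda>m. W m * (J m)\<^sup>2) has_sum S) UNIV"
  shows "(\<Sum>a\<in>F. w a * \<kappa> a) \<le> S"
proof -
  have "(\<Sum>a\<in>F. w a * \<kappa> a) \<le> (\<Sum>a\<in>F. w a * corr_kernel a)"
    using w \<kappa> by (intro sum_mono mult_left_mono)
  also have "\<dots> \<le> S"
  proof (rule has_sum_mono)
    show "((\<lambda>m. \<Sum>a\<in>F. w a * ((if a \<le> m then 1 else 0) * (J m)\<^sup>2)) has_sum (\<Sum>a\<in>F. w a * corr_kernel a)) UNIV"
      by (intro has_sum_finite_sum has_sum_cmult_right corr_kernel_has_sum)
    show "(\<Sum>a\<in>F. w a * ((if a \<le> m then 1 else 0) * (J m)\<^sup>2)) \<le> W m * (J m)\<^sup>2" for m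
    proof -
      have "(\<Sum>a\<in>F. w a * ((if a \<le> m then 1 else 0) * (J m)\<^sup>2)) = (\<Sum>a\<in>F. if a \<le> m then w a else 0) * (J m)\<^sup>2"
        unfolding sum_distrib_right by (intro sum.cong) auto
      then show ?thesis using W[of m] by (simp add: mult_right_mono)
    qed
  qed (rule S)
  finally show ?thesis .
qed

text \<open>The term of the empty partition in the Cauchy--Binet sum: its rows \<open>- i\<close>
  give a unitriangular matrix. The family has one member, hence the type
  \<open>unit\<close>.\<close>

lemma gram_det_ge_1: "1 \<le> dt N (toeplitz t)"
proof -
  have "dt N (\<lambda>i j. h (- int i + int j)) = dt N (\<lambda>i j. h (- int j + int i))"
    by (rule dt_transpose[symmetric])
  also have "\<dots> = 1"
    by (subst dt_lower_triangular) (auto simp: miwa_h_neg miwa_h_0)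
  finally have 1: "dt N (\<lambda>i j. h (- int i + int j)) = 1" .
  have "(\<Sum>x\<in>{()}. (dt N (\<lambda>i j. h (- int i + int j)))\<^sup>2 * (\<Prod>i<N. 1 :: real))
      \<le> dt N (\<lambda>i j. \<Sum>\<^sub>\<infinity>a. 1 * h (a + int i) * h (a + int j))"
  proof (rule cauchy_binet_infsum_le[where f = "\<lambda>_ i. - int i" and w = "\<lambda>_. 1"
        and \<phi> = "\<lambda>a j. h (a + int j)"])
    fix x y :: unit and p q :: "nat \<Rightarrow> nat"
    assume *: "p permutes {0..<N}" "q permutes {0..<N}" "\<forall>i<N. - int (p i) = - int (q i)"
    have "p i = q i" for i
      using * permutes_not_in[of p "{0..<N}" i] permutes_not_in[of q "{0..<N}" i]
      by (cases "i < N") auto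
    then show "x = y \<and> p = q" by auto
  qed (auto intro: summable_hh simp: summable_hh)
  then show ?thesis unfolding 1 by (simp add: miwa_gram_def[abs_def])
qed

text \<open>Bundles the Christoffel function of the first \<open>N\<close> shifts of
  \<open>h\<close> with its bounds. It vanishes for \<open>a \<le> - N\<close> because
  \<open>h (a + i)\<close> does for all \<open>i < N\<close>.\<close>

definition one_point :: "nat \<Rightarrow> (int \<Rightarrow> real) \<Rightarrow> bool" where
  "one_point N \<kappa> \<longleftrightarrow> (\<forall>a. 0 \<le> \<kappa> a \<and> \<kappa> a \<le> corr_kernel a \<and> (a \<le> - int N \<longrightarrow> \<kappa> a = 0)) \<and>
    (\<kappa> has_sum real N) UNIV \<and>
    (\<forall>w. (\<forall>a. 0 \<le> w a) \<longrightarrow>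
      (\<forall>i j. (\<lambda>a. w a * h (a + int i) * h (a + int j)) summable_on UNIV) \<longrightarrow>
      (\<lambda>a. w a * \<kappa> a) summable_on UNIV \<and>
      dt N (miwa_gram t w) \<le> dt N (toeplitz t) * exp ((\<Sum>\<^sub>\<infinity>a. w a * \<kappa> a) - real N))"

lemma one_point_exists: "\<exists>\<kappa>. one_point N \<kappa>"
proof -
  have gram: "(\<lambda>i j. \<Sum>\<^sub>\<infinity>a. w a * h (a + int i) * h (a + int j)) = miwa_gram t w" for w
    by (simp add: miwa_gram_def fun_eq_iff)
  have ne: "dt N (toeplitz t) \<noteq> 0"
    using gram_det_ge_1[of N] by simp
  have hh: "(\<lambda>a. h (a + int i) * h (a + int j)) summable_on UNIV" for i j
    by (rule summable_hh)
  obtain \<kappa> where \<kappa>: "\<And>a. 0 \<le> \<kappa> a" "(\<kappa> has_sum real N) UNIV"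
    "\<And>a. \<exists>c. \<kappa> a = (\<Sum>i<N. c i * h (a + int i)) \<and> \<kappa> a = qform N (toeplitz t) c"
    "\<And>w. (\<And>a. 0 \<le> w a) \<Longrightarrow>
      (\<And>i j. (\<lambda>a. w a * h (a + int i) * h (a + int j)) summable_on UNIV) \<Longrightarrow>
      (\<lambda>a. w a * \<kappa> a) summable_on UNIV \<and>
      dt N (miwa_gram t w) \<le> dt N (toeplitz t) * exp ((\<Sum>\<^sub>\<infinity>a. w a * \<kappa> a) - real N)"
    using christoffel_bound[where \<phi> = "\<lambda>a j. h (a + int j)" and N = N, unfolded gram, OF hh ne] by blast
  have "\<kappa> a \<le> corr_kernel a" "a \<le> - int N \<longrightarrow> \<kappa> a = 0" for a
  proof -
    obtain c where c: "\<kappa> a = (\<Sum>i<N. c i * h (a + int i))" "\<kappa> a = qform N (toeplitz t) c"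
      using \<kappa>(3) by blast
    show "\<kappa> a \<le> corr_kernel a"
      by (rule kernel_bound[OF c \<kappa>(1)])
    show "a \<le> - int N \<longrightarrow> \<kappa> a = 0"
      unfolding c(1) by (auto simp: miwa_h_neg intro!: sum.neutral)
  qed
  then have "one_point N \<kappa>"
    unfolding one_point_def using \<kappa>(1,2,4) by blast
  then show ?thesis by blast
qed

lemma one_pointD:
  assumes "one_point N \<kappa>"
  shows "0 \<le> \<kappa> a" and "(\<kappa> has_sum real N) UNIV" and "\<kappa> a \<le> corr_kernel a" and "a \<le> - int N \<Longrightarrow> \<kappa> a = 0"
    and "(\<And>a. 0 \<le> w a) \<Longrightarrow> (\<And>i j. (\<lambda>a. w a * h (a + int i) * h (a + int j)) summable_on UNIV) \<Longrightarrow>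
      (\<lambda>a. w a * \<kappa> a) summable_on UNIV \<and>
      dt N (miwa_gram t w) \<le> dt N (toeplitz t) * exp ((\<Sum>\<^sub>\<infinity>a. w a * \<kappa> a) - real N)"
  using assms unfolding one_point_def by simp_all

text \<open>The upper bound for \<open>S\<close> is summed from
  \<open>\<kappa> \<le> corr_kernel\<close>. For the lower one the mass of \<open>\<kappa>\<close>
  on \<open>{- N<..n}\<close> is bounded above and subtracted from the total mass \<open>N\<close>;
  the loss is the excess of \<open>miwa_mean t (- N)\<close> over \<open>N\<close>.\<close>

lemma gram_step:
  assumes z: "- 1 < z"
  obtains S where "dt N (miwa_gram t (step_weight n z)) \<le> dt N (toeplitz t) * exp (z * S)"
    and "S \<le> miwa_mean t n"
    and "- int N \<le> n \<Longrightarrow> 0 < N \<Longrightarrow> miwa_mean t n - miwa_moment t 2 0 / real N \<le> S"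
proof -
  obtain \<kappa> where "one_point N \<kappa>"
    using one_point_exists by blast
  note \<kappa> = one_pointD[OF this]
  define I :: "int \<Rightarrow> real" where "I a = (if n < a then 1 else 0)" for a
  define S where "S = (\<Sum>\<^sub>\<infinity>a. I a * \<kappa> a)"
  have I\<kappa>: "(\<lambda>a. I a * \<kappa> a) summable_on UNIV"
    by (rule summable_on_bounded_mult[OF has_sum_imp_summable[OF \<kappa>(2)], of _ 1]) (auto simp: I_def)
  show thesis
  proof (rule that)
    show "dt N (miwa_gram t (step_weight n z)) \<le> dt N (toeplitz t) * exp (z * S)"
    proof -
      have "((\<lambda>a. \<kappa> a + z * (I a * \<kappa> a)) has_sum (real N + z * S)) UNIV"
        unfolding S_def by (intro has_sum_add \<kappa> has_sum_cmult_right has_sum_infsum I\<kappa>)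
      moreover have "\<kappa> a + z * (I a * \<kappa> a) = step_weight n z a * \<kappa> a" for a
        by (simp add: I_def step_weight_def algebra_simps)
      ultimately have "(\<Sum>\<^sub>\<infinity>a. step_weight n z a * \<kappa> a) = real N + z * S"
        by (simp add: infsumI)
      moreover have "\<bar>step_weight n z a\<bar> \<le> 1 + \<bar>z\<bar>" for a
        by (auto simp: step_weight_def)
      ultimately show ?thesis
        using \<kappa>(5)[of "step_weight n z"] summable_whh[of "step_weight n z" "1 + \<bar>z\<bar>"] z
        by (auto simp: step_weight_def)
    qed
    show "S \<le> miwa_mean t n"
      unfolding S_def
    proof (rule infsum_le_finite_sums[OF I\<kappa>])
      fix F :: "int set" assume "finite F" "F \<subseteq> UNIV"
      then show "(\<Sum>a\<in>F. I a * \<kappa> a) \<le> miwa_mean t n"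
        using sum_indicator_le[of F _ n, folded I_def]
        by (intro kernel_sum_bound[OF _ _ _ _ mean_has_sum] \<kappa>) (auto simp: I_def)
    qed
    assume n: "- int N \<le> n" "0 < N"
    let ?W = "\<lambda>m. of_int (max 0 (m + int N)) - of_int (max 0 (m - n)) :: real"
    have "((\<lambda>m. of_int (max 0 (m - - int N)) * (J m)\<^sup>2 + (-1) * (of_int (max 0 (m - n)) * (J m)\<^sup>2)) has_sum
        (miwa_mean t (- int N) + (-1) * miwa_mean t n)) UNIV"
      by (intro has_sum_add has_sum_cmult_right mean_has_sum)
    then have W: "((\<lambda>m. ?W m * (J m)\<^sup>2) has_sum (miwa_mean t (- int N) - miwa_mean t n)) UNIV"
      by (simp add: left_diff_distrib)
    have "(\<Sum>a\<in>{- int N<..n}. 1 * \<kappa> a) \<le> miwa_mean t (- int N) - miwa_mean t n"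
    proof (rule kernel_sum_bound[OF _ _ _ _ W])
      fix m
      have "(\<Sum>a\<in>{- int N<..n}. if a \<le> m then 1 else 0 :: real) = real (card ({- int N<..n} \<inter> {..m}))"
        by (simp add: sum.If_cases Int_def)
      also have "{- int N<..n} \<inter> {..m} = {- int N<..min m n}" by auto
      also have "real (card {- int N<..min m n}) \<le> ?W m"
        using n by (auto simp: min_def max_def)
      finally show "(\<Sum>a\<in>{- int N<..n}. if a \<le> m then 1 else 0) \<le> ?W m" .
    qed (auto intro: \<kappa>)
    moreover have "S + (\<Sum>a\<in>{- int N<..n}. 1 * \<kappa> a) = real N"
    proof -
      have "((\<lambda>a. (1 - I a) * \<kappa> a) has_sum (\<Sum>a\<in>{- int N<..n}. 1 * \<kappa> a)) UNIV"
        using \<kappa>(4) by (intro has_sum_finite_neutralI[of "{- int N<..n}"])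
          (auto simp: I_def not_less intro!: sum.cong)
      from has_sum_add[OF has_sum_infsum[OF I\<kappa>] this]
      have "(\<kappa> has_sum (S + (\<Sum>a\<in>{- int N<..n}. 1 * \<kappa> a))) UNIV"
        by (simp add: S_def algebra_simps)
      from has_sum_unique[OF this \<kappa>(2)] show ?thesis .
    qed
    \<comment> \<open>Pointwise \<open>max 0 (m + N) \<le> N + m + m\<^sup>2 / N\<close>, and under
      the weights \<open>(J m)\<^sup>2\<close> the mean of \<open>m\<close> is 0.\<close>
    moreover have "miwa_mean t (- int N) \<le> real N + miwa_moment t 2 0 / real N"
    proof (rule has_sum_mono[OF mean_has_sum])
      show "((\<lambda>m. real N * (of_int m ^ 0 * (J m)\<^sup>2) + (of_int m ^ 1 * (J m)\<^sup>2
          + inverse (real N) * (of_int m ^ 2 * (J m)\<^sup>2))) has_sum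
          (real N + miwa_moment t 2 0 / real N)) UNIV"
        using has_sum_add[OF has_sum_cmult_right[OF moment_has_sum[of 0], of "real N"]
            has_sum_add[OF moment_has_sum[of 1]
              has_sum_cmult_right[OF moment_has_sum[of 2], of "inverse (real N)"]]]
        by (simp add: moment_0 moment_1[simplified] divide_inverse mult.commute)
      fix m :: int
      have "of_int (max 0 (m - - int N)) \<le> real N + (of_int m + of_int m ^ 2 / real N)"
      proof (cases "0 \<le> m + int N")
        case True
        then show ?thesis by simp
      next
        case False
        then have "real N \<le> - of_int m" by linarith
        from mult_right_mono[OF this, of "- of_int m"] False
        have "- (real N * of_int m) \<le> of_int m ^ 2"
          by (simp add: power2_eq_square)
        then have "0 \<le> of_int m + of_int m ^ 2 / real N"
          using n(2) by (simp add: field_simps)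
        then show ?thesis using False by simp
      qed
      from mult_right_mono[OF this, of "(J m)\<^sup>2"]
      show "of_int (max 0 (m - - int N)) * (J m)\<^sup>2 \<le> real N * (of_int m ^ 0 * (J m)\<^sup>2) + (of_int m ^ 1 * (J m)\<^sup>2
          + inverse (real N) * (of_int m ^ 2 * (J m)\<^sup>2))"
        by (simp add: algebra_simps divide_inverse)
    qed
    ultimately show "miwa_mean t n - miwa_moment t 2 0 / real N \<le> S"
      by linarith
  qed
qed

end

section \<open>Normalization\<close>

lemma summable_on_finite_sum:
  fixes f :: "'i \<Rightarrow> 'a \<Rightarrow> real"
  assumes "\<And>i. i \<in> I \<Longrightarrow> f i summable_on A"
  shows "(\<lambda>a. \<Sum>i\<in>I. f i a) summable_on A"
  by (rule has_sum_imp_summable[OF has_sum_finite_sum]) (rule has_sum_infsum[OF assms])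

lemma exp_second_order: "0 \<le> x \<Longrightarrow> exp x - 1 - x \<le> x\<^sup>2 * exp x" for x :: real
proof -
  assume x: "0 \<le> x"
  define u where "u y = y\<^sup>2 * exp y - (exp y - 1 - y)" for y :: real
  have "u 0 \<le> u x"
  proof (rule DERIV_nonneg_imp_nondecreasing[OF x])
    fix y :: real assume y: "0 \<le> y" "y \<le> x"
    have "(u has_real_derivative (2 * y * exp y + y\<^sup>2 * exp y - (exp y - 1))) (at y)"
      unfolding u_def by (auto intro!: derivative_eq_intros simp: algebra_simps)
    moreover have "exp y - 1 \<le> y * exp y"
    proof -
      have "(1 - y) * exp y \<le> exp (- y) * exp y"
        using exp_ge_add_one_self[of "- y"] by (intro mult_right_mono) auto
      then show ?thesis by (simp add: exp_minus algebra_simps)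
    qed
    then have "0 \<le> 2 * y * exp y + y\<^sup>2 * exp y - (exp y - 1)"
    proof -
      assume "exp y - 1 \<le> y * exp y"
      moreover have "0 \<le> y * exp y" "0 \<le> y\<^sup>2 * exp y"
        using y by auto
      ultimately show ?thesis by linarith
    qed
    ultimately show "\<exists>d. (u has_real_derivative d) (at y) \<and> 0 \<le> d" by blast
  qed
  then show ?thesis by (simp add: u_def)
qed

text \<open>The half in the exponent makes squared Schur functions scale by
  \<open>exp (s * \<bar>\<lambda>\<bar>)\<close>, so \<open>s\<close> is conjugate to the size of
  the partition.\<close>

definition scale_times :: "real \<Rightarrow> (nat \<Rightarrow> real) \<Rightarrow> nat \<Rightarrow> real" where
  "scale_times s t r = exp (s / 2) ^ r * t r"

lemma scale_times_add: "scale_times \<delta> (scale_times s t) = scale_times (s + \<delta>) t"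
  by (rule ext) (simp add: scale_times_def power_mult_distrib[symmetric] exp_add[symmetric] add_divide_distrib add.commute)

lemma miwa_h_scale_times: "miwa_h (scale_times s t) k = exp (s * of_int k / 2) * miwa_h t k"
proof (cases "0 \<le> k")
  case True
  then have "exp (s / 2) ^ nat k = exp (s * of_int k / 2)"
    by (simp add: exp_of_nat_mult[symmetric] mult.commute)
  then show ?thesis by (simp add: scale_times_def[abs_def] miwa_h_scale)
qed (simp add: miwa_h_neg)

text \<open>The linear term is exact and produces the mean size; of the remainder only the order
  \<open>\<delta>\<^sup>2\<close> counts. Its power of 2 comes from
  \<open>exp \<delta> \<le> 2\<close> and stays summable against the decay of
  \<open>(J m)\<^sup>2\<close>.\<close>

lemma sum_exp_bound:
  assumes \<delta>: "0 \<le> \<delta>" "exp \<delta> \<le> 2"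
  shows "(\<Sum>l<n. exp (\<delta> * real l) - 1) \<le> \<delta> * (real n * (real n - 1) / 2) + \<delta>\<^sup>2 * (real n ^ 3 * 2 ^ n)"
proof -
  have "exp (\<delta> * real l) - 1 \<le> \<delta> * real l + \<delta>\<^sup>2 * (real n ^ 2 * 2 ^ n)" if "l < n" for l
  proof -
    have "exp (\<delta> * real l) - 1 - \<delta> * real l \<le> (\<delta> * real l)\<^sup>2 * exp (\<delta> * real l)"
      using \<delta> by (intro exp_second_order) simp
    also have "\<dots> \<le> \<delta>\<^sup>2 * (real n ^ 2 * 2 ^ n)"
    proof -
      have "exp (\<delta> * real l) = exp \<delta> ^ l"
        by (simp add: exp_of_nat_mult[symmetric] mult.commute)
      also have "\<dots> \<le> 2 ^ l"
        using \<delta> by (intro power_mono) auto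
      also have "\<dots> \<le> 2 ^ n"
        using that by (intro power_increasing) auto
      finally have "(real l)\<^sup>2 * exp (\<delta> * real l) \<le> (real n)\<^sup>2 * 2 ^ n"
        using that by (intro mult_mono power_mono) auto
      then show ?thesis
        by (simp add: power_mult_distrib mult.assoc mult_left_mono)
    qed
    finally show ?thesis by simp
  qed
  then have "(\<Sum>l<n. exp (\<delta> * real l) - 1) \<le> (\<Sum>l<n. \<delta> * real l + \<delta>\<^sup>2 * (real n ^ 2 * 2 ^ n))"
    by (intro sum_mono) auto
  also have "\<dots> = \<delta> * (\<Sum>l<n. real l) + \<delta>\<^sup>2 * (real n ^ 3 * 2 ^ n)"
    by (simp add: sum.distrib sum_distrib_left power3_eq_cube power2_eq_square)
  also have "(\<Sum>l<n. real l) = real n * (real n - 1) / 2"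
    by (induction n) (auto simp: field_simps)
  finally show ?thesis .
qed

text \<open>The second order remainder summed against the decay
  \<open>(1 / 4) ^ \<bar>m\<bar>\<close> of \<open>(J m)\<^sup>2\<close>, which beats the growth
  \<open>2 ^ \<bar>m\<bar>\<close>. It depends on \<open>N\<close> but not on the times.\<close>

definition tail_const :: "nat \<Rightarrow> real" where
  "tail_const N = (\<Sum>\<^sub>\<infinity>m::int. (\<bar>of_int m\<bar> + real N) ^ 3 * 2 ^ (nat \<bar>m\<bar> + N) * (1 / 4) ^ nat \<bar>m\<bar>)"

lemma tail_const_has_sum:
  "((\<lambda>m::int. (\<bar>of_int m\<bar> + real N) ^ 3 * 2 ^ (nat \<bar>m\<bar> + N) * (1 / 4) ^ nat \<bar>m\<bar>) has_sum tail_const N) UNIV"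
  unfolding tail_const_def
proof (rule has_sum_infsum, rule summable_on_bounded_by)
  show "(\<lambda>m::int. (real N + 1) ^ 3 * 2 ^ N * (\<Sum>p\<le>3. 8 * (\<bar>real_of_int m\<bar> ^ p * (1 / 2) ^ nat \<bar>m\<bar>))) summable_on UNIV"
    by (intro summable_on_cmult_right summable_on_finite_sum summable_on_int_poly_geometric) auto
  fix m :: int
  have 1: "(2 :: real) ^ (nat \<bar>m\<bar> + N) * (1 / 4) ^ nat \<bar>m\<bar> = 2 ^ N * (1 / 2) ^ nat \<bar>m\<bar>"
    by (simp add: power_add power_mult_distrib[symmetric])
  have "(\<bar>of_int m\<bar> + real N) \<le> (real N + 1) * (\<bar>of_int m\<bar> + 1)"
    by (simp add: algebra_simps)
  then have "(\<bar>of_int m\<bar> + real N) ^ 3 \<le> (real N + 1) ^ 3 * (\<bar>of_int m\<bar> + 1) ^ 3"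
    by (subst power_mult_distrib[symmetric]) (intro power_mono, auto)
  also have "\<dots> \<le> (real N + 1) ^ 3 * (\<Sum>p\<le>3. 8 * \<bar>of_int m\<bar> ^ p)"
  proof (rule mult_left_mono)
    define x where "x = \<bar>real_of_int m\<bar>"
    have "(\<Sum>p\<le>3. 8 * x ^ p) - (x + 1) ^ 3 = 7 + 5 * x + 5 * x ^ 2 + 7 * x ^ 3"
      by (simp add: eval_nat_numeral algebra_simps)
    moreover have "0 \<le> x" by (simp add: x_def)
    then have "0 \<le> 7 + 5 * x + 5 * x ^ 2 + 7 * x ^ 3" by simp
    ultimately show "(\<bar>of_int m\<bar> + 1) ^ 3 \<le> (\<Sum>p\<le>3. 8 * \<bar>real_of_int m\<bar> ^ p)"
      unfolding x_def by linarith
  qed simp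
  finally have "(\<bar>of_int m\<bar> + real N) ^ 3 * (2 ^ N * (1 / 2) ^ nat \<bar>m\<bar>)
      \<le> (real N + 1) ^ 3 * (\<Sum>p\<le>3. 8 * \<bar>of_int m\<bar> ^ p) * (2 ^ N * (1 / 2) ^ nat \<bar>m\<bar>)"
    by (intro mult_right_mono) auto
  also have "\<dots> = (real N + 1) ^ 3 * 2 ^ N * (\<Sum>p\<le>3. 8 * (\<bar>real_of_int m\<bar> ^ p * (1 / 2) ^ nat \<bar>m\<bar>))"
    by (simp add: sum_distrib_left sum_distrib_right mult_ac)
  finally show "\<bar>(\<bar>of_int m\<bar> + real N) ^ 3 * 2 ^ (nat \<bar>m\<bar> + N) * (1 / 4) ^ nat \<bar>m\<bar>\<bar>
      \<le> (real N + 1) ^ 3 * 2 ^ N * (\<Sum>p\<le>3. 8 * (\<bar>real_of_int m\<bar> ^ p * (1 / 2) ^ nat \<bar>m\<bar>))"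
    by (simp only: mult.assoc 1) simp
qed

context miwa
begin

lemma miwa_scale_times: "miwa (scale_times s t) R"
  by unfold_locales (simp add: scale_times_def finite_support)

lemma scale_times_product:
  "exp (\<delta> * (of_int a + real N - 1)) * h (a + int i) * h (a + int j)
    = exp (\<delta> * (real N - 1 - real i / 2)) * (miwa_h (scale_times \<delta> t) (a + int i) *
      miwa_h (scale_times \<delta> t) (a + int j)) * exp (- \<delta> * (real j / 2))"
proof -
  have "exp (\<delta> * (of_int a + real N - 1)) = exp (\<delta> * (real N - 1 - real i / 2)) *
      (exp (\<delta> * of_int (a + int i) / 2) * exp (\<delta> * of_int (a + int j) / 2)) * exp (- \<delta> * (real j / 2))"
    unfolding exp_add[symmetric] by (rule arg_cong[of _ _ exp]) (simp add: field_simps)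
  then show ?thesis
    unfolding miwa_h_scale_times by (simp only: mult_ac)
qed

text \<open>The exponential weight splits into row and column factors around the rescaled Toeplitz
  matrix. In terms of partitions, the sum of \<open>row_index l i + N - 1\<close> over
  \<open>i < N\<close> is the size plus \<open>N * (N - 1) / 2\<close>, which explains the
  prefactor.\<close>

lemma gram_det_scale:
  "dt N (miwa_gram t (\<lambda>a. exp (\<delta> * (of_int a + real N - 1))))
    = exp (\<delta> * (real N * (real N - 1) / 2)) * dt N (toeplitz (scale_times \<delta> t))"
proof -
  have "miwa_gram t (\<lambda>a. exp (\<delta> * (of_int a + real N - 1))) i j
      = exp (\<delta> * (real N - 1 - real i / 2)) * toeplitz (scale_times \<delta> t) i j * exp (- \<delta> * (real j / 2))" for i j
    unfolding miwa_gram_def scale_times_product by (simp add: infsum_cmult_right' infsum_cmult_left')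
  then have "dt N (miwa_gram t (\<lambda>a. exp (\<delta> * (of_int a + real N - 1))))
      = (\<Prod>i<N. exp (\<delta> * (real N - 1 - real i / 2))) * dt N (toeplitz (scale_times \<delta> t))
        * (\<Prod>j<N. exp (- \<delta> * (real j / 2)))"
    unfolding dt_scale[symmetric] by (intro dt_cong)
  also have "\<dots> = (\<Prod>i<N. exp (\<delta> * (real N - 1 - real i / 2)) * exp (- \<delta> * (real i / 2)))
      * dt N (toeplitz (scale_times \<delta> t))"
    by (simp only: prod.distrib mult_ac)
  also have "(\<Prod>i<N. exp (\<delta> * (real N - 1 - real i / 2)) * exp (- \<delta> * (real i / 2)))
      = exp (\<Sum>i<N. \<delta> * (real N - 1 - real i))"
    unfolding exp_sum[OF finite_lessThan] exp_add[symmetric] by (intro prod.cong refl arg_cong[of _ _ exp]) (simp add: field_simps)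
  also have "(\<Sum>i<N. \<delta> * (real N - 1 - real i)) = \<delta> * (real N * (real N - 1) / 2)"
  proof -
    have s: "(\<Sum>i<N. real i) = real N * (real N - 1) / 2"
      by (induction N) (auto simp: field_simps)
    show ?thesis
      unfolding sum_distrib_left[symmetric] sum_subtractf s by (simp add: field_simps)
  qed
  finally show ?thesis .
qed

text \<open>Determinant bound for the weight \<open>w a = exp (\<delta> * (a + N - 1))\<close>,
  which is at least 1 wherever \<open>\<kappa>\<close> is nonzero. The first order term is half of
  \<open>miwa_moment t 2 0 + N * (N - 1)\<close>; its second summand cancels the prefactor of
  \<open>gram_det_scale\<close>, which leaves half of \<open>moment_2_0\<close>.\<close>

lemma norm_step:
  assumes C: "\<And>k. \<bar>J k\<bar> \<le> C * (1 / 2) ^ nat \<bar>k\<bar>" and \<delta>: "0 \<le> \<delta>" "exp \<delta> \<le> 2"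
  shows "dt N (toeplitz (scale_times \<delta> t))
    \<le> dt N (toeplitz t) * exp (\<delta> * (\<Sum>r=1..R. (real r * t r)\<^sup>2) + \<delta>\<^sup>2 * (C\<^sup>2 * tail_const N))"
proof -
  obtain \<kappa> where "one_point N \<kappa>"
    using one_point_exists by blast
  note \<kappa> = one_pointD[OF this]
  define w where "w a = exp (\<delta> * (of_int a + real N - 1))" for a :: int
  have w0: "0 \<le> w a" for a
    by (simp add: w_def)
  have whh: "(\<lambda>a. w a * h (a + int i) * h (a + int j)) summable_on UNIV" for i j
    unfolding w_def scale_times_product
    by (intro summable_on_cmult_left summable_on_cmult_right miwa.summable_hh[OF miwa_scale_times])
  have w\<kappa>: "(\<lambda>a. w a * \<kappa> a) summable_on UNIV"
    and bound: "dt N (miwa_gram t w) \<le> dt N (toeplitz t) * exp ((\<Sum>\<^sub>\<infinity>a. w a * \<kappa> a) - real N)"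
    using \<kappa>(5)[OF w0 whh] by blast+
  \<comment> \<open>Cumulative excess \<open>w a - 1\<close> over \<open>- N < a \<le> m\<close>,
    with \<open>l = a + N - 1\<close>.\<close>
  define W where "W m = (\<Sum>l<nat (m + int N). exp (\<delta> * real l) - 1)" for m
  define S where "S = \<delta> * ((miwa_moment t 2 0 + real N * (real N - 1)) / 2) + \<delta>\<^sup>2 * (C\<^sup>2 * tail_const N)"
  define V where "V m = \<delta> / 2 * (of_int m ^ 2 * (J m)\<^sup>2 + ((2 * real N - 1) * (of_int m ^ 1 * (J m)\<^sup>2)
      + real N * (real N - 1) * (of_int m ^ 0 * (J m)\<^sup>2)))
    + \<delta>\<^sup>2 * (C\<^sup>2 * ((\<bar>of_int m\<bar> + real N) ^ 3 * 2 ^ (nat \<bar>m\<bar> + N) * (1 / 4) ^ nat \<bar>m\<bar>))" for m :: int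
  have V: "(V has_sum S) UNIV"
  proof -
    have "(V has_sum (\<delta> / 2 * (miwa_moment t 2 0 + ((2 * real N - 1) * miwa_moment t 1 0
      + real N * (real N - 1) * miwa_moment t 0 0)) + \<delta>\<^sup>2 * (C\<^sup>2 * tail_const N))) UNIV"
      unfolding V_def by (intro has_sum_add has_sum_cmult_right moment_has_sum tail_const_has_sum)
    then show ?thesis
      by (simp add: S_def moment_0 moment_1[simplified])
  qed
  have WV: "W m * (J m)\<^sup>2 \<le> V m" for m
  proof -
    let ?n = "nat (m + int N)"
    have J2: "(J m)\<^sup>2 \<le> C\<^sup>2 * (1 / 4) ^ nat \<bar>m\<bar>"
    proof -
      have "\<bar>J m\<bar>\<^sup>2 \<le> (C * (1 / 2) ^ nat \<bar>m\<bar>)\<^sup>2"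
        by (intro power_mono C) simp
      then show ?thesis
        by (simp add: power_mult_distrib power2_eq_square[of "_ ^ _"] power_mult_distrib[symmetric])
    qed
    \<comment> \<open>Truncating \<open>m + N\<close> at 0 can only lower the product, because
      \<open>x * (x - 1)\<close> is nonnegative for \<open>x \<le> 0\<close>.\<close>
    have n1: "real ?n * (real ?n - 1) \<le> (of_int m + real N) * (of_int m + real N - 1)"
    proof (cases "0 \<le> m + int N")
      case True
      then have "real ?n = of_int m + real N" by simp
      then show ?thesis by simp
    next
      case False
      then have "of_int m + real N \<le> 0" by linarith
      then have "0 \<le> (of_int m + real N) * (of_int m + real N - 1)"
        by (intro mult_nonpos_nonpos) auto
      then show ?thesis using False by simp
    qed
    have n2: "real ?n ^ 3 * 2 ^ ?n * (J m)\<^sup>2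
        \<le> (\<bar>of_int m\<bar> + real N) ^ 3 * 2 ^ (nat \<bar>m\<bar> + N) * (C\<^sup>2 * (1 / 4) ^ nat \<bar>m\<bar>)"
    proof (intro mult_mono J2 power_mono)
      show "real ?n \<le> \<bar>of_int m\<bar> + real N" by linarith
      show "(2 :: real) ^ ?n \<le> 2 ^ (nat \<bar>m\<bar> + N)" by (intro power_increasing) auto
    qed auto
    have "W m * (J m)\<^sup>2 \<le> (\<delta> * (real ?n * (real ?n - 1) / 2) + \<delta>\<^sup>2 * (real ?n ^ 3 * 2 ^ ?n)) * (J m)\<^sup>2"
      unfolding W_def by (intro mult_right_mono sum_exp_bound \<delta>) simp
    also have "\<dots> = \<delta> / 2 * (real ?n * (real ?n - 1) * (J m)\<^sup>2) + \<delta>\<^sup>2 * (real ?n ^ 3 * 2 ^ ?n * (J m)\<^sup>2)"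
      by (simp add: field_simps)
    also have "\<dots> \<le> \<delta> / 2 * ((of_int m + real N) * (of_int m + real N - 1) * (J m)\<^sup>2)
        + \<delta>\<^sup>2 * ((\<bar>of_int m\<bar> + real N) ^ 3 * 2 ^ (nat \<bar>m\<bar> + N) * (C\<^sup>2 * (1 / 4) ^ nat \<bar>m\<bar>))"
      using \<delta>(1) by (intro add_mono mult_left_mono mult_right_mono n1 n2) auto
    also have "\<dots> = V m"
    proof -
      have "(of_int m + real N) * (of_int m + real N - 1) * (J m)\<^sup>2
          = of_int m ^ 2 * (J m)\<^sup>2 + ((2 * real N - 1) * (of_int m ^ 1 * (J m)\<^sup>2)
            + real N * (real N - 1) * (of_int m ^ 0 * (J m)\<^sup>2))"
        by (simp add: power2_eq_square algebra_simps)
      then show ?thesis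
        unfolding V_def by (simp only: mult_ac)
    qed
    finally show ?thesis .
  qed
  have W0: "0 \<le> W m" for m
    unfolding W_def using \<delta> by (intro sum_nonneg) auto
  have "(\<lambda>m. W m * (J m)\<^sup>2) summable_on UNIV"
    by (rule summable_on_bounded_by[OF has_sum_imp_summable[OF V]]) (simp add: abs_mult W0 WV)
  then have WS: "((\<lambda>m. W m * (J m)\<^sup>2) has_sum (\<Sum>\<^sub>\<infinity>m. W m * (J m)\<^sup>2)) UNIV"
    by (rule has_sum_infsum)
  have SS: "(\<Sum>\<^sub>\<infinity>m. W m * (J m)\<^sup>2) \<le> S"
    by (rule has_sum_mono[OF WS V WV])
  have diff: "((\<lambda>a. w a * \<kappa> a - \<kappa> a) has_sum ((\<Sum>\<^sub>\<infinity>a. w a * \<kappa> a) - real N)) UNIV"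
    using has_sum_add[OF has_sum_infsum[OF w\<kappa>] has_sum_cmult_right[OF \<kappa>(2), of "-1"]] by simp
  have "(\<Sum>\<^sub>\<infinity>a. w a * \<kappa> a) - real N \<le> S"
  proof (rule has_sum_le_finite_sums[OF diff])
    fix F :: "int set" assume F: "finite F"
    have "(\<Sum>a\<in>F. w a * \<kappa> a - \<kappa> a) = (\<Sum>a\<in>F \<inter> {- int N<..}. (w a - 1) * \<kappa> a)"
      using F \<kappa>(4) by (intro sum.mono_neutral_cong_right) (auto simp: algebra_simps not_less)
    also have "\<dots> \<le> (\<Sum>\<^sub>\<infinity>m. W m * (J m)\<^sup>2)"
    proof (rule kernel_sum_bound[OF _ _ \<kappa>(3) _ WS])
      have w1: "0 \<le> w a - 1" if "- int N < a" for a
      proof -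
        have "0 \<le> real_of_int a + real N - 1" using that by linarith
        then show ?thesis using \<delta> by (simp add: w_def)
      qed
      then show "0 \<le> w a - 1" if "a \<in> F \<inter> {- int N<..}" for a using that by auto
      fix m
      have "(\<Sum>a\<in>F \<inter> {- int N<..}. if a \<le> m then w a - 1 else 0) = (\<Sum>a\<in>F \<inter> {- int N<..m}. w a - 1)"
        using F by (intro sum.mono_neutral_cong_right) auto
      also have "\<dots> \<le> (\<Sum>a\<in>{- int N<..m}. w a - 1)"
        using w1 by (intro sum_mono2) auto
      also have "\<dots> = W m"
        unfolding W_def
      proof (rule sum.reindex_bij_witness[of _ "\<lambda>l. int l - int N + 1" "\<lambda>a. nat (a + int N - 1)"])
        fix a assume "a \<in> {- int N<..m}"
        then have "real (nat (a + int N - 1)) = of_int a + real N - 1" by auto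
        then show "exp (\<delta> * real (nat (a + int N - 1))) - 1 = w a - 1"
          by (simp add: w_def)
      qed auto
      finally show "(\<Sum>a\<in>F \<inter> {- int N<..}. if a \<le> m then w a - 1 else 0) \<le> W m" .
    qed (use F in auto)
    finally show "(\<Sum>a\<in>F. w a * \<kappa> a - \<kappa> a) \<le> S" using SS by simp
  qed
  then have "exp (- \<delta> * (real N * (real N - 1) / 2)) * exp ((\<Sum>\<^sub>\<infinity>a. w a * \<kappa> a) - real N)
      \<le> exp (\<delta> * (\<Sum>r=1..R. (real r * t r)\<^sup>2) + \<delta>\<^sup>2 * (C\<^sup>2 * tail_const N))"
    unfolding exp_add[symmetric] exp_le_cancel_iff S_def moment_2_0 by (simp add: field_simps)
  then have *: "dt N (toeplitz t) * (exp (- \<delta> * (real N * (real N - 1) / 2)) * exp ((\<Sum>\<^sub>\<infinity>a. w a * \<kappa> a) - real N))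
      \<le> dt N (toeplitz t) * exp (\<delta> * (\<Sum>r=1..R. (real r * t r)\<^sup>2) + \<delta>\<^sup>2 * (C\<^sup>2 * tail_const N))"
    using gram_det_ge_1[of N] by (intro mult_left_mono) auto
  have "dt N (toeplitz (scale_times \<delta> t)) = exp (- \<delta> * (real N * (real N - 1) / 2)) * dt N (miwa_gram t w)"
    unfolding w_def gram_det_scale mult.assoc[symmetric] exp_add[symmetric] by simp
  also have "\<dots> \<le> exp (- \<delta> * (real N * (real N - 1) / 2)) *
      (dt N (toeplitz t) * exp ((\<Sum>\<^sub>\<infinity>a. w a * \<kappa> a) - real N))"
    by (intro mult_left_mono bound) simp
  finally show ?thesis using * by (simp add: mult_ac)
qed

end

context miwa
begin

text \<open>Let \<open>D s\<close> be the Gram determinant for the times \<open>exp (s r / 2) * t r\<close>, a scaling under which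
  \<open>s\<^sub>\<lambda>\<close> is multiplied by \<open>exp (s \<bar>\<lambda>\<bar> / 2)\<close>. The bound on the mean size turns into
  \<open>ln D (s + \<delta>) - ln D s \<le> \<Phi> (s + \<delta>) - \<Phi> s + O (\<delta>\<^sup>2)\<close> with \<open>\<Phi> s = (\<Sum>r. r * exp (s r) * (t r)\<^sup>2)\<close>,
  and both \<open>ln D\<close> and \<open>\<Phi>\<close> vanish at \<open>- \<infinity>\<close>.\<close>

lemma gram_det_le_exp: "dt N (toeplitz t) \<le> exp Z"
proof -
  obtain A where A: "0 \<le> A" "\<And>k. \<bar>h k\<bar> \<le> A * (1 / 4) ^ nat \<bar>k\<bar>" using h_bound by blast
  obtain B where B: "0 \<le> B" "\<And>k. \<bar>e k\<bar> \<le> B * (1 / 4) ^ nat \<bar>k\<bar>" using e_bound by blast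
  define C where "C = A * B * (\<Sum>\<^sub>\<infinity>i::int. (1 / 2) ^ nat \<bar>i\<bar>)"
  \<comment> \<open>For \<open>s \<le> 0\<close> the scaling shrinks the coefficients of both
    series, so the errors of all steps share one constant.\<close>
  have J: "\<bar>miwa_J (scale_times s t) k\<bar> \<le> C * (1 / 2) ^ nat \<bar>k\<bar>" if "s \<le> 0" for s k
  proof -
    have *: "\<bar>miwa_h (scale_times s u) k\<bar> \<le> M * (1 / 4) ^ nat \<bar>k\<bar>"
      if "\<And>k. \<bar>miwa_h u k\<bar> \<le> M * (1 / 4) ^ nat \<bar>k\<bar>" for u k M
    proof (cases "0 \<le> k")
      case True
      then have "exp (s * of_int k / 2) \<le> 1"
        using \<open>s \<le> 0\<close> by (simp add: mult_nonpos_nonneg)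
      then have "exp (s * of_int k / 2) * \<bar>miwa_h u k\<bar> \<le> 1 * \<bar>miwa_h u k\<bar>"
        by (intro mult_right_mono) auto
      then show ?thesis
        unfolding miwa_h_scale_times using that[of k] by (simp add: abs_mult)
    next
      case False
      then show ?thesis using that[of k] by (simp add: miwa_h_neg)
    qed
    have "(\<lambda>r. - scale_times s t r) = scale_times s (\<lambda>r. - t r)"
      by (simp add: scale_times_def[abs_def])
    then show ?thesis
      unfolding C_def miwa_J_def using corr_geometric_bound[OF *[OF A(2)] *[OF B(2)]] by simp
  qed
  define K where "K = C\<^sup>2 * tail_const N"
  define D where "D s = dt N (toeplitz (scale_times s t))" for s
  define \<Phi> where "\<Phi> s = (\<Sum>r=1..R. real r * exp (s * real r) * (t r)\<^sup>2)" for s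
  define u where "u s = ln (D s) - \<Phi> s" for s
  have D1: "1 \<le> D s" for s
    unfolding D_def by (rule miwa.gram_det_ge_1[OF miwa_scale_times])
  have step: "u (s + \<delta>) \<le> u s + \<delta>\<^sup>2 * K" if s: "s \<le> 0" and \<delta>: "0 \<le> \<delta>" "exp \<delta> \<le> 2" for s \<delta>
  proof -
    have "D (s + \<delta>) \<le> D s * exp (\<delta> * (\<Sum>r=1..R. (real r * scale_times s t r)\<^sup>2) + \<delta>\<^sup>2 * K)"
      unfolding D_def K_def scale_times_add[symmetric]
      by (rule miwa.norm_step[OF miwa_scale_times J[OF s] \<delta>])
    then have "ln (D (s + \<delta>)) \<le> ln (D s * exp (\<delta> * (\<Sum>r=1..R. (real r * scale_times s t r)\<^sup>2) + \<delta>\<^sup>2 * K))"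
      using D1[of "s + \<delta>"] D1[of s] by (subst ln_le_cancel_iff) auto
    also have "\<dots> = ln (D s) + (\<delta> * (\<Sum>r=1..R. (real r * scale_times s t r)\<^sup>2) + \<delta>\<^sup>2 * K)"
      using D1[of s] by (subst ln_mult) auto
    \<comment> \<open>Convexity of \<open>\<Phi>\<close>: the left side is \<open>\<delta>\<close>
      times its derivative at \<open>s\<close>.\<close>
    also have "\<delta> * (\<Sum>r=1..R. (real r * scale_times s t r)\<^sup>2) \<le> \<Phi> (s + \<delta>) - \<Phi> s"
      unfolding \<Phi>_def sum_distrib_left sum_subtractf[symmetric]
    proof (rule sum_mono)
      fix r
      have 1: "exp (s / 2) ^ r * exp (s / 2) ^ r = exp (s * real r)"
        by (simp add: exp_of_nat_mult[symmetric] exp_add[symmetric] algebra_simps)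
      have 2: "exp ((s + \<delta>) * real r) = exp (s * real r) * exp (\<delta> * real r)"
        by (simp add: exp_add[symmetric] algebra_simps)
      have "\<delta> * (real r * scale_times s t r)\<^sup>2 = (\<delta> * real r) * (real r * exp (s * real r) * (t r)\<^sup>2)"
        unfolding scale_times_def 1[symmetric] by (simp add: power2_eq_square mult_ac)
      also have "\<dots> \<le> (exp (\<delta> * real r) - 1) * (real r * exp (s * real r) * (t r)\<^sup>2)"
      proof (rule mult_right_mono)
        show "\<delta> * real r \<le> exp (\<delta> * real r) - 1"
          using exp_ge_add_one_self[of "\<delta> * real r"] by linarith
      qed simp
      finally show "\<delta> * (real r * scale_times s t r)\<^sup>2
          \<le> real r * exp ((s + \<delta>) * real r) * (t r)\<^sup>2 - real r * exp (s * real r) * (t r)\<^sup>2"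
        unfolding 2 by (simp add: algebra_simps)
    qed
    finally show ?thesis by (simp add: u_def)
  qed
  \<comment> \<open>The way from \<open>s\<close> to 0 is divided into \<open>n\<close> steps of
    length \<open>- s / n\<close>, with total error \<open>s\<^sup>2 * K / n\<close>.\<close>
  have mono: "u 0 \<le> u s" if s: "s \<le> 0" for s
  proof (rule tendsto_lowerbound)
    show "(\<lambda>n. u s + s\<^sup>2 * K * (1 / real n)) \<longlonglongrightarrow> u s"
      by (auto intro!: tendsto_eq_intros lim_1_over_n)
    have "(\<lambda>n. exp (- s * (1 / real n))) \<longlonglongrightarrow> exp (- s * 0)"
      by (intro tendsto_intros lim_1_over_n)
    then have "\<forall>\<^sub>F n in sequentially. exp (- s * (1 / real n)) < 2"
      by (intro order_tendstoD(2)) auto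
    with eventually_gt_at_top[of 0]
    show "\<forall>\<^sub>F n in sequentially. u 0 \<le> u s + s\<^sup>2 * K * (1 / real n)"
    proof eventually_elim
      case (elim n)
      define \<delta> where "\<delta> = - s / real n"
      have \<delta>: "0 \<le> \<delta>" "exp \<delta> \<le> 2" "s = - (real n * \<delta>)"
        using elim s by (auto simp: \<delta>_def divide_nonpos_nonneg)
      have "u (s + real k * \<delta>) \<le> u s + real k * (\<delta>\<^sup>2 * K)" if "k \<le> n" for k
        using that
      proof (induction k)
        case (Suc k)
        have "real k * \<delta> \<le> real n * \<delta>"
          using Suc.prems \<delta>(1) by (intro mult_right_mono) auto
        then have "u (s + real k * \<delta> + \<delta>) \<le> u (s + real k * \<delta>) + \<delta>\<^sup>2 * K"
          using \<delta> by (intro step) auto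
        then show ?case using Suc by (simp add: algebra_simps)
      qed simp
      from this[of n] have "u 0 \<le> u s + real n * (\<delta>\<^sup>2 * K)"
        using \<delta>(3) by simp
      also have "real n * (\<delta>\<^sup>2 * K) = s\<^sup>2 * K * (1 / real n)"
        using elim by (simp add: \<delta>_def power2_eq_square field_simps)
      finally show ?case .
    qed
  qed simp
  have hh: "((\<lambda>k. h k * h k) has_sum corr h h 0) UNIV"
    using corr_has_sum[OF summable_h summable_h, of 0] by simp
  \<comment> \<open>Hadamard's inequality at the left end: each diagonal entry is at most 1 plus a
    multiple of \<open>exp s\<close>.\<close>
  have upper: "u s \<le> real N * (exp s * corr h h 0)" if s: "s \<le> 0" for s
  proof -
    interpret s: miwa "scale_times s t" R by (rule miwa_scale_times)
    have diag: "toeplitz (scale_times s t) i i \<le> 1 + exp s * corr h h 0" for i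
    proof -
      have "((\<lambda>a. 1 * s.h (a + int i) * s.h (a + int i)) has_sum toeplitz (scale_times s t) i i) UNIV"
        unfolding miwa_gram_def using s.summable_hh[of "int i" "int i"] by (intro has_sum_infsum) simp
      then have "((\<lambda>k. s.h k * s.h k) has_sum toeplitz (scale_times s t) i i) UNIV"
        using has_sum_int_shift[of "\<lambda>k. s.h k * s.h k" "int i"] by simp
      moreover have "((\<lambda>k. (if k = 0 then 1 else 0) + exp s * (h k * h k)) has_sum (1 + exp s * corr h h 0)) UNIV"
        by (intro has_sum_add has_sum_cmult_right hh has_sum_finite_neutralI[of "{0}"]) auto
      moreover have "s.h k * s.h k \<le> (if k = 0 then 1 else 0) + exp s * (h k * h k)" for k
      proof (cases "k \<le> 0")
        case True
        then show ?thesis by (cases "k = 0") (auto simp: miwa_h_neg miwa_h_0)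
      next
        case False
        then have "exp (s * of_int k) \<le> exp s"
          using s mult_left_mono_neg[of 1 "of_int k" s] by simp
        then have "exp (s * of_int k) * (h k * h k) \<le> exp s * (h k * h k)"
          by (intro mult_right_mono) auto
        moreover have "exp (s * of_int k) = exp (s * of_int k / 2) * exp (s * of_int k / 2)"
          by (simp add: exp_add[symmetric])
        ultimately show ?thesis using False by (simp add: miwa_h_scale_times mult_ac)
      qed
      ultimately show ?thesis by (rule has_sum_mono)
    qed
    have H0: "0 \<le> corr h h 0" by (rule has_sum_nonneg[OF hh]) simp
    have "D s \<le> (\<Prod>i<N. toeplitz (scale_times s t) i i)"
      unfolding D_def
    proof (rule hadamard)
      show "toeplitz (scale_times s t) i j = toeplitz (scale_times s t) j i" for i j
        unfolding miwa_gram_def by (simp add: mult_ac)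
      show "0 \<le> qform N (toeplitz (scale_times s t)) c" for c
        by (rule has_sum_nonneg[OF s.gram_quadratic_form]) simp
    qed
    also have "\<dots> \<le> (\<Prod>i<N. 1 + exp s * corr h h 0)"
    proof (intro prod_mono conjI diag)
      show "0 \<le> toeplitz (scale_times s t) i i" for i
        unfolding miwa_gram_def by (intro infsum_nonneg) simp
    qed
    also have "\<dots> \<le> (\<Prod>i<N. exp (exp s * corr h h 0))"
      using H0 by (intro prod_mono) auto
    also have "\<dots> = exp (real N * (exp s * corr h h 0))"
      by (simp add: exp_of_nat_mult)
    finally have "ln (D s) \<le> real N * (exp s * corr h h 0)"
      using D1[of s] ln_le_cancel_iff[of "D s" "exp (real N * (exp s * corr h h 0))"] by simp
    moreover have "0 \<le> \<Phi> s"
      unfolding \<Phi>_def by (intro sum_nonneg) auto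
    ultimately show ?thesis by (simp add: u_def)
  qed
  have "u 0 \<le> 0"
  proof (rule tendsto_lowerbound)
    have "((\<lambda>s. real N * (exp s * corr h h 0)) \<longlongrightarrow> real N * (0 * corr h h 0)) at_bot"
      by (intro tendsto_intros exp_at_bot)
    then show "((\<lambda>s. real N * (exp s * corr h h 0)) \<longlongrightarrow> 0) at_bot" by simp
    show "\<forall>\<^sub>F s in at_bot. u 0 \<le> real N * (exp s * corr h h 0)"
      using eventually_le_at_bot[of 0] by eventually_elim (use mono upper in \<open>fastforce intro: order.trans\<close>)
  qed simp
  then have "ln (D 0) \<le> Z"
    by (simp add: u_def \<Phi>_def)
  then have "exp (ln (D 0)) \<le> exp Z"
    by (simp only: exp_le_cancel_iff)
  then have "D 0 \<le> exp Z"
    using D1[of 0] by simp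
  then show ?thesis
    by (simp add: D_def scale_times_def[abs_def])
qed

end

section \<open>Partitions as strictly decreasing sequences of integers\<close>

definition row_index :: "nat list \<Rightarrow> nat \<Rightarrow> int" where
  "row_index l i = int (part l (i + 1)) - int i"

lemma part_antimono:
  assumes "l \<in> partitions" "1 \<le> i" "i \<le> j"
  shows "part l j \<le> part l i"
proof (cases "i < j \<and> j \<le> length l")
  case True
  then have "l ! (j - 1) \<le> l ! (i - 1)"
    using assms by (intro sorted_wrt_nth_less[of "(\<ge>)" l, simplified]) (auto simp: partitions_def)
  then show ?thesis using True assms by (simp add: part_def)
qed (use assms in \<open>auto simp: part_def\<close>)

lemma row_index_less:
  assumes "l \<in> partitions" "i < j"
  shows "row_index l j < row_index l i"
  using part_antimono[OF assms(1), of "i + 1" "j + 1"] assms(2) by (simp add: row_index_def)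

lemma row_index_inj: "l \<in> partitions \<Longrightarrow> row_index l i = row_index l j \<Longrightarrow> i = j"
  using row_index_less[of l i j] row_index_less[of l j i] by (cases i j rule: linorder_cases) auto

lemma row_index_list:
  assumes "l \<in> partitions"
  shows "sorted (map (row_index l) (rev [0..<N])) \<and> distinct (map (row_index l) (rev [0..<N]))"
proof -
  have "sorted_wrt (\<lambda>i j. row_index l j \<le> row_index l i) [0..<N]"
    using row_index_less[OF assms] by (auto simp: sorted_wrt_iff_nth_less less_imp_le)
  moreover have "inj_on (row_index l) A" for A
    using row_index_inj[OF assms] by (rule inj_onI)
  ultimately show ?thesis
    by (simp add: sorted_wrt_map sorted_wrt_rev distinct_map del: rev_map)
qed

lemma partition_eq_takeWhile:
  assumes "l \<in> partitions" "length l \<le> N"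
  shows "l = takeWhile (\<lambda>k. k \<noteq> 0) (map (\<lambda>i. part l (i + 1)) [0..<N])"
proof -
  have "map (\<lambda>i. part l (i + 1)) [0..<N] = l @ replicate (N - length l) 0"
    using assms(2) by (intro nth_equalityI) (auto simp: part_def nth_append)
  moreover have "\<forall>k\<in>set l. k \<noteq> 0"
    using assms(1) by (metis (mono_tags, lifting) mem_Collect_eq partitions_def)
  ultimately show ?thesis
    by (simp add: takeWhile_append2)
qed

text \<open>Injectivity condition of \<open>cauchy_binet_infsum_le\<close>. A strictly decreasing
  sequence is determined by its set of values, which does not see \<open>p\<close> and
  \<open>q\<close>; once the partitions agree, distinctness of the rows forces
  \<open>p = q\<close>.\<close>

lemma row_index_permute_inj:
  assumes l: "l \<in> partitions" "l' \<in> partitions" "length l \<le> N" "length l' \<le> N"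
    and p: "p permutes {0..<N}" "q permutes {0..<N}"
    and eq: "\<forall>i<N. row_index l (p i) = row_index l' (q i)"
  shows "l = l' \<and> p = q"
proof -
  have img: "row_index m ` {..<N} = (\<lambda>i. row_index m (p i)) ` {..<N}" if "p permutes {0..<N}" for m p
    using permutes_image[OF that] by (simp add: lessThan_atLeast0 image_image[symmetric])
  have "row_index l ` {..<N} = row_index l' ` {..<N}"
    unfolding img[OF p(1), of l] img[OF p(2), of l'] using eq by (intro image_cong) auto
  then have "map (row_index l) (rev [0..<N]) = map (row_index l') (rev [0..<N])"
    using row_index_list[OF l(1), of N] row_index_list[OF l(2), of N]
    by (intro sorted_distinct_set_unique) (auto simp: lessThan_atLeast0)
  then have "map (\<lambda>i. part l (i + 1)) [0..<N] = map (\<lambda>i. part l' (i + 1)) [0..<N]"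
    by (auto simp: row_index_def)
  then have "l = l'"
    using partition_eq_takeWhile[OF l(1,3)] partition_eq_takeWhile[OF l(2,4)] by (simp only:)
  moreover have "p i = q i" for i
  proof (cases "i < N")
    case True
    then show ?thesis using eq \<open>l = l'\<close> row_index_inj[OF l(1)] by blast
  next
    case False
    then show ?thesis using permutes_not_in[OF p(1), of i] permutes_not_in[OF p(2), of i] by auto
  qed
  ultimately show ?thesis by auto
qed

text \<open>Padding by an empty row preserves the determinant: the entries \<open>h (j - N)\<close>
  of the new last row are 0 for \<open>j < N\<close> and 1 for \<open>j = N\<close>.\<close>

lemma schur_dt:
  assumes "length l \<le> N"
  shows "dt N (\<lambda>i j. miwa_h t (row_index l i + int j)) = schur l t"
  using assms
proof (induction N rule: dec_induct)
  case base
  show ?case unfolding dt_def schur_def row_index_def ..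
next
  case (step N)
  define A where "A = mat (Suc N) (Suc N) (\<lambda>(i, j). miwa_h t (row_index l i + int j))"
  have A: "A \<in> carrier_mat (Suc N) (Suc N)" by (simp add: A_def)
  have last: "A $$ (N, j) = (if j = N then 1 else 0)" if "j < Suc N" for j
    using that step.hyps by (auto simp: A_def row_index_def part_def miwa_h_0 miwa_h_neg)
  have "Determinant.det A = (\<Sum>j<Suc N. A $$ (N, j) * cofactor A N j)"
    by (rule laplace_expansion_row[OF A]) simp
  also have "\<dots> = (\<Sum>j<Suc N. if j = N then cofactor A N N else 0)"
    by (intro sum.cong) (auto simp: last)
  also have "\<dots> = cofactor A N N"
    by simp
  also have "\<dots> = Determinant.det (mat_delete A N N)"
    by (simp add: cofactor_def)
  also have "mat_delete A N N = mat N N (\<lambda>(i, j). miwa_h t (row_index l i + int j))"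
    by (rule eq_matI) (auto simp: mat_delete_def A_def)
  finally show ?case
    using step.IH by (simp add: dt_def A_def)
qed

definition particle_count :: "nat list \<Rightarrow> int \<Rightarrow> nat" where
  "particle_count l n = card {k \<in> particles l. k > of_int n}"

text \<open>Rows \<open>i \<ge> N\<close> are empty and sit at \<open>- i \<le> n\<close>, so they
  do not count. For integers \<open>n < a - 1 / 2\<close> and \<open>n < a\<close> agree, which
  disposes of the half-integer offset.\<close>

lemma particle_set:
  assumes "length l \<le> N" "- int N \<le> n"
  shows "{k \<in> particles l. k > of_int n} = (\<lambda>i. of_int (row_index l i) - 1 / 2) ` {i \<in> {..<N}. n < row_index l i}"
proof -
  have val: "real (part l (Suc i)) - real (Suc i) + 1 / 2 = of_int (row_index l i) - 1 / 2" for i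
    by (simp add: row_index_def)
  have gt: "of_int n < real_of_int a - 1 / 2 \<longleftrightarrow> n < a" for a
    by linarith
  have "particles l = (\<lambda>i. of_int (row_index l i) - 1 / 2) ` UNIV"
  proof -
    have "particles l = (\<lambda>i. real (part l i) - real i + 1 / 2) ` {1..}"
      by (auto simp: particles_def)
    also have "{1..} = Suc ` UNIV"
      by (auto simp: image_iff) (metis Suc_le_D)
    finally show ?thesis by (simp only: image_image val)
  qed
  moreover have "i < N" if "n < row_index l i" for i
    using that assms by (auto simp: row_index_def part_def split: if_splits)
  ultimately show ?thesis
    by (auto simp: gt)
qed

lemma particle_count_eq:
  assumes l: "l \<in> partitions" and N: "length l \<le> N" "- int N \<le> n"
  shows "particle_count l n = card {i \<in> {..<N}. n < row_index l i}"
  unfolding particle_count_def particle_set[OF N]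
  by (rule card_image) (auto simp: inj_on_def dest: row_index_inj[OF l])

lemma prod_step_weight:
  assumes l: "l \<in> partitions" and N: "length l \<le> N" "- int N \<le> n"
  shows "(\<Prod>i<N. step_weight n z (row_index l i)) = (1 + z) ^ particle_count l n"
proof -
  have "(\<Prod>i<N. step_weight n z (row_index l i)) = (\<Prod>i\<in>{i \<in> {..<N}. n < row_index l i}. 1 + z)"
    by (intro prod.mono_neutral_cong_right) (auto simp: step_weight_def)
  then show ?thesis
    by (simp add: particle_count_eq[OF assms])
qed

text \<open>The truncation level \<open>N\<close> tends to infinity for a fixed finite set
  \<open>F\<close>. The sign of \<open>z\<close> decides which of the two bounds on \<open>S\<close>
  is used; the lower one leaves the vanishing error \<open>miwa_moment t 2 0 / N\<close>.\<close>

lemma (in miwa) exp_moment_le: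
  assumes F: "finite F" "F \<subseteq> partitions" and z: "- 1 < z"
  shows "(\<Sum>l\<in>F. (schur l t)\<^sup>2 * (1 + z) ^ particle_count l n) \<le> exp (Z + z * miwa_mean t n)"
proof (rule tendsto_lowerbound)
  have "(\<lambda>N. exp (Z + z * miwa_mean t n + \<bar>z\<bar> * miwa_moment t 2 0 * (1 / real N)))
      \<longlonglongrightarrow> exp (Z + z * miwa_mean t n + \<bar>z\<bar> * miwa_moment t 2 0 * 0)"
    by (intro tendsto_intros lim_1_over_n)
  then show "(\<lambda>N. exp (Z + z * miwa_mean t n + \<bar>z\<bar> * miwa_moment t 2 0 * (1 / real N)))
      \<longlonglongrightarrow> exp (Z + z * miwa_mean t n)" by simp
  \<comment> \<open>From \<open>N0\<close> on, every partition in \<open>F\<close> fits into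
    \<open>N\<close> rows, and \<open>- N \<le> n\<close>.\<close>
  define N0 where "N0 = Max (insert 1 (insert (nat (- n)) (length ` F)))"
  show "\<forall>\<^sub>F N in sequentially. (\<Sum>l\<in>F. (schur l t)\<^sup>2 * (1 + z) ^ particle_count l n)
      \<le> exp (Z + z * miwa_mean t n + \<bar>z\<bar> * miwa_moment t 2 0 * (1 / real N))"
    using eventually_ge_at_top[of N0]
  proof eventually_elim
    case (elim N)
    have "x \<le> N" if "x \<in> insert 1 (insert (nat (- n)) (length ` F))" for x
    proof -
      have "x \<le> N0"
        unfolding N0_def using that F(1) by (intro Max_ge) auto
      then show ?thesis using elim by simp
    qed
    then have N: "1 \<le> N" "nat (- n) \<le> N" "\<And>l. l \<in> F \<Longrightarrow> length l \<le> N"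
      by auto
    then have n: "- int N \<le> n" by linarith
    obtain S where S1: "dt N (miwa_gram t (step_weight n z)) \<le> dt N (toeplitz t) * exp (z * S)"
      and S: "S \<le> miwa_mean t n" "- int N \<le> n \<Longrightarrow> 0 < N \<Longrightarrow> miwa_mean t n - miwa_moment t 2 0 / real N \<le> S"
      by (rule gram_step[OF z, of N n]) blast
    have S2: "miwa_mean t n - miwa_moment t 2 0 / real N \<le> S"
      using S(2) n N(1) by simp
    have "(\<Sum>l\<in>F. (schur l t)\<^sup>2 * (1 + z) ^ particle_count l n)
        = (\<Sum>l\<in>F. (dt N (\<lambda>i j. h (row_index l i + int j)))\<^sup>2 * (\<Prod>i<N. step_weight n z (row_index l i)))"
      using F(2) N n by (intro sum.cong refl) (auto simp: schur_dt prod_step_weight)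
    also have "\<dots> \<le> dt N (miwa_gram t (step_weight n z))"
      unfolding miwa_gram_def[abs_def]
    proof (rule cauchy_binet_infsum_le[where \<phi> = "\<lambda>a j. h (a + int j)"])
      show "(\<lambda>a. step_weight n z a * h (a + int i) * h (a + int j)) summable_on UNIV" for i j
        by (rule summable_whh[of _ "1 + \<bar>z\<bar>"]) (auto simp: step_weight_def)
      show "0 \<le> step_weight n z a" for a
        using z by (simp add: step_weight_def)
      show "l = l' \<and> p = q"
        if "l \<in> F" "l' \<in> F" "p permutes {0..<N}" "q permutes {0..<N}"
          "\<forall>i<N. row_index l (p i) = row_index l' (q i)" for l l' p q
        using that F(2) N(3) by (intro row_index_permute_inj[of l l' N]) auto
    qed (rule F(1))
    also have "\<dots> \<le> exp Z * exp (z * S)"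
      by (rule order.trans[OF S1], rule mult_right_mono[OF gram_det_le_exp]) simp
    also have "\<dots> \<le> exp (Z + z * miwa_mean t n + \<bar>z\<bar> * miwa_moment t 2 0 * (1 / real N))"
    proof -
      have "z * S \<le> z * miwa_mean t n + \<bar>z\<bar> * miwa_moment t 2 0 * (1 / real N)"
      proof (cases "0 \<le> z")
        case True
        moreover have "0 \<le> miwa_moment t 2 0"
          by (rule has_sum_nonneg[OF moment_has_sum]) auto
        ultimately show ?thesis
          using mult_left_mono[OF S(1) True] by (simp add: add_increasing2)
      next
        case False
        then show ?thesis
          using mult_left_mono_neg[OF S2, of z] by (simp add: algebra_simps)
      qed
      then show ?thesis by (simp add: exp_add[symmetric])
    qed
    finally show ?case .
  qed
qed simp

section \<open>Asymptotics of the mean\<close>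

text \<open>A Weierstrass approximation on \<open>[-R, R]\<close> is corrected by a multiple of an
  even power \<open>y ^ (2 * q)\<close>. This power dominates the error for
  \<open>\<bar>y\<bar> > R\<close>, and since \<open>R \<ge> 2 * B\<close> it contributes at most
  \<open>\<epsilon> / 4\<close> on \<open>[-B, B]\<close> once \<open>q\<close> is large.\<close>

lemma polynomial_sandwich:
  fixes x :: real
  assumes B: "0 < B" and \<epsilon>: "0 < \<epsilon>"
  shows "\<exists>P Q. real_polynomial_function P \<and> real_polynomial_function Q \<and>
    (\<forall>y. P y \<le> max 0 (y - x) \<and> max 0 (y - x) \<le> Q y \<and> (\<bar>y\<bar> \<le> B \<longrightarrow> Q y - P y \<le> \<epsilon>))"
proof -
  define R where "R = 2 * B + 1"
  have R: "1 \<le> R" "2 * B \<le> R" using B by (auto simp: R_def)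
  have "continuous_on {-R..R} (\<lambda>y. max 0 (y - x))"
    by (intro continuous_intros)
  then obtain p where p: "real_polynomial_function p" "\<And>y. y \<in> {-R..R} \<Longrightarrow> \<bar>max 0 (y - x) - p y\<bar> < \<epsilon> / 4"
    using Stone_Weierstrass_real_polynomial_function[of "{-R..R}" "\<lambda>y. max 0 (y - x)" "\<epsilon> / 4"] \<epsilon> by auto
  then obtain c d where c: "p = (\<lambda>y. \<Sum>i\<le>d. c i * y ^ i)"
    using real_polynomial_function_iff_sum by blast
  define K where "K = (\<Sum>i\<le>d. \<bar>c i\<bar>) + \<bar>x\<bar> + 1"
  have K: "0 < K" unfolding K_def by (intro add_nonneg_pos add_nonneg_nonneg sum_nonneg) auto
  have far: "\<bar>max 0 (y - x) - p y\<bar> \<le> K * \<bar>y\<bar> ^ Suc d" if "R < \<bar>y\<bar>" for y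
  proof -
    have y: "1 \<le> \<bar>y\<bar>" using that R by simp
    then have le: "\<bar>y\<bar> ^ i \<le> \<bar>y\<bar> ^ Suc d" if "i \<le> Suc d" for i
      using that by (intro power_increasing) auto
    have "\<bar>p y\<bar> \<le> (\<Sum>i\<le>d. \<bar>c i\<bar> * \<bar>y\<bar> ^ i)"
      unfolding c by (rule order.trans[OF sum_abs]) (simp add: abs_mult power_abs)
    also have "\<dots> \<le> (\<Sum>i\<le>d. \<bar>c i\<bar> * \<bar>y\<bar> ^ Suc d)"
      using le by (intro sum_mono mult_left_mono) auto
    finally have "\<bar>p y\<bar> \<le> (\<Sum>i\<le>d. \<bar>c i\<bar>) * \<bar>y\<bar> ^ Suc d"
      by (simp add: sum_distrib_right)
    moreover have "\<bar>max 0 (y - x)\<bar> \<le> \<bar>y\<bar> ^ 1 + \<bar>x\<bar> * \<bar>y\<bar> ^ 0"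
      by (auto simp: max_def)
    moreover have "\<bar>y\<bar> ^ 1 + \<bar>x\<bar> * \<bar>y\<bar> ^ 0 \<le> \<bar>y\<bar> ^ Suc d + \<bar>x\<bar> * \<bar>y\<bar> ^ Suc d"
      by (intro add_mono mult_left_mono le) auto
    ultimately show ?thesis
      unfolding K_def distrib_right by linarith
  qed
  obtain q where q: "Suc d \<le> 2 * q" "K * R ^ Suc d * (1 / 2) ^ (2 * q) \<le> \<epsilon> / 4"
  proof -
    have "(\<lambda>q. K * R ^ Suc d * (1 / 4) ^ q) \<longlonglongrightarrow> K * R ^ Suc d * 0"
      by (intro tendsto_intros LIMSEQ_realpow_zero) auto
    then have "\<forall>\<^sub>F q in sequentially. K * R ^ Suc d * (1 / 4) ^ q < \<epsilon> / 4"
      using \<epsilon> by (intro order_tendstoD(2)) auto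
    then have "\<forall>\<^sub>F q in sequentially. K * R ^ Suc d * (1 / 4) ^ q < \<epsilon> / 4 \<and> Suc d \<le> q"
      using eventually_ge_at_top[of "Suc d"] by eventually_elim auto
    then obtain q where "K * R ^ Suc d * (1 / 4) ^ q < \<epsilon> / 4" "Suc d \<le> q"
      by (auto simp only: eventually_sequentially)
    moreover have "(1 / 2 :: real) ^ (2 * q) = (1 / 4) ^ q"
      by (simp add: power_mult power2_eq_square)
    ultimately show ?thesis using that[of q] by simp
  qed
  \<comment> \<open>Normalized so that
    \<open>C * y ^ (2 * q) = K * R ^ Suc d * (y / R) ^ (2 * q)\<close>.\<close>
  define C where "C = K * R ^ Suc d / R ^ (2 * q)"
  define E where "E y = \<epsilon> / 4 + C * y ^ (2 * q)" for y :: real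
  have C0: "0 \<le> C" using K R by (simp add: C_def)
  have even: "y ^ (2 * q) = \<bar>y\<bar> ^ (2 * q)" for y :: real
    by (simp add: power_mult)
  have approx: "\<bar>max 0 (y - x) - p y\<bar> \<le> E y" for y
  proof (cases "\<bar>y\<bar> \<le> R")
    case True
    then have "\<bar>max 0 (y - x) - p y\<bar> < \<epsilon> / 4" by (intro p(2)) auto
    moreover have "0 \<le> C * y ^ (2 * q)" using C0 by (simp add: power_mult)
    ultimately show ?thesis by (simp add: E_def)
  next
    case False
    have "\<bar>y\<bar> ^ Suc d = R ^ Suc d * (\<bar>y\<bar> / R) ^ Suc d"
      using R by (simp add: power_divide)
    also have "\<dots> \<le> R ^ Suc d * (\<bar>y\<bar> / R) ^ (2 * q)"
      using False R q(1) by (intro mult_left_mono power_increasing) auto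
    finally have "K * \<bar>y\<bar> ^ Suc d \<le> K * (R ^ Suc d * (\<bar>y\<bar> / R) ^ (2 * q))"
      using K by (intro mult_left_mono) auto
    also have "\<dots> = C * y ^ (2 * q)"
      unfolding even[of y] by (simp add: C_def power_divide)
    finally show ?thesis using far[of y] False \<epsilon> by (simp add: E_def)
  qed
  show ?thesis
  proof (intro exI conjI allI impI)
    have "real_polynomial_function E"
      unfolding E_def[abs_def]
      by (intro real_polynomial_function.intros(2-4) real_polynomial_function_power
          real_polynomial_function.intros(1)[OF bounded_linear_ident])
    then show "real_polynomial_function (\<lambda>y. p y - E y)" "real_polynomial_function (\<lambda>y. p y + E y)"
      using p(1) by (auto intro: real_polynomial_function_diff real_polynomial_function.intros(3))
    fix y :: real
    show "p y - E y \<le> max 0 (y - x)" "max 0 (y - x) \<le> p y + E y"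
      using approx[of y] by linarith+
    assume y: "\<bar>y\<bar> \<le> B"
    have "C * \<bar>y\<bar> ^ (2 * q) = K * R ^ Suc d * (\<bar>y\<bar> / R) ^ (2 * q)"
      by (simp add: C_def power_divide)
    also have "\<dots> \<le> K * R ^ Suc d * (1 / 2) ^ (2 * q)"
      using y R K by (intro mult_left_mono power_mono) (auto simp: field_simps)
    finally have "E y \<le> \<epsilon> / 2"
      using q(2) unfolding E_def even[of y] by simp
    then show "p y + E y - (p y - E y) \<le> \<epsilon>" by simp
  qed
qed

lemma integral_cos_int:
  "integral {0..pi} (\<lambda>\<phi>. cos (of_int s * \<phi>)) = (if s = 0 then pi else 0)"
proof (cases "s = 0")
  case False
  have "((\<lambda>\<phi>. cos (of_int s * \<phi>)) has_integral (sin (of_int s * pi) / of_int s - sin (of_int s * 0) / of_int s)) {0..pi}"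
    using False
    by (intro fundamental_theorem_of_calculus)
      (auto intro!: derivative_eq_intros simp: has_real_derivative_iff_has_vector_derivative[symmetric])
  then show ?thesis using False by (simp add: integral_unique sin_times_pi_eq_0)
qed simp

context miwa
begin

text \<open>The logarithmic derivative of \<open>J\<close> at \<open>z = exp (i * \<phi>)\<close>,
  which is the function \<open>D\<close> of the overview.\<close>

definition symbol :: "real \<Rightarrow> real" where
  "symbol \<phi> = 2 * (\<Sum>r=1..R. real r * t r * cos (real r * \<phi>))"

lemma continuous_on_symbol [continuous_intros]: "continuous_on A symbol"
  unfolding symbol_def by (intro continuous_intros)

lemma symbol_bounded: obtains B where "0 < B" "\<And>\<phi>. \<bar>symbol \<phi>\<bar> \<le> B"
proof
  show "0 < 1 + 2 * (\<Sum>r=1..R. \<bar>real r * t r\<bar>)"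
    by (intro add_pos_nonneg mult_nonneg_nonneg sum_nonneg) auto
  show "\<bar>symbol \<phi>\<bar> \<le> 1 + 2 * (\<Sum>r=1..R. \<bar>real r * t r\<bar>)" for \<phi>
  proof -
    have "\<bar>\<Sum>r=1..R. real r * t r * cos (real r * \<phi>)\<bar> \<le> (\<Sum>r=1..R. \<bar>real r * t r\<bar>)"
      by (rule order.trans[OF sum_abs]) (auto intro!: sum_mono mult_left_le simp: abs_mult)
    then show ?thesis by (simp add: symbol_def)
  qed
qed

text \<open>After division of \<open>moment_Suc\<close> by \<open>\<theta> ^ Suc p\<close> the term
  with the factor \<open>s\<close> is of order \<open>1 / \<theta>\<close>. The remaining sum
  becomes multiplication by \<open>symbol\<close>, since \<open>cos ((s + r) * \<phi>) + cos ((s -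
  r) * \<phi>) = 2 * cos (s * \<phi>) * cos (r * \<phi>)\<close>.\<close>

lemma moment_asymptotics:
  "((\<lambda>\<theta>. miwa_moment (\<lambda>r. \<theta> * t r) p s / \<theta> ^ p)
    \<longlongrightarrow> 1 / pi * integral {0..pi} (\<lambda>\<phi>. symbol \<phi> ^ p * cos (of_int s * \<phi>))) at_top"
proof (induction p arbitrary: s)
  case 0
  have "miwa (\<lambda>r. \<theta> * t r) R" for \<theta> by unfold_locales (simp add: finite_support)
  from miwa.moment_0[OF this] show ?case
    by (simp add: integral_cos_int)
next
  case (Suc p)
  let ?L = "\<lambda>p s. 1 / pi * integral {0..pi} (\<lambda>\<phi>. symbol \<phi> ^ p * cos (of_int s * \<phi>))"
  define M where "M \<theta> p s = miwa_moment (\<lambda>r. \<theta> * t r) p s / \<theta> ^ p" for \<theta> p s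
  define M' where "M' \<theta> = of_int s * (1 / \<theta>) * M \<theta> p s
      + (\<Sum>r=1..int R. of_int r * t (nat r) * (M \<theta> p (s + r) + M \<theta> p (s - r)))" for \<theta>
  have "miwa (\<lambda>r. \<theta> * t r) R" for \<theta> by unfold_locales (simp add: finite_support)
  note Suc_moment = miwa.moment_Suc[OF this]
  have rec: "M \<theta> (Suc p) s = M' \<theta>" if "\<theta> > 0" for \<theta>
    unfolding M_def M'_def Suc_moment add_divide_distrib[of "of_int s * _"] sum_divide_distrib
  proof (intro arg_cong2[where f = "(+)"] sum.cong refl)
    fix r
    have "a * (\<theta> * b) * (c + d) / \<theta> ^ Suc p = a * b * (c / \<theta> ^ p + d / \<theta> ^ p)" for a b c d :: real
      using that by (simp add: add_divide_distrib[symmetric])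
    then show "of_int r * (\<theta> * t (nat r)) * (miwa_moment (\<lambda>r. \<theta> * t r) p (s + r)
        + miwa_moment (\<lambda>r. \<theta> * t r) p (s - r)) / \<theta> ^ Suc p
      = of_int r * t (nat r) * (miwa_moment (\<lambda>r. \<theta> * t r) p (s + r) / \<theta> ^ p
        + miwa_moment (\<lambda>r. \<theta> * t r) p (s - r) / \<theta> ^ p)" .
  qed (use that in simp)
  have "(M' \<longlongrightarrow> of_int s * 0 * ?L p s
      + (\<Sum>r=1..int R. of_int r * t (nat r) * (?L p (s + r) + ?L p (s - r)))) at_top"
    unfolding M'_def M_def
    by (intro tendsto_intros Suc.IH tendsto_divide_0[OF tendsto_const] filterlim_at_top_imp_at_infinity filterlim_ident)
  moreover have "of_int s * 0 * ?L p s + (\<Sum>r=1..int R. of_int r * t (nat r) * (?L p (s + r) + ?L p (s - r))) = ?L (Suc p) s"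
  proof -
    have hi: "((\<lambda>\<phi>. symbol \<phi> ^ p * cos (of_int s * \<phi>)) has_integral (pi * ?L p s)) {0..pi}" for s
    proof -
      have "(\<lambda>\<phi>. symbol \<phi> ^ p * cos (of_int s * \<phi>)) integrable_on {0..pi}"
        by (intro integrable_continuous_interval continuous_intros)
      then show ?thesis by (simp add: has_integral_integral)
    qed
    have "((\<lambda>\<phi>. \<Sum>r=1..int R. of_int r * t (nat r) * (symbol \<phi> ^ p * cos (of_int (s + r) * \<phi>)
          + symbol \<phi> ^ p * cos (of_int (s - r) * \<phi>)))
        has_integral (\<Sum>r=1..int R. of_int r * t (nat r) * (pi * ?L p (s + r) + pi * ?L p (s - r)))) {0..pi}"
      by (intro has_integral_sum has_integral_mult_right has_integral_add hi) auto
    moreover have "(\<Sum>r=1..int R. of_int r * t (nat r) * (symbol \<phi> ^ p * cos (of_int (s + r) * \<phi>)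
          + symbol \<phi> ^ p * cos (of_int (s - r) * \<phi>))) = symbol \<phi> ^ Suc p * cos (of_int s * \<phi>)" for \<phi>
    proof -
      have sy: "symbol \<phi> = 2 * (\<Sum>r=1..int R. of_int r * t (nat r) * cos (of_int r * \<phi>))"
        unfolding symbol_def by (intro arg_cong[of _ _ "(*) 2"] sum.reindex_bij_witness[of _ nat int]) auto
      have cc: "cos (of_int (s + r) * \<phi>) + cos (of_int (s - r) * \<phi>) = 2 * cos (of_int s * \<phi>) * cos (of_int r * \<phi>)" for r
        by (simp add: distrib_right left_diff_distrib cos_add cos_diff)
      have "(\<Sum>r=1..int R. of_int r * t (nat r) * (symbol \<phi> ^ p * cos (of_int (s + r) * \<phi>)
          + symbol \<phi> ^ p * cos (of_int (s - r) * \<phi>)))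
        = (\<Sum>r=1..int R. symbol \<phi> ^ p * cos (of_int s * \<phi>) * (2 * (of_int r * t (nat r) * cos (of_int r * \<phi>))))"
        unfolding distrib_left[of "symbol \<phi> ^ p", symmetric] cc by (simp only: mult_ac)
      also have "\<dots> = symbol \<phi> ^ p * cos (of_int s * \<phi>) * symbol \<phi>"
        by (subst (2) sy) (simp only: sum_distrib_left)
      finally show ?thesis by (simp add: mult_ac)
    qed
    ultimately have "integral {0..pi} (\<lambda>\<phi>. symbol \<phi> ^ Suc p * cos (of_int s * \<phi>))
      = (\<Sum>r=1..int R. of_int r * t (nat r) * (pi * ?L p (s + r) + pi * ?L p (s - r)))"
      by (simp only: integral_unique)
    also have "\<dots> = pi * (\<Sum>r=1..int R. of_int r * t (nat r) * (?L p (s + r) + ?L p (s - r)))"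
      unfolding sum_distrib_left by (intro sum.cong refl) (simp only: distrib_left mult_ac)
    finally show ?thesis by simp
  qed
  ultimately have "(M' \<longlongrightarrow> ?L (Suc p) s) at_top"
    by (simp only:)
  moreover have "\<forall>\<^sub>F \<theta> in at_top. M \<theta> (Suc p) s = M' \<theta>"
    using eventually_gt_at_top[of 0] by eventually_elim (rule rec)
  ultimately show ?case
    unfolding M_def by (subst tendsto_cong)
qed

definition limit_mean :: "real \<Rightarrow> real" where
  "limit_mean x = 1 / pi * integral {0..pi} (\<lambda>\<phi>. max 0 (symbol \<phi> - x))"

text \<open>Moments give the limit for polynomials, and \<open>polynomial_sandwich\<close> transfers
  it to \<open>max 0 (y - x)\<close>. Rounding \<open>\<theta> * x\<close> moves the threshold by at
  most \<open>1 / \<theta>\<close>, which costs at most \<open>1 / \<theta>\<close> as the weights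
  have total mass 1.\<close>

lemma mean_asymptotics:
  "((\<lambda>\<theta>. miwa_mean (\<lambda>r. \<theta> * t r) \<lfloor>\<theta> * x\<rfloor> / \<theta>) \<longlongrightarrow> limit_mean x) at_top"
proof -
  have m: "miwa (\<lambda>r. \<theta> * t r) R" for \<theta> by unfold_locales (simp add: finite_support)
  define J where "J \<theta> k = (miwa_J (\<lambda>r. \<theta> * t r) k)\<^sup>2" for \<theta> k
  define M where "M \<theta> = miwa_mean (\<lambda>r. \<theta> * t r) \<lfloor>\<theta> * x\<rfloor> / \<theta>" for \<theta>
  define y where "y \<theta> = of_int \<lfloor>\<theta> * x\<rfloor> / \<theta>" for \<theta>
  have mom: "((\<lambda>k. (of_int k / \<theta>) ^ p * J \<theta> k) has_sum (miwa_moment (\<lambda>r. \<theta> * t r) p 0 / \<theta> ^ p)) UNIV" for \<theta> p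
    using has_sum_cmult_right[OF miwa.moment_has_sum[OF m[of \<theta>], where p = p], of "1 / \<theta> ^ p"]
    by (simp add: J_def power_divide)
  have mean: "((\<lambda>k. max 0 (of_int k / \<theta> - y \<theta>) * J \<theta> k) has_sum M \<theta>) UNIV" if "0 < \<theta>" for \<theta>
  proof -
    have "max 0 (of_int k / \<theta> - y \<theta>) = 1 / \<theta> * of_int (max 0 (k - \<lfloor>\<theta> * x\<rfloor>))" for k
      using that by (auto simp: y_def max_def field_simps)
    then show ?thesis
      using has_sum_cmult_right[OF miwa.mean_has_sum[OF m[of \<theta>], where n = "\<lfloor>\<theta> * x\<rfloor>"], of "1 / \<theta>"]
      by (simp add: J_def M_def mult.assoc)
  qed
  have floor: "x - 1 / \<theta> \<le> y \<theta> \<and> y \<theta> \<le> x" if "0 < \<theta>" for \<theta>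
  proof -
    have "\<theta> * x - 1 \<le> of_int \<lfloor>\<theta> * x\<rfloor>" "of_int \<lfloor>\<theta> * x\<rfloor> \<le> \<theta> * x" by linarith+
    then have "(\<theta> * x - 1) / \<theta> \<le> y \<theta>" "y \<theta> \<le> \<theta> * x / \<theta>"
      unfolding y_def using that by (intro divide_right_mono; simp)+
    then show ?thesis using that by (simp add: diff_divide_distrib)
  qed
  define I where "I P = 1 / pi * integral {0..pi} (\<lambda>\<phi>. P (symbol \<phi>))" for P :: "real \<Rightarrow> real"
  define S where "S P \<theta> = (\<Sum>\<^sub>\<infinity>k. P (of_int k / \<theta>) * J \<theta> k)" for P :: "real \<Rightarrow> real" and \<theta>
  have poly: "(\<forall>\<theta>. ((\<lambda>k. P (of_int k / \<theta>) * J \<theta> k) has_sum S P \<theta>) UNIV) \<and> (S P \<longlongrightarrow> I P) at_top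
      \<and> (\<lambda>\<phi>. P (symbol \<phi>)) integrable_on {0..pi}" if rpf: "real_polynomial_function P" for P
  proof -
    obtain c n where P: "P = (\<lambda>y. \<Sum>i\<le>n. c i * y ^ i)"
      using rpf real_polynomial_function_iff_sum by blast
    have sum: "((\<lambda>k. P (of_int k / \<theta>) * J \<theta> k) has_sum
        (\<Sum>i\<le>n. c i * (miwa_moment (\<lambda>r. \<theta> * t r) i 0 / \<theta> ^ i))) UNIV" for \<theta>
      unfolding P sum_distrib_right mult.assoc by (intro has_sum_finite_sum has_sum_cmult_right mom)
    have S: "S P = (\<lambda>\<theta>. \<Sum>i\<le>n. c i * (miwa_moment (\<lambda>r. \<theta> * t r) i 0 / \<theta> ^ i))"
      by (rule ext) (simp only: S_def infsumI[OF sum])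
    have lim: "((\<lambda>\<theta>. \<Sum>i\<le>n. c i * (miwa_moment (\<lambda>r. \<theta> * t r) i 0 / \<theta> ^ i)) \<longlongrightarrow>
      (\<Sum>i\<le>n. c i * (1 / pi * integral {0..pi} (\<lambda>\<phi>. symbol \<phi> ^ i * cos (of_int 0 * \<phi>))))) at_top"
      by (intro tendsto_intros moment_asymptotics)
    have int: "((\<lambda>\<phi>. P (symbol \<phi>)) has_integral (\<Sum>i\<le>n. c i * integral {0..pi} (\<lambda>\<phi>. symbol \<phi> ^ i))) {0..pi}"
      unfolding P by (intro has_integral_sum has_integral_mult_right integrable_integral
          integrable_continuous_interval continuous_intros) auto
    then have I: "I P = (\<Sum>i\<le>n. c i * (1 / pi * integral {0..pi} (\<lambda>\<phi>. symbol \<phi> ^ i * cos (of_int 0 * \<phi>))))"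
      unfolding I_def by (simp add: integral_unique sum_distrib_left mult_ac)
    show ?thesis
      unfolding S I using sum lim has_integral_integrable[OF int] by simp
  qed
  obtain B where B: "0 < B" "\<And>\<phi>. \<bar>symbol \<phi>\<bar> \<le> B" using symbol_bounded by blast
  have gint: "(\<lambda>\<phi>. max 0 (symbol \<phi> - x)) integrable_on {0..pi}"
    by (intro integrable_continuous_interval continuous_intros)
  show ?thesis
    unfolding M_def[symmetric]
  proof (rule tendstoI)
    fix \<epsilon> :: real assume \<epsilon>: "0 < \<epsilon>"
    then have e4: "0 < \<epsilon> / 4" by simp
    obtain P Q where PQ: "real_polynomial_function P" "real_polynomial_function Q"
        "\<And>y. P y \<le> max 0 (y - x)" "\<And>y. max 0 (y - x) \<le> Q y" "\<And>y. \<bar>y\<bar> \<le> B \<Longrightarrow> Q y - P y \<le> \<epsilon> / 4"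
      using polynomial_sandwich[OF B(1) e4, of x] by blast
    note P = poly[OF PQ(1)] and Q = poly[OF PQ(2)]
    have int: "(\<lambda>\<phi>. P (symbol \<phi>)) integrable_on {0..pi}" "(\<lambda>\<phi>. Q (symbol \<phi>)) integrable_on {0..pi}"
      using P Q by blast+
    have IP: "I P \<le> limit_mean x"
      unfolding limit_mean_def I_def by (intro mult_left_mono integral_le int gint PQ(3)) simp
    have IQ: "limit_mean x \<le> I Q"
      unfolding limit_mean_def I_def by (intro mult_left_mono integral_le int gint PQ(4)) simp
    have "integral {0..pi} (\<lambda>\<phi>. Q (symbol \<phi>) - P (symbol \<phi>)) \<le> integral {0..pi} (\<lambda>_. \<epsilon> / 4)"
      by (intro integral_le integrable_diff integrable_const_ivl int PQ(5) B(2))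
    then have IPQ: "I Q - I P \<le> \<epsilon> / 4"
      unfolding I_def by (simp add: integral_diff int field_simps)
    have "\<forall>\<^sub>F \<theta> in at_top. I P - \<epsilon> / 4 < S P \<theta>" "\<forall>\<^sub>F \<theta> in at_top. S Q \<theta> < I Q + \<epsilon> / 4"
      using order_tendstoD(1)[of "S P" "I P" at_top "I P - \<epsilon> / 4"] order_tendstoD(2)[of "S Q" "I Q" at_top "I Q + \<epsilon> / 4"]
        P Q \<epsilon> by auto
    moreover have "\<forall>\<^sub>F \<theta> in at_top. 1 / \<theta> < \<epsilon> / 4"
      using \<epsilon> by (intro order_tendstoD(2)[OF tendsto_divide_0[OF tendsto_const]] filterlim_at_top_imp_at_infinity
          filterlim_ident) auto
    ultimately show "\<forall>\<^sub>F \<theta> in at_top. dist (M \<theta>) (limit_mean x) < \<epsilon>"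
      using eventually_gt_at_top[of 0]
    proof eventually_elim
      case (elim \<theta>)
      note fl = floor[OF elim(4)]
      have "S P \<theta> \<le> M \<theta>"
      proof (rule has_sum_mono[OF _ mean[OF elim(4)]])
        show "((\<lambda>k. P (of_int k / \<theta>) * J \<theta> k) has_sum S P \<theta>) UNIV" using P by blast
        show "P (of_int k / \<theta>) * J \<theta> k \<le> max 0 (of_int k / \<theta> - y \<theta>) * J \<theta> k" for k
          using PQ(3)[of "of_int k / \<theta>"] fl by (intro mult_right_mono) (auto simp: J_def)
      qed
      moreover have "M \<theta> \<le> S Q \<theta> + 1 / \<theta> * (miwa_moment (\<lambda>r. \<theta> * t r) 0 0 / \<theta> ^ 0)"
      proof (rule has_sum_mono[OF mean[OF elim(4)] has_sum_add[OF _ has_sum_cmult_right[OF mom]]])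
        show "((\<lambda>k. Q (of_int k / \<theta>) * J \<theta> k) has_sum S Q \<theta>) UNIV" using Q by blast
        show "max 0 (of_int k / \<theta> - y \<theta>) * J \<theta> k \<le> Q (of_int k / \<theta>) * J \<theta> k + 1 / \<theta> * ((of_int k / \<theta>) ^ 0 * J \<theta> k)" for k
        proof -
          have "max 0 (of_int k / \<theta> - y \<theta>) \<le> Q (of_int k / \<theta>) + 1 / \<theta>"
            using PQ(4)[of "of_int k / \<theta>"] fl elim(4) by (auto simp: max_def split: if_splits)
          from mult_right_mono[OF this, of "J \<theta> k"] show ?thesis
            by (simp add: J_def distrib_right)
        qed
      qed
      ultimately show ?case
        using elim IP IQ IPQ by (simp add: dist_real_def miwa.moment_0[OF m] abs_less_iff)
    qed
  qed
qed

end

section \<open>The multicritical symbol\<close>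

context miwa
begin

lemma limit_mean_integrable: "(\<lambda>\<phi>. max 0 (symbol \<phi> - x)) integrable_on {0..pi}"
  by (intro integrable_continuous_interval continuous_intros)

lemma limit_mean_antimono: "x \<le> y \<Longrightarrow> limit_mean y \<le> limit_mean x"
  unfolding limit_mean_def by (intro mult_left_mono integral_le limit_mean_integrable) auto

lemma limit_mean_lipschitz: "x \<le> y \<Longrightarrow> limit_mean x \<le> limit_mean y + (y - x)"
proof -
  assume "x \<le> y"
  have "integral {0..pi} (\<lambda>\<phi>. max 0 (symbol \<phi> - x)) \<le> integral {0..pi} (\<lambda>\<phi>. max 0 (symbol \<phi> - y) + (y - x))"
    using \<open>x \<le> y\<close> by (intro integral_le integrable_add limit_mean_integrable integrable_const_ivl) auto
  also have "\<dots> = integral {0..pi} (\<lambda>\<phi>. max 0 (symbol \<phi> - y)) + pi * (y - x)"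
    by (subst integral_add) (auto intro: limit_mean_integrable)
  finally show ?thesis
    unfolding limit_mean_def by (simp add: field_simps)
qed

lemma limit_mean_right:
  assumes "\<And>\<phi>. \<phi> \<in> {0..pi} \<Longrightarrow> symbol \<phi> \<le> x"
  shows "limit_mean x = 0"
proof -
  have "integral {0..pi} (\<lambda>\<phi>. max 0 (symbol \<phi> - x)) = integral {0..pi} (\<lambda>_. 0)"
    using assms by (intro integral_cong) auto
  then show ?thesis by (simp add: limit_mean_def)
qed

text \<open>The symbol is a cosine polynomial without constant term, so its integral over
  \<open>[0, \<pi>]\<close> vanishes.\<close>

lemma limit_mean_left:
  assumes "\<And>\<phi>. \<phi> \<in> {0..pi} \<Longrightarrow> x \<le> symbol \<phi>"
  shows "limit_mean x = - x"
proof -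
  have "integral {0..pi} (\<lambda>\<phi>. max 0 (symbol \<phi> - x)) = integral {0..pi} (\<lambda>\<phi>. symbol \<phi> - x)"
    using assms by (intro integral_cong) auto
  also have "\<dots> = integral {0..pi} symbol - pi * x"
    by (subst integral_diff) (auto intro: integrable_continuous_interval continuous_intros)
  also have "integral {0..pi} symbol = 0"
  proof -
    have "(symbol has_integral (2 * (\<Sum>r=1..R. real r * t r * integral {0..pi} (\<lambda>\<phi>. cos (of_int (int r) * \<phi>))))) {0..pi}"
      unfolding symbol_def[abs_def]
      by (intro has_integral_mult_right has_integral_sum) (auto intro!: integrable_integral integrable_continuous_interval continuous_intros)
    then show ?thesis
      unfolding integral_cos_int by (simp add: integral_unique)
  qed
  finally show ?thesis by (simp add: limit_mean_def)
qed

text \<open>Differentiating \<open>\<integral> max 0 (symbol - x)\<close> in \<open>x\<close> gives minus the length of \<open>{symbol > x}\<close>.\<close>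

lemma integral_angle:
  assumes dec: "\<And>\<phi> \<phi>'. 0 \<le> \<phi> \<Longrightarrow> \<phi> < \<phi>' \<Longrightarrow> \<phi>' \<le> pi \<Longrightarrow> symbol \<phi>' < symbol \<phi>"
    and chi: "\<And>x. x \<in> {symbol pi..symbol 0} \<Longrightarrow> chi x \<in> {0..pi} \<and> symbol (chi x) = x"
    and x: "x \<in> {symbol pi..symbol 0}"
  shows "integral {symbol pi..x} chi = pi * (limit_mean (symbol pi) - limit_mean x)"
proof -
  let ?S = "{symbol pi..symbol 0}"
  have img: "symbol \<phi> \<in> ?S" if "\<phi> \<in> {0..pi}" for \<phi>
    using that dec[of 0 \<phi>] dec[of \<phi> pi] by (cases "\<phi> = 0"; cases "\<phi> = pi") (auto simp: less_imp_le)
  have inv: "chi (symbol \<phi>) = \<phi>" if "\<phi> \<in> {0..pi}" for \<phi>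
    using that chi[OF img[OF that]] dec[of \<phi> "chi (symbol \<phi>)"] dec[of "chi (symbol \<phi>)" \<phi>]
    by (cases "chi (symbol \<phi>)" \<phi> rule: linorder_cases) auto
  have "symbol ` {0..pi} = ?S"
    using img chi by (auto simp: image_iff) (metis atLeastAtMost_iff)
  then have cont: "continuous_on ?S chi"
    using continuous_on_inv[of "{0..pi}" symbol chi] inv by (auto intro: continuous_intros)
  have gt: "y \<le> symbol \<phi>" if "y \<in> ?S" "\<phi> \<in> {0..pi}" "\<phi> \<le> chi y" for y \<phi>
    using that chi[OF that(1)] dec[of \<phi> "chi y"] by (cases "\<phi> = chi y") auto
  have lt: "symbol \<phi> \<le> y" if "y \<in> ?S" "\<phi> \<in> {0..pi}" "chi y \<le> \<phi>" for y \<phi>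
    using that chi[OF that(1)] dec[of "chi y" \<phi>] by (cases "\<phi> = chi y") auto
  define G where "G y = pi * limit_mean y" for y
  have G: "G y = integral {0..pi} (\<lambda>\<phi>. max 0 (symbol \<phi> - y))" for y
    by (simp add: G_def limit_mean_def)
  \<comment> \<open>For \<open>y \<le> z\<close> the difference of the integrands is
    \<open>z - y\<close> on \<open>[0, chi z]\<close>, 0 beyond \<open>chi y\<close>, and in
    \<open>[0, z - y]\<close> between. This squeezes the difference quotient of \<open>G\<close>,
    and continuity of \<open>chi\<close> yields the derivative.\<close>
  have bounds: "chi z * (z - y) \<le> G y - G z \<and> G y - G z \<le> chi y * (z - y)"
    if yz: "y \<in> ?S" "z \<in> ?S" "y \<le> z" for y z
  proof -
    have ind: "((\<lambda>\<phi>. if \<phi> \<in> {0..c} then z - y else 0) has_integral c * (z - y)) {0..pi}"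
      if "c \<in> {0..pi}" for c
      using that has_integral_const_real[of "z - y" 0 c]
      by (subst has_integral_restrict) auto
    have diff: "((\<lambda>\<phi>. max 0 (symbol \<phi> - y) - max 0 (symbol \<phi> - z)) has_integral (G y - G z)) {0..pi}"
      unfolding G by (intro has_integral_diff integrable_integral limit_mean_integrable)
    have "chi z * (z - y) \<le> G y - G z"
    proof (rule has_integral_le[OF ind diff])
      show "chi z \<in> {0..pi}" using chi yz by auto
      show "(if \<phi> \<in> {0..chi z} then z - y else 0) \<le> max 0 (symbol \<phi> - y) - max 0 (symbol \<phi> - z)"
        if "\<phi> \<in> {0..pi}" for \<phi>
        using gt[OF yz(2) that] yz(3) by auto
    qed
    moreover have "G y - G z \<le> chi y * (z - y)"
    proof (rule has_integral_le[OF diff ind])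
      show "chi y \<in> {0..pi}" using chi yz by auto
      show "max 0 (symbol \<phi> - y) - max 0 (symbol \<phi> - z) \<le> (if \<phi> \<in> {0..chi y} then z - y else 0)"
        if "\<phi> \<in> {0..pi}" for \<phi>
        using lt[OF yz(1) that] that yz(3) by auto
    qed
    ultimately show ?thesis ..
  qed
  have deriv: "((\<lambda>y. - G y) has_real_derivative chi y) (at y within ?S)" if y: "y \<in> ?S" for y
    unfolding has_field_derivative_iff
  proof (rule tendstoI)
    fix e :: real assume "0 < e"
    have "(chi \<longlongrightarrow> chi y) (at y within ?S)"
      using cont y by (simp add: continuous_on_def)
    from tendstoD[OF this \<open>0 < e\<close>]
    have "\<forall>\<^sub>F z in at y within ?S. dist (chi z) (chi y) < e" .
    moreover have "\<forall>\<^sub>F z in at y within ?S. z \<in> ?S \<and> z \<noteq> y"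
      by (simp add: eventually_at_filter)
    ultimately show "\<forall>\<^sub>F z in at y within ?S. dist ((- G z - - G y) / (z - y)) (chi y) < e"
    proof eventually_elim
      case (elim z)
      then consider "y < z" | "z < y" by linarith
      then show ?case
      proof cases
        case 1
        then have "chi z \<le> (G y - G z) / (z - y)" "(G y - G z) / (z - y) \<le> chi y"
          using bounds[of y z] elim y by (auto simp: field_simps)
        then show ?thesis using elim by (auto simp: dist_real_def)
      next
        case 2
        have "(- G z - - G y) / (z - y) = (G z - G y) / (y - z)"
          using 2 by (simp add: field_simps)
        moreover have "chi y \<le> (G z - G y) / (y - z)" "(G z - G y) / (y - z) \<le> chi z"
          using 2 bounds[of z y] elim y by (auto simp: field_simps)
        ultimately show ?thesis using elim by (auto simp: dist_real_def)
      qed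
    qed
  qed
  have "(chi has_integral (- G x - - G (symbol pi))) {symbol pi..x}"
  proof (rule fundamental_theorem_of_calculus)
    show "symbol pi \<le> x" using x by simp
    fix y assume "y \<in> {symbol pi..x}"
    then have "((\<lambda>y. - G y) has_real_derivative chi y) (at y within {symbol pi..x})"
      using x by (intro has_field_derivative_subset[OF deriv]) auto
    then show "((\<lambda>y. - G y) has_vector_derivative chi y) (at y within {symbol pi..x})"
      by (simp add: has_real_derivative_iff_has_vector_derivative)
  qed
  then show ?thesis
    by (simp add: integral_unique G_def right_diff_distrib)
qed

end

text \<open>Imaginary part of the binomial expansion of
  \<open>(exp (i * \<phi>) - exp (- i * \<phi>)) ^ (2 * m - 1)\<close>, with the terms
  \<open>k\<close> and \<open>2 * m - 1 - k\<close> paired. The binomial coefficients and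
  alternating signs are those of \<open>multicrit_coeff\<close>.\<close>

lemma sin_power_odd:
  assumes "1 \<le> m"
  shows "(\<Sum>j=1..m. (-1) ^ (j + 1) * real ((2 * m - 1) choose (m - j)) * sin (real (2 * j - 1) * \<phi>))
    = 2 ^ (2 * m - 2) * sin \<phi> ^ (2 * m - 1)"
proof -
  define n where "n = 2 * m - 1"
  have n: "n = Suc (2 * (m - 1))" "odd n" "Suc n = 2 * m" using assms by (auto simp: n_def)
  define f where "f k = real (n choose k) * (-1) ^ k * sin ((real n - 2 * real k) * \<phi>)" for k
  have summand: "cis (- \<phi>) ^ k * cis \<phi> ^ (n - k) = cis ((real n - 2 * real k) * \<phi>)" if "k \<le> n" for k
  proof -
    have "cis (- \<phi>) ^ k * cis \<phi> ^ (n - k) = cis (real k * (- \<phi>) + real (n - k) * \<phi>)"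
      by (simp only: Complex.DeMoivre cis_mult)
    also have "real k * (- \<phi>) + real (n - k) * \<phi> = (real n - 2 * real k) * \<phi>"
      using that by (simp add: of_nat_diff algebra_simps)
    finally show ?thesis .
  qed
  have "(2 * \<i> * complex_of_real (sin \<phi>)) ^ n = (- cis (- \<phi>) + cis \<phi>) ^ n"
    by (intro arg_cong[of _ _ "\<lambda>z. z ^ n"]) (simp add: complex_eq_iff)
  also have "\<dots> = (\<Sum>k\<le>n. of_nat (n choose k) * ((-1) ^ k * cis ((real n - 2 * real k) * \<phi>)))"
    unfolding binomial_ring
  proof (rule sum.cong[OF refl])
    fix k assume "k \<in> {..n}"
    then have "k \<le> n" by simp
    show "of_nat (n choose k) * (- cis (- \<phi>)) ^ k * cis \<phi> ^ (n - k)
        = of_nat (n choose k) * ((-1) ^ k * cis ((real n - 2 * real k) * \<phi>))"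
      unfolding summand[OF \<open>k \<le> n\<close>, symmetric] power_minus[of "cis (- \<phi>)"] by (simp only: mult_ac)
  qed
  finally have "Im ((2 * \<i> * complex_of_real (sin \<phi>)) ^ n) = (\<Sum>k\<le>n. Im (of_nat (n choose k) * ((-1) ^ k * cis ((real n - 2 * real k) * \<phi>))))"
    by (simp only: Im_sum)
  also have "\<dots> = (\<Sum>k\<le>n. f k)"
  proof (intro sum.cong refl)
    fix k
    have "of_nat (n choose k) * ((-1) ^ k * cis ((real n - 2 * real k) * \<phi>))
        = complex_of_real (real (n choose k) * (-1) ^ k) * cis ((real n - 2 * real k) * \<phi>)"
      by simp
    moreover have "Im (complex_of_real a * cis b) = a * sin b" for a b
      by simp
    ultimately show "Im (of_nat (n choose k) * ((-1) ^ k * cis ((real n - 2 * real k) * \<phi>))) = f k"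
      unfolding f_def by (simp only:)
  qed
  also have "\<dots> = (\<Sum>k<m. f k) + (\<Sum>k\<in>{m..<2 * m}. f k)"
  proof -
    have "{..n} = {..<m} \<union> {m..<2 * m}" using n assms by auto
    then show ?thesis
      by (simp only:) (rule sum.union_disjoint; auto)
  qed
  \<comment> \<open>Under \<open>k \<mapsto> n - k\<close> both \<open>(-1) ^ k\<close> and the sine
    change sign, the former because \<open>n\<close> is odd.\<close>
  also have "(\<Sum>k\<in>{m..<2 * m}. f k) = (\<Sum>k<m. f k)"
  proof (rule sum.reindex_bij_witness[of _ "\<lambda>k. n - k" "\<lambda>k. n - k"])
    fix k assume k: "k \<in> {m..<2 * m}"
    then have kn: "k \<le> n" using n by auto
    have "(real n - 2 * real (n - k)) * \<phi> = - ((real n - 2 * real k) * \<phi>)"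
      using kn by (simp add: of_nat_diff algebra_simps)
    moreover have "(-1 :: real) ^ (n - k) = - ((-1) ^ k)"
      using n(2) kn by (auto simp: minus_one_power_iff)
    ultimately show "f (n - k) = f k"
      unfolding f_def using kn by (simp add: binomial_symmetric[symmetric])
  qed (use n in auto)
  finally have "Im ((2 * \<i> * complex_of_real (sin \<phi>)) ^ n) = 2 * (\<Sum>k<m. f k)"
    by simp
  moreover have "(2 * \<i> * complex_of_real (sin \<phi>)) ^ n = \<i> * complex_of_real (2 ^ n * (-1) ^ (m - 1) * sin \<phi> ^ n)"
  proof -
    have "\<i> ^ n = \<i> * (-1) ^ (m - 1)"
      unfolding n(1) by (simp add: power_mult)
    then show ?thesis
      by (simp only: power_mult_distrib of_real_mult of_real_power of_real_minus of_real_1 of_real_numeral mult_ac)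
  qed
  moreover have "Im (\<i> * complex_of_real a) = a" for a
    by simp
  ultimately have key: "2 ^ n * (-1) ^ (m - 1) * sin \<phi> ^ n = 2 * (\<Sum>k<m. f k)"
    by (simp only:)
  have "(\<Sum>k<m. f k) = (\<Sum>j=1..m. (-1) ^ (m - 1) * ((-1) ^ (j + 1) * real (n choose (m - j)) * sin (real (2 * j - 1) * \<phi>)))"
  proof (rule sum.reindex_bij_witness[of _ "\<lambda>j. m - j" "\<lambda>k. m - k"])
    fix k assume k: "k \<in> {..<m}"
    have r: "real n - 2 * real k = real (2 * (m - k) - 1)"
      using k assms by (auto simp: n_def of_nat_diff)
    have s: "(-1 :: real) ^ k = (-1) ^ (m - 1) * (-1) ^ (m - k + 1)"
      using k by (auto simp: power_add[symmetric] minus_one_power_iff)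
    show "(-1) ^ (m - 1) * ((-1) ^ (m - k + 1) * real (n choose (m - (m - k))) * sin (real (2 * (m - k) - 1) * \<phi>)) = f k"
      unfolding f_def r s using k by (simp add: mult_ac)
  qed auto
  then have "2 ^ n * (-1) ^ (m - 1) * sin \<phi> ^ n = 2 * ((-1) ^ (m - 1) * (\<Sum>j=1..m. (-1) ^ (j + 1) * real (n choose (m - j)) * sin (real (2 * j - 1) * \<phi>)))"
    unfolding key by (simp only: sum_distrib_left)
  moreover have "(2 :: real) ^ n = 2 * 2 ^ (2 * m - 2)"
    using n(1) by (simp add: algebra_simps)
  ultimately show ?thesis
    unfolding n_def[symmetric] by simp
qed

section \<open>The symbol of the multicritical coefficients\<close>

lemma multicrit_coeff_support: "multicrit_coeff m r = 0" if "r > 2 * m"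
  using that by (auto simp: multicrit_coeff_def)

lemma multicrit_miwa: "miwa (multicrit_coeff m) (2 * m)"
  by unfold_locales (rule multicrit_coeff_support)

definition multicrit_symbol :: "nat \<Rightarrow> real \<Rightarrow> real" where
  "multicrit_symbol m = miwa.symbol (multicrit_coeff m) (2 * m)"

text \<open>Only the odd indices \<open>2 * j - 1\<close> contribute, and the factor
  \<open>r\<close> in the symbol reduces the squared denominators of the coefficients to first
  powers.\<close>

lemma multicrit_symbol_sum:
  assumes "1 \<le> m"
  shows "multicrit_symbol m \<phi> = 2 / real ((2 * m - 1) choose (m - 1))
    * (\<Sum>j=1..m. (-1) ^ (j + 1) * real ((2 * m - 1) choose (m - j)) * (cos (real (2 * j - 1) * \<phi>) / real (2 * j - 1)))"
proof -
  let ?f = "\<lambda>r. real r * multicrit_coeff m r * cos (real r * \<phi>)"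
  have "sum ?f {1..2 * m} = sum ?f ((\<lambda>j. 2 * j - 1) ` {1..m})"
  proof (rule sum.mono_neutral_right)
    show "\<forall>i\<in>{1..2 * m} - (\<lambda>j. 2 * j - 1) ` {1..m}. ?f i = 0"
    proof
      fix i assume i: "i \<in> {1..2 * m} - (\<lambda>j. 2 * j - 1) ` {1..m}"
      have "even i"
      proof (rule ccontr)
        assume "odd i"
        then obtain k where "i = 2 * k + 1" by (elim oddE)
        then have "i = 2 * (k + 1) - 1" "k + 1 \<in> {1..m}" using i by auto
        then show False using i by blast
      qed
      then show "?f i = 0" by (simp add: multicrit_coeff_def)
    qed
  qed auto
  also have "\<dots> = (\<Sum>j=1..m. ?f (2 * j - 1))"
    by (subst sum.reindex) (auto simp: inj_on_def)
  also have "\<dots> = (\<Sum>j=1..m. 1 / real ((2 * m - 1) choose (m - 1)) * ((-1) ^ (j + 1) * real ((2 * m - 1) choose (m - j))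
      * (cos (real (2 * j - 1) * \<phi>) / real (2 * j - 1))))"
  proof (rule sum.cong[OF refl])
    fix j assume j: "j \<in> {1..m}"
    then have "odd (2 * j - 1)" "(2 * j - 1 + 1) div 2 = j" "real (2 * j - 1) = 2 * real j - 1" "2 * real j - 1 \<noteq> 0"
      by (auto simp: of_nat_diff)
    then show "?f (2 * j - 1) = 1 / real ((2 * m - 1) choose (m - 1)) * ((-1) ^ (j + 1) * real ((2 * m - 1) choose (m - j))
      * (cos (real (2 * j - 1) * \<phi>) / real (2 * j - 1)))"
      using j by (simp add: multicrit_coeff_def Let_def power2_eq_square)
  qed
  finally show ?thesis
    unfolding multicrit_symbol_def miwa.symbol_def[OF multicrit_miwa] by (simp add: sum_distrib_left)
qed

text \<open>Differentiation cancels the remaining denominators and leaves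
  \<open>sin_power_odd\<close>. The derivative vanishes to order \<open>2 * m - 1\<close> at 0 and
  \<open>\<pi>\<close>, which is the multicritical behaviour at the two edges.\<close>

lemma multicrit_symbol_deriv:
  assumes "1 \<le> m"
  shows "(multicrit_symbol m has_real_derivative
    - (2 ^ (2 * m - 1) / real ((2 * m - 1) choose m)) * sin \<phi> ^ (2 * m - 1)) (at \<phi>)"
proof -
  let ?C = "real ((2 * m - 1) choose (m - 1))"
  have C: "?C = real ((2 * m - 1) choose m)"
    using assms binomial_symmetric[of m "2 * m - 1"] by (simp add: Suc_diff_le mult_2)
  have "((\<lambda>\<phi>. 2 / ?C * (\<Sum>j=1..m. (-1) ^ (j + 1) * real ((2 * m - 1) choose (m - j))
        * (cos (real (2 * j - 1) * \<phi>) / real (2 * j - 1)))) has_real_derivative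
      2 / ?C * (\<Sum>j=1..m. (-1) ^ (j + 1) * real ((2 * m - 1) choose (m - j)) * (- sin (real (2 * j - 1) * \<phi>)))) (at \<phi>)"
  proof (intro DERIV_cmult DERIV_sum)
    fix j assume "j \<in> {1..m}"
    then have "real (2 * j - 1) \<noteq> 0" by auto
    then show "((\<lambda>\<phi>. cos (real (2 * j - 1) * \<phi>) / real (2 * j - 1)) has_real_derivative - sin (real (2 * j - 1) * \<phi>)) (at \<phi>)"
      by (auto intro!: derivative_eq_intros)
  qed
  also have "(\<Sum>j=1..m. (-1) ^ (j + 1) * real ((2 * m - 1) choose (m - j)) * (- sin (real (2 * j - 1) * \<phi>)))
      = - (2 ^ (2 * m - 2) * sin \<phi> ^ (2 * m - 1))"
    unfolding sin_power_odd[OF assms, symmetric] by (simp add: sum_negf)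
  also have "2 / ?C * - (2 ^ (2 * m - 2) * sin \<phi> ^ (2 * m - 1))
      = - (2 ^ (2 * m - 1) / real ((2 * m - 1) choose m)) * sin \<phi> ^ (2 * m - 1)"
  proof -
    have "(2 :: real) ^ (2 * m - 1) = 2 * 2 ^ (2 * m - 2)"
      using assms by (simp add: power_Suc[symmetric] Suc_diff_Suc numeral_2_eq_2 del: power_Suc)
    then show ?thesis unfolding C by simp
  qed
  finally show ?thesis
    unfolding multicrit_symbol_sum[OF assms, abs_def] .
qed

lemma multicrit_symbol_decreasing:
  assumes "1 \<le> m" "0 \<le> \<phi>" "\<phi> < \<phi>'" "\<phi>' \<le> pi"
  shows "multicrit_symbol m \<phi>' < multicrit_symbol m \<phi>"
proof (rule DERIV_neg_imp_decreasing_open[OF assms(3)])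
  fix y assume "\<phi> < y" "y < \<phi>'"
  then have "0 < sin y" using assms by (intro sin_gt_zero) auto
  then have "0 < 2 ^ (2 * m - 1) / real ((2 * m - 1) choose m) * sin y ^ (2 * m - 1)"
    using assms(1) by (intro mult_pos_pos divide_pos_pos zero_less_power) (auto intro!: zero_less_binomial)
  then show "\<exists>d. (multicrit_symbol m has_real_derivative d) (at y) \<and> d < 0"
    using multicrit_symbol_deriv[OF assms(1), of y] by (intro exI conjI) auto
next
  show "continuous_on {\<phi>..\<phi>'} (multicrit_symbol m)"
    unfolding multicrit_symbol_def by (rule miwa.continuous_on_symbol[OF multicrit_miwa])
qed

lemma multicrit_symbol_0: "multicrit_symbol m 0 = multicrit_edge m"
proof -
  have "(\<Sum>r. real r * multicrit_coeff m r) = (\<Sum>r=1..2 * m. real r * multicrit_coeff m r)"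
    by (rule suminf_finite) (auto simp: multicrit_coeff_support not_le)
  then show ?thesis
    by (simp add: multicrit_symbol_def miwa.symbol_def[OF multicrit_miwa] multicrit_edge_def)
qed

lemma multicrit_symbol_pi:
  assumes "1 \<le> m"
  shows "multicrit_symbol m pi = - multicrit_edge m"
proof -
  have c: "cos (real (2 * j - 1) * pi) = - cos (real (2 * j - 1) * 0)" if "j \<in> {1..m}" for j
    using that cos_npi[of "2 * j - 1"] by simp
  have "multicrit_symbol m pi = - multicrit_symbol m 0"
    unfolding multicrit_symbol_sum[OF assms] mult_minus_right[symmetric] sum_negf[symmetric]
    by (intro arg_cong2[where f = "(*)"] sum.cong refl) (simp only: c minus_divide_left[symmetric] mult_minus_right)
  then show ?thesis by (simp add: multicrit_symbol_0)
qed

lemma integral_sin_power: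
  assumes "1 \<le> m" "0 \<le> c"
  shows "integral {0..c} (\<lambda>\<phi>. sin \<phi> ^ (2 * m - 1))
    = real ((2 * m - 1) choose m) / 2 ^ (2 * m - 1) * (multicrit_edge m - multicrit_symbol m c)"
proof -
  let ?K = "2 ^ (2 * m - 1) / real ((2 * m - 1) choose m)"
  have K: "?K \<noteq> 0" using assms(1) by auto
  have "((\<lambda>\<phi>. - ?K * sin \<phi> ^ (2 * m - 1)) has_integral (multicrit_symbol m c - multicrit_symbol m 0)) {0..c}"
    using multicrit_symbol_deriv[OF assms(1)] assms(2)
    by (intro fundamental_theorem_of_calculus)
      (auto simp: has_real_derivative_iff_has_vector_derivative[symmetric] intro: has_field_derivative_at_within)
  from has_integral_mult_right[OF this, of "- 1 / ?K"]
  have "((\<lambda>\<phi>. sin \<phi> ^ (2 * m - 1)) has_integral (- 1 / ?K * (multicrit_symbol m c - multicrit_symbol m 0))) {0..c}"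
    using K by simp
  moreover have "- 1 / (p / q) * (u - v) = q / p * (v - u)" for p q u v :: real
    by (cases "p = 0"; cases "q = 0") (auto simp: field_simps)
  ultimately show ?thesis
    unfolding multicrit_symbol_0[symmetric] by (simp only: integral_unique)
qed

text \<open>By \<open>integral_sin_power\<close> the defining integral is an affine function of
  \<open>multicrit_symbol m (chi x)\<close> with nonzero slope, so the condition makes
  \<open>chi\<close> an inverse of the symbol.\<close>

lemma limit_angle_iff:
  assumes "1 \<le> m"
  shows "limit_angle m chi \<longleftrightarrow>
    (\<forall>x\<in>{- multicrit_edge m..multicrit_edge m}. chi x \<in> {0..pi} \<and> multicrit_symbol m (chi x) = x)"
proof -
  have "real ((2 * m - 1) choose m) / 2 ^ (2 * m - 1) \<noteq> 0"
    using assms by auto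
  then have "integral {0..c} (\<lambda>\<phi>. sin \<phi> ^ (2 * m - 1))
      = real ((2 * m - 1) choose m) / 2 ^ (2 * m - 1) * (multicrit_edge m - x) \<longleftrightarrow> multicrit_symbol m c = x"
    if "c \<in> {0..pi}" for c x
    using that integral_sin_power[OF assms, of c] by auto
  then show ?thesis
    unfolding limit_angle_def by blast
qed

lemma limit_angle_exists:
  assumes "1 \<le> m"
  shows "\<exists>chi. limit_angle m chi"
proof -
  have "\<exists>c. c \<in> {0..pi} \<and> multicrit_symbol m c = x" if "x \<in> {- multicrit_edge m..multicrit_edge m}" for x
    using IVT2'[of "multicrit_symbol m" pi x 0] that
      miwa.continuous_on_symbol[OF multicrit_miwa, of "{0..pi}" m]
    by (auto simp: multicrit_symbol_0 multicrit_symbol_pi[OF assms] multicrit_symbol_def[symmetric])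
  then show ?thesis
    unfolding limit_angle_iff[OF assms] by metis
qed

definition multicrit_mean :: "nat \<Rightarrow> real \<Rightarrow> real" where
  "multicrit_mean m = miwa.limit_mean (multicrit_coeff m) (2 * m)"

lemma multicrit_edge_pos:
  assumes "1 \<le> m" shows "0 < multicrit_edge m"
  using multicrit_symbol_decreasing[OF assms, of 0 pi]
  by (simp add: multicrit_symbol_0 multicrit_symbol_pi[OF assms])

lemma multicrit_symbol_range:
  assumes "1 \<le> m" "\<phi> \<in> {0..pi}"
  shows "\<bar>multicrit_symbol m \<phi>\<bar> \<le> multicrit_edge m"
  using multicrit_symbol_decreasing[OF assms(1), of 0 \<phi>] multicrit_symbol_decreasing[OF assms(1), of \<phi> pi] assms(2)
    multicrit_edge_pos[OF assms(1)]
  by (cases "\<phi> = 0"; cases "\<phi> = pi") (auto simp: multicrit_symbol_0 multicrit_symbol_pi[OF assms(1)])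

lemma multicrit_mean_right: "1 \<le> m \<Longrightarrow> multicrit_edge m \<le> x \<Longrightarrow> multicrit_mean m x = 0"
  unfolding multicrit_mean_def
  using multicrit_symbol_range[of m]
  by (intro miwa.limit_mean_right[OF multicrit_miwa]) (fastforce simp: multicrit_symbol_def)

lemma multicrit_mean_left: "1 \<le> m \<Longrightarrow> x \<le> - multicrit_edge m \<Longrightarrow> multicrit_mean m x = - x"
  unfolding multicrit_mean_def
  using multicrit_symbol_range[of m]
  by (intro miwa.limit_mean_left[OF multicrit_miwa]) (fastforce simp: multicrit_symbol_def)

text \<open>With \<open>b\<close> the edge, \<open>integral_angle\<close> and
  \<open>multicrit_mean m (- b) = b\<close> turn \<open>2 * b - 2 / \<pi> * integral\<close> into
  twice the mean; outside \<open>[-b, b]\<close> the mean is 0 or \<open>- x\<close>.\<close>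

lemma limit_profile_eq:
  assumes "1 \<le> m" "limit_angle m chi"
  shows "limit_profile m chi x = x + 2 * multicrit_mean m x"
proof -
  let ?b = "multicrit_edge m"
  consider "x \<in> {- ?b..?b}" | "?b < x" | "x < - ?b" by fastforce
  then show ?thesis
  proof cases
    case 1
    have "integral {multicrit_symbol m pi..x} chi = pi * (multicrit_mean m (multicrit_symbol m pi) - multicrit_mean m x)"
      unfolding multicrit_mean_def multicrit_symbol_def
    proof (rule miwa.integral_angle[OF multicrit_miwa], unfold multicrit_symbol_def[symmetric])
      show "multicrit_symbol m \<phi>' < multicrit_symbol m \<phi>" if "0 \<le> \<phi>" "\<phi> < \<phi>'" "\<phi>' \<le> pi" for \<phi> \<phi>'
        by (rule multicrit_symbol_decreasing[OF assms(1) that])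
      show "chi x \<in> {0..pi} \<and> multicrit_symbol m (chi x) = x" if "x \<in> {multicrit_symbol m pi..multicrit_symbol m 0}" for x
        using that assms(2) unfolding limit_angle_iff[OF assms(1)]
        by (auto simp: multicrit_symbol_0 multicrit_symbol_pi[OF assms(1)])
      show "x \<in> {multicrit_symbol m pi..multicrit_symbol m 0}"
        using 1 by (simp add: multicrit_symbol_0 multicrit_symbol_pi[OF assms(1)])
    qed
    then have "integral {- ?b..x} chi = pi * (?b - multicrit_mean m x)"
      by (simp add: multicrit_symbol_pi[OF assms(1)] multicrit_mean_left[OF assms(1)])
    then show ?thesis using 1 by (simp add: limit_profile_def Let_def field_simps)
  next
    case 2
    then show ?thesis
      using multicrit_edge_pos[OF assms(1)] by (auto simp: limit_profile_def Let_def multicrit_mean_right[OF assms(1)])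
  next
    case 3
    then show ?thesis
      using multicrit_edge_pos[OF assms(1)] by (auto simp: limit_profile_def Let_def multicrit_mean_left[OF assms(1)])
  qed
qed

section \<open>Concentration\<close>

text \<open>One number of rows for finitely many levels, so that the counts become cardinalities of
  subsets of one finite set.\<close>

lemma particle_count_large:
  assumes "l \<in> partitions" and "finite (S :: int set)"
  obtains N where "\<And>n. n \<in> S \<Longrightarrow> particle_count l n = card {i \<in> {..<N}. n < row_index l i}"
    and "nat K \<le> N"
proof -
  define N where "N = Max (insert (nat K) (insert (length l) ((\<lambda>n. nat (- n)) ` S)))"
  have "x \<le> N" if "x \<in> insert (nat K) (insert (length l) ((\<lambda>n. nat (- n)) ` S))" for x
    unfolding N_def using that \<open>finite S\<close> by (intro Max_ge) auto
  then have N: "nat K \<le> N" "length l \<le> N" "\<And>n. n \<in> S \<Longrightarrow> nat (- n) \<le> N"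
    by auto
  have "particle_count l n = card {i \<in> {..<N}. n < row_index l i}" if "n \<in> S" for n
    using N(3)[OF that] by (intro particle_count_eq assms N(2)) linarith
  then show ?thesis using that N(1) by blast
qed

lemma particle_count_antimono:
  assumes "l \<in> partitions" "y \<le> y'"
  shows "particle_count l y' \<le> particle_count l y"
proof -
  obtain N where N: "\<And>n. n \<in> {y, y'} \<Longrightarrow> particle_count l n = card {i \<in> {..<N}. n < row_index l i}"
    by (rule particle_count_large[OF assms(1), of "{y, y'}" 0]) auto
  then show ?thesis
    using assms(2) by (auto intro!: card_mono)
qed

lemma particle_count_lipschitz:
  assumes l: "l \<in> partitions" and y: "y \<le> y'"
  shows "particle_count l y \<le> particle_count l y' + nat (y' - y)"
proof -
  obtain N where N: "\<And>n. n \<in> {y, y'} \<Longrightarrow> particle_count l n = card {i \<in> {..<N}. n < row_index l i}"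
    by (rule particle_count_large[OF l, of "{y, y'}" 0]) auto
  let ?A = "{i \<in> {..<N}. y < row_index l i \<and> row_index l i \<le> y'}"
  have "card ?A = card (row_index l ` ?A)"
    by (rule card_image[symmetric]) (auto simp: inj_on_def dest: row_index_inj[OF l])
  also have "\<dots> \<le> card {y<..y'}"
    by (intro card_mono) auto
  finally have A: "card ?A \<le> nat (y' - y)" by simp
  have "card {i \<in> {..<N}. y < row_index l i} \<le> card ({i \<in> {..<N}. y' < row_index l i} \<union> ?A)"
    by (intro card_mono) auto
  also have "\<dots> \<le> card {i \<in> {..<N}. y' < row_index l i} + card ?A"
    by (rule card_Un_le)
  finally show ?thesis using N A by simp
qed

text \<open>Each row \<open>i < - y\<close> counts, because
  \<open>row_index l i \<ge> - i > y\<close>.\<close>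

lemma particle_count_ge:
  assumes l: "l \<in> partitions"
  shows "- y \<le> int (particle_count l y)"
proof -
  obtain N where N: "\<And>n. n \<in> {y} \<Longrightarrow> particle_count l n = card {i \<in> {..<N}. n < row_index l i}" "nat (- y) \<le> N"
    by (rule particle_count_large[OF l, of "{y}" "- y"]) auto
  have "card {..<nat (- y)} \<le> card {i \<in> {..<N}. y < row_index l i}"
    using N(2) by (intro card_mono) (auto simp: row_index_def)
  then show ?thesis using N by simp
qed

lemma ln_one_plus_lower:
  fixes z :: real
  assumes "\<bar>z\<bar> \<le> 1 / 2"
  shows "z - 2 * z\<^sup>2 \<le> ln (1 + z)"
proof (cases "0 \<le> z")
  case True
  then have "z - z\<^sup>2 \<le> ln (1 + z)" using assms by (intro ln_one_plus_pos_lower_bound) auto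
  then show ?thesis using zero_le_power2[of z] by linarith
next
  case False
  then show ?thesis using ln_one_minus_pos_lower_bound[of "- z"] assms by simp
qed

text \<open>Markov's inequality: the side condition makes \<open>(1 + z)\<close> to the power
  \<open>count - c\<close> at least 1 on \<open>F\<close> for either sign of \<open>z\<close>, so
  both tails are treated at once. The quadratic term comes from
  \<open>ln_one_plus_lower\<close>.\<close>

lemma (in miwa) chernoff:
  assumes F: "finite F" "F \<subseteq> partitions" and z: "\<bar>z\<bar> \<le> 1 / 2" and c: "0 \<le> c"
    and side: "\<And>l. l \<in> F \<Longrightarrow> 0 \<le> z * (real (particle_count l n) - c)"
  shows "(\<Sum>l\<in>F. (schur l t)\<^sup>2) \<le> exp (Z + z * (miwa_mean t n - c) + 2 * z\<^sup>2 * c)"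
proof -
  have z1: "0 < 1 + z" using z by linarith
  have "(schur l t)\<^sup>2 \<le> exp (- c * ln (1 + z)) * ((schur l t)\<^sup>2 * (1 + z) ^ particle_count l n)" if "l \<in> F" for l
  proof -
    have "0 \<le> (real (particle_count l n) - c) * ln (1 + z)"
    proof (cases "z = 0")
      case False
      then show ?thesis
        using side[OF that] z1 ln_gt_zero[of "1 + z"] ln_less_zero[of "1 + z"]
        by (cases "0 < z") (auto simp: zero_le_mult_iff)
    qed simp
    then have "1 \<le> exp ((real (particle_count l n) - c) * ln (1 + z))" by simp
    also have "\<dots> = exp (- c * ln (1 + z)) * (1 + z) ^ particle_count l n"
    proof -
      have "(1 + z) ^ particle_count l n = exp (real (particle_count l n) * ln (1 + z))"
        using z1 by (simp add: exp_of_nat_mult)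
      then show ?thesis by (simp add: exp_add[symmetric] algebra_simps)
    qed
    finally have "(schur l t)\<^sup>2 * 1 \<le> (schur l t)\<^sup>2 * (exp (- c * ln (1 + z)) * (1 + z) ^ particle_count l n)"
      by (intro mult_left_mono) auto
    then show ?thesis by (simp add: mult_ac)
  qed
  then have "(\<Sum>l\<in>F. (schur l t)\<^sup>2) \<le> exp (- c * ln (1 + z)) * (\<Sum>l\<in>F. (schur l t)\<^sup>2 * (1 + z) ^ particle_count l n)"
    unfolding sum_distrib_left by (rule sum_mono)
  also have "\<dots> \<le> exp (- c * ln (1 + z)) * exp (Z + z * miwa_mean t n)"
    using z by (intro mult_left_mono exp_moment_le F) auto
  also have "\<dots> \<le> exp (Z + z * (miwa_mean t n - c) + 2 * z\<^sup>2 * c)"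
    using mult_left_mono[OF ln_one_plus_lower[OF z] c]
    by (simp add: exp_add[symmetric] algebra_simps)
  finally show ?thesis .
qed

definition multicrit_weight :: "nat \<Rightarrow> real \<Rightarrow> nat list \<Rightarrow> real" where
  "multicrit_weight m \<theta> l = exp (- \<theta>\<^sup>2 * (\<Sum>r. real r * (multicrit_coeff m r)\<^sup>2))
     * (schur l (\<lambda>r. \<theta> * multicrit_coeff m r))\<^sup>2"

lemma multicrit_weight_nonneg: "0 \<le> multicrit_weight m \<theta> l"
  by (simp add: multicrit_weight_def)

text \<open>Lists of naturals are countable, so any event is exhausted by its finite subsets of
  members with code below \<open>n\<close>, and continuity from below carries the bound
  over.\<close>

lemma measure_multicrit_le:
  assumes A: "A \<subseteq> partitions" and B: "0 \<le> B"
    and F: "\<And>F. finite F \<Longrightarrow> F \<subseteq> A \<Longrightarrow> (\<Sum>l\<in>F. multicrit_weight m \<theta> l) \<le> B"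
  shows "measure (multicrit_measure m \<theta>) A \<le> B"
proof -
  let ?M = "multicrit_measure m \<theta>"
  have M: "?M = density (count_space partitions) (\<lambda>l. ennreal (multicrit_weight m \<theta> l))"
    unfolding multicrit_measure_def multicrit_weight_def ..
  define A' where "A' n = {l \<in> A. to_nat l < n}" for n
  have fin: "finite (A' n)" for n
  proof (rule finite_imageD)
    have "to_nat ` A' n \<subseteq> {..<n}" by (auto simp: A'_def)
    then show "finite (to_nat ` A' n)" by (rule finite_subset) simp
    show "inj_on to_nat (A' n)" by (rule inj_on_subset[OF inj_to_nat]) simp
  qed
  have sets: "A' n \<in> sets ?M" for n
    using A by (auto simp: M A'_def)
  have "emeasure ?M (A' n) \<le> ennreal B" for n
  proof -
    have "emeasure ?M (A' n) = (\<integral>\<^sup>+l. ennreal (multicrit_weight m \<theta> l) * indicator (A' n) l \<partial>count_space partitions)"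
      unfolding M using A by (intro emeasure_density) (auto simp: A'_def)
    also have "\<dots> = (\<Sum>l\<in>A' n. ennreal (multicrit_weight m \<theta> l) * indicator (A' n) l)"
      using A fin by (intro nn_integral_count_space') (auto simp: A'_def)
    also have "\<dots> = ennreal (\<Sum>l\<in>A' n. multicrit_weight m \<theta> l)"
      by (simp add: sum_ennreal multicrit_weight_nonneg)
    also have "\<dots> \<le> ennreal B"
      by (intro ennreal_leI F fin) (auto simp: A'_def)
    finally show ?thesis .
  qed
  moreover have "(SUP n. emeasure ?M (A' n)) = emeasure ?M (\<Union>n. A' n)"
    by (intro SUP_emeasure_incseq) (auto simp: incseq_def A'_def sets[unfolded A'_def])
  moreover have "(\<Union>n. A' n) = A"
    by (auto simp: A'_def)
  ultimately have "emeasure ?M A \<le> ennreal B"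
    by (metis SUP_least)
  then show ?thesis
    unfolding measure_def by (rule enn2real_leI[OF B])
qed

text \<open>Half of \<open>\<epsilon>\<close> absorbs the distance of the rescaled mean from its
  limit; the other half is a deviation of size \<open>\<theta> * \<epsilon>'\<close> from the mean,
  to which \<open>chernoff\<close> applies.\<close>

lemma deviation_bound:
  assumes m: "1 \<le> m" and \<epsilon>: "0 < \<epsilon>"
  obtains \<kappa> where "0 < \<kappa>" and "\<forall>\<^sub>F \<theta> in at_top. \<forall>F. finite F \<longrightarrow>
    F \<subseteq> {l \<in> partitions. \<epsilon> \<le> \<bar>real (particle_count l \<lfloor>\<theta> * x\<rfloor>) / \<theta> - multicrit_mean m x\<bar>} \<longrightarrow>
    (\<Sum>l\<in>F. multicrit_weight m \<theta> l) \<le> 2 * exp (- \<kappa> * \<theta>)"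
proof -
  let ?g = "multicrit_mean m x"
  define t where "t \<theta> r = \<theta> * multicrit_coeff m r" for \<theta> r
  have t: "miwa (t \<theta>) (2 * m)" for \<theta>
    by unfold_locales (simp add: t_def multicrit_coeff_support)
  have lim: "((\<lambda>\<theta>. miwa_mean (t \<theta>) \<lfloor>\<theta> * x\<rfloor> / \<theta>) \<longlongrightarrow> ?g) at_top"
    unfolding multicrit_mean_def t_def by (rule miwa.mean_asymptotics[OF multicrit_miwa])
  have g0: "0 \<le> ?g"
    unfolding multicrit_mean_def miwa.limit_mean_def[OF multicrit_miwa]
    by (intro mult_nonneg_nonneg integral_nonneg miwa.limit_mean_integrable[OF multicrit_miwa]) auto
  define \<epsilon>' where "\<epsilon>' = \<epsilon> / 2"
  define G where "G = ?g + \<epsilon>"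
  \<comment> \<open>The maximizer of \<open>\<zeta> * \<epsilon>' - 2 * \<zeta>\<^sup>2 * G\<close>,
    where \<open>\<theta> * G\<close> bounds the threshold \<open>c\<close>; the maximum is
    \<open>\<kappa>\<close>.\<close>
  define \<zeta> where "\<zeta> = \<epsilon>' / (4 * G)"
  have pos: "0 < \<epsilon>'" "0 < G" "\<epsilon>' \<le> G" "0 < \<zeta>" "\<zeta> \<le> 1 / 2"
    using \<epsilon> g0 by (auto simp: \<epsilon>'_def G_def \<zeta>_def field_simps)
  define \<kappa> where "\<kappa> = \<zeta> * \<epsilon>' / 2"
  have \<kappa>: "\<kappa> = \<zeta> * \<epsilon>' - 2 * \<zeta>\<^sup>2 * G"
    using pos by (simp add: \<kappa>_def \<zeta>_def power2_eq_square field_simps)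
  have Z: "(\<Sum>r=1..2 * m. real r * (t \<theta> r)\<^sup>2) = \<theta>\<^sup>2 * (\<Sum>r. real r * (multicrit_coeff m r)\<^sup>2)" for \<theta>
  proof -
    have "(\<Sum>r. real r * (multicrit_coeff m r)\<^sup>2) = (\<Sum>r=1..2 * m. real r * (multicrit_coeff m r)\<^sup>2)"
      by (rule suminf_finite) (auto simp: multicrit_coeff_support not_le)
    then show ?thesis by (simp add: t_def power_mult_distrib sum_distrib_left mult_ac)
  qed
  show thesis
  proof (rule that[of \<kappa>])
    show "0 < \<kappa>" using pos by (simp add: \<kappa>_def)
    have "\<forall>\<^sub>F \<theta> in at_top. dist (miwa_mean (t \<theta>) \<lfloor>\<theta> * x\<rfloor> / \<theta>) ?g < \<epsilon>'"
      by (rule tendstoD[OF lim pos(1)])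
    then show "\<forall>\<^sub>F \<theta> in at_top. \<forall>F. finite F \<longrightarrow>
      F \<subseteq> {l \<in> partitions. \<epsilon> \<le> \<bar>real (particle_count l \<lfloor>\<theta> * x\<rfloor>) / \<theta> - ?g\<bar>} \<longrightarrow>
      (\<Sum>l\<in>F. multicrit_weight m \<theta> l) \<le> 2 * exp (- \<kappa> * \<theta>)"
      using eventually_gt_at_top[of 0]
    proof eventually_elim
      case (elim \<theta>)
      define M where "M = miwa_mean (t \<theta>) \<lfloor>\<theta> * x\<rfloor>"
      define N where "N l = real (particle_count l \<lfloor>\<theta> * x\<rfloor>)" for l
      have M: "\<bar>M / \<theta> - ?g\<bar> < \<epsilon>'" using elim by (simp add: M_def dist_real_def)
      have one_side: "(\<Sum>l\<in>F. multicrit_weight m \<theta> l) \<le> exp (- \<kappa> * \<theta>)"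
        if F: "finite F" "F \<subseteq> partitions" and s: "s = 1 \<or> s = -1"
          and side: "\<And>l. l \<in> F \<Longrightarrow> \<theta> * \<epsilon>' \<le> s * (N l - M)" for F and s :: real
      proof (cases "F = {}")
        case False
        define c where "c = M + s * \<theta> * \<epsilon>'"
        have side': "0 \<le> s * (N l - c)" if "l \<in> F" for l
          using side[OF that] s by (auto simp: c_def algebra_simps)
        \<comment> \<open>For \<open>s = -1\<close> this comes from a member of \<open>F\<close>,
          whose count is at most \<open>c\<close>; hence the empty set is split off.\<close>
        have c0: "0 \<le> c"
        proof (cases "s = 1")
          case True
          have "0 \<le> M"
            unfolding M_def by (rule has_sum_nonneg[OF miwa.mean_has_sum[OF t]]) auto
          then show ?thesis using True elim pos by (simp add: c_def)
        next
          case False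
          obtain l where "l \<in> F" using \<open>F \<noteq> {}\<close> by blast
          from side'[OF this] False s show ?thesis by (simp add: N_def)
        qed
        have "c \<le> \<theta> * G"
        proof -
          have "M \<le> \<theta> * (?g + \<epsilon>')" using M elim by (simp add: field_simps abs_less_iff)
          moreover have "s * \<theta> * \<epsilon>' \<le> \<theta> * \<epsilon>'" using s elim pos by auto
          ultimately show ?thesis by (simp add: c_def G_def \<epsilon>'_def algebra_simps)
        qed
        then have cG: "2 * \<zeta>\<^sup>2 * c \<le> 2 * \<zeta>\<^sup>2 * (\<theta> * G)"
          by (intro mult_left_mono) auto
        have s2: "s * s = 1" using s by auto
        have "(\<Sum>l\<in>F. (schur l (t \<theta>))\<^sup>2)
            \<le> exp (\<theta>\<^sup>2 * (\<Sum>r. real r * (multicrit_coeff m r)\<^sup>2) + s * \<zeta> * (M - c) + 2 * (s * \<zeta>)\<^sup>2 * c)"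
          unfolding Z[symmetric] M_def
        proof (rule miwa.chernoff[OF t F _ c0])
          show "\<bar>s * \<zeta>\<bar> \<le> 1 / 2" using s pos by (auto simp: abs_mult)
          show "0 \<le> s * \<zeta> * (real (particle_count l \<lfloor>\<theta> * x\<rfloor>) - c)" if "l \<in> F" for l
            using mult_left_mono[OF side'[OF that], of \<zeta>] pos by (simp add: N_def mult_ac)
        qed
        also have "\<dots> \<le> exp (\<theta>\<^sup>2 * (\<Sum>r. real r * (multicrit_coeff m r)\<^sup>2) + - \<kappa> * \<theta>)"
        proof -
          have "s * \<zeta> * (M - c) = - (s * s) * (\<zeta> * \<theta> * \<epsilon>')"
            by (simp add: c_def)
          moreover have "(s * \<zeta>)\<^sup>2 = \<zeta>\<^sup>2"
            using s by (auto simp: power_mult_distrib)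
          moreover have "- (\<zeta> * \<theta> * \<epsilon>') + 2 * \<zeta>\<^sup>2 * (\<theta> * G) = - \<kappa> * \<theta>"
            unfolding \<kappa> by (simp add: algebra_simps)
          ultimately show ?thesis
            using cG unfolding s2 by simp
        qed
        finally have "exp (- \<theta>\<^sup>2 * (\<Sum>r. real r * (multicrit_coeff m r)\<^sup>2)) * (\<Sum>l\<in>F. (schur l (t \<theta>))\<^sup>2)
            \<le> exp (- \<theta>\<^sup>2 * (\<Sum>r. real r * (multicrit_coeff m r)\<^sup>2)) *
              exp (\<theta>\<^sup>2 * (\<Sum>r. real r * (multicrit_coeff m r)\<^sup>2) + - \<kappa> * \<theta>)"
          by (intro mult_left_mono) auto
        also have "\<dots> = exp (- \<kappa> * \<theta>)"
          unfolding exp_add[symmetric] by simp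
        finally show ?thesis
          by (simp add: multicrit_weight_def sum_distrib_left t_def[abs_def])
      qed simp
      show ?case
      proof (intro allI impI)
        fix F assume F: "finite F" "F \<subseteq> {l \<in> partitions. \<epsilon> \<le> \<bar>real (particle_count l \<lfloor>\<theta> * x\<rfloor>) / \<theta> - ?g\<bar>}"
        define F1 where "F1 = {l \<in> F. \<theta> * \<epsilon>' \<le> 1 * (N l - M)}"
        define F2 where "F2 = {l \<in> F. \<theta> * \<epsilon>' \<le> (-1) * (N l - M)}"
        have "F \<subseteq> F1 \<union> F2"
        proof
          fix l assume l: "l \<in> F"
          then have "\<epsilon> \<le> \<bar>N l / \<theta> - ?g\<bar>" using F by (auto simp: N_def)
          then have "\<epsilon>' \<le> \<bar>N l / \<theta> - M / \<theta>\<bar>"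
            using M unfolding \<epsilon>'_def by linarith
          also have "\<dots> = \<bar>N l - M\<bar> / \<theta>"
            using elim by (simp add: diff_divide_distrib[symmetric])
          finally have "\<theta> * \<epsilon>' \<le> \<bar>N l - M\<bar>" using elim by (simp add: field_simps)
          then show "l \<in> F1 \<union> F2" using l by (auto simp: F1_def F2_def)
        qed
        then have "(\<Sum>l\<in>F. multicrit_weight m \<theta> l) \<le> (\<Sum>l\<in>F1 \<union> F2. multicrit_weight m \<theta> l)"
          using F(1) by (intro sum_mono2) (auto simp: F1_def F2_def multicrit_weight_nonneg)
        also have "\<dots> \<le> (\<Sum>l\<in>F1. multicrit_weight m \<theta> l) + (\<Sum>l\<in>F2. multicrit_weight m \<theta> l)"
          using F(1) by (subst sum.union_inter[symmetric]) (auto simp: F1_def F2_def intro!: sum_nonneg multicrit_weight_nonneg)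
        also have "\<dots> \<le> exp (- \<kappa> * \<theta>) + exp (- \<kappa> * \<theta>)"
          using F by (intro add_mono one_side[of F1 1] one_side[of F2 "-1"]) (auto simp: F1_def F2_def)
        finally show "(\<Sum>l\<in>F. multicrit_weight m \<theta> l) \<le> 2 * exp (- \<kappa> * \<theta>)" by simp
      qed
    qed
  qed
qed

section \<open>From particle counts to the interpolated profile\<close>

lemma profile_eq:
  assumes "0 < \<theta>"
  shows "profile l \<theta> x = x + 2 * ((1 - frac (\<theta> * x)) * (real (particle_count l \<lfloor>\<theta> * x\<rfloor>) / \<theta>)
    + frac (\<theta> * x) * (real (particle_count l (\<lfloor>\<theta> * x\<rfloor> + 1)) / \<theta>))"
proof -
  define y where "y = real_of_int \<lfloor>\<theta> * x\<rfloor>"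
  define f where "f = frac (\<theta> * x)"
  have "\<theta> * x = y + f" by (simp add: y_def f_def frac_def)
  then have x: "y / \<theta> + f / \<theta> = x"
    using assms by (simp add: add_divide_distrib[symmetric] field_simps)
  have "(1 - f) * (y / \<theta> + 2 / \<theta> * A) + f * ((y + 1) / \<theta> + 2 / \<theta> * B)
      = y / \<theta> + f / \<theta> + 2 * ((1 - f) * (A / \<theta>) + f * (B / \<theta>))" for A B
    by (simp add: add_divide_distrib diff_divide_distrib algebra_simps)
  from this[unfolded x] show ?thesis
    unfolding profile_def lattice_height_def particle_count_def[symmetric]
    by (simp only: f_def[symmetric] y_def[symmetric] of_int_add of_int_1)
qed

lemma multicrit_mean_antimono: "x \<le> y \<Longrightarrow> multicrit_mean m y \<le> multicrit_mean m x"
  unfolding multicrit_mean_def by (rule miwa.limit_mean_antimono[OF multicrit_miwa])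

lemma multicrit_mean_lipschitz: "x \<le> y \<Longrightarrow> multicrit_mean m x \<le> multicrit_mean m y + (y - x)"
  unfolding multicrit_mean_def by (rule miwa.limit_mean_lipschitz[OF multicrit_miwa])

text \<open>Monotonicity of the particle count reduces uniform closeness to closeness on a finite grid
  of \<open>[-b, b]\<close>; outside of it the trivial bounds \<open>particle_count l y \<ge> max 0 (- y)\<close> suffice.\<close>

lemma lattice_close:
  fixes b \<delta> \<eta> \<theta> :: real
  assumes m: "1 \<le> m" and l: "l \<in> partitions" and \<theta>: "0 < \<theta>" and \<delta>: "0 < \<delta>" and K: "0 < K"
    and b: "b = multicrit_edge m" "2 * b = real K * \<delta>"
    and grid: "\<And>i. i \<le> K \<Longrightarrow> \<bar>real (particle_count l \<lfloor>\<theta> * (- b + real i * \<delta>)\<rfloor>) / \<theta>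
        - multicrit_mean m (- b + real i * \<delta>)\<bar> < \<eta>"
  shows "\<bar>real (particle_count l y) / \<theta> - multicrit_mean m (of_int y / \<theta>)\<bar> \<le> \<eta> + \<delta>"
proof -
  let ?g = "multicrit_mean m" and ?N = "\<lambda>y. real (particle_count l y) / \<theta>"
  define u where "u = of_int y / \<theta>"
  have y: "of_int y = \<theta> * u" using \<theta> by (simp add: u_def)
  have anti: "?N y2 \<le> ?N y1" if "y1 \<le> y2" for y1 y2
    using particle_count_antimono[OF l that] \<theta> by (intro divide_right_mono) auto
  have \<eta>: "0 < \<eta>" using grid[of 0] by linarith
  consider "u < - b" | "- b \<le> u" "u < b" | "b \<le> u" by linarith
  then have "\<bar>?N y - ?g u\<bar> \<le> \<eta> + \<delta>"
  proof cases
    case 1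
    let ?y0 = "\<lfloor>\<theta> * - b\<rfloor>"
    have "\<theta> * u < \<theta> * - b" using 1 \<theta> by (intro mult_strict_left_mono)
    then have le: "y \<le> ?y0" using y by (simp add: le_floor_iff)
    have gu: "?g u = - u" "?g (- b) = b"
      using 1 b(1) multicrit_mean_left[OF m] by auto
    have "\<bar>?N ?y0 - b\<bar> < \<eta>" using grid[of 0] gu by simp
    moreover have "?N y \<le> (real (particle_count l ?y0) + (of_int ?y0 - of_int y)) / \<theta>"
      using particle_count_lipschitz[OF l le] \<theta> le by (intro divide_right_mono) linarith+
    then have "?N y \<le> ?N ?y0 + (of_int ?y0 / \<theta> - u)"
      using \<theta> by (simp add: u_def add_divide_distrib diff_divide_distrib)
    moreover have "of_int ?y0 / \<theta> \<le> - b"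
    proof -
      have "of_int ?y0 \<le> \<theta> * - b" by (rule of_int_floor_le)
      then show ?thesis using \<theta> by (simp add: field_simps)
    qed
    moreover have "- u \<le> ?N y"
    proof -
      have "- of_int y \<le> real (particle_count l y)" using particle_count_ge[OF l, of y] by linarith
      then have "- of_int y / \<theta> \<le> ?N y" using \<theta> by (intro divide_right_mono) auto
      then show ?thesis by (simp add: u_def)
    qed
    ultimately show ?thesis using gu \<delta> by linarith
  next
    case 2
    define i where "i = nat \<lfloor>(u + b) / \<delta>\<rfloor>"
    have nn: "0 \<le> (u + b) / \<delta>" using 2 \<delta> by simp
    then have i: "real i \<le> (u + b) / \<delta>" "(u + b) / \<delta> < real i + 1"
      unfolding i_def by linarith+
    define x1 where "x1 = - b + real i * \<delta>"
    define x2 where "x2 = - b + real (Suc i) * \<delta>"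
    have x: "x1 \<le> u" "u < x2" "x2 = x1 + \<delta>"
      using i \<delta> by (auto simp: x1_def x2_def field_simps)
    have iK: "Suc i \<le> K"
    proof -
      have "x1 < b" using x 2 by simp
      then have "real i * \<delta> < real K * \<delta>" using b(2) by (simp add: x1_def)
      then show ?thesis using \<delta> by simp
    qed
    have y12: "\<lfloor>\<theta> * x1\<rfloor> \<le> y" "y \<le> \<lfloor>\<theta> * x2\<rfloor>"
    proof -
      have "\<theta> * x1 \<le> of_int y" "of_int y \<le> \<theta> * x2"
        unfolding y using x \<theta> by (auto intro: mult_left_mono)
      then show "\<lfloor>\<theta> * x1\<rfloor> \<le> y" "y \<le> \<lfloor>\<theta> * x2\<rfloor>"
        by (auto simp: le_floor_iff floor_le_iff)
    qed
    have "\<bar>?N \<lfloor>\<theta> * x1\<rfloor> - ?g x1\<bar> < \<eta>" "\<bar>?N \<lfloor>\<theta> * x2\<rfloor> - ?g x2\<bar> < \<eta>"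
      unfolding x1_def x2_def using grid[of i] grid[of "Suc i"] iK by auto
    moreover have "?g x1 \<le> ?g u + \<delta>" "?g u \<le> ?g x2 + \<delta>"
      using multicrit_mean_lipschitz[of x1 u m] multicrit_mean_lipschitz[of u x2 m] x by auto
    ultimately show ?thesis
      using anti[OF y12(1)] anti[OF y12(2)] by linarith
  next
    case 3
    have "\<lfloor>\<theta> * b\<rfloor> \<le> y"
    proof -
      have "\<theta> * b \<le> of_int y" unfolding y using 3 \<theta> by (intro mult_left_mono) auto
      then show ?thesis by (simp add: floor_le_iff)
    qed
    moreover have gb: "?g u = 0" "?g b = 0" using 3 b(1) multicrit_mean_right[OF m] by auto
    moreover have "\<bar>?N \<lfloor>\<theta> * b\<rfloor> - ?g b\<bar> < \<eta>"
    proof -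
      have "- b + real K * \<delta> = b" using b(2) by simp
      then show ?thesis using grid[of K] by simp
    qed
    moreover have "0 \<le> ?N y" using \<theta> by simp
    ultimately show ?thesis using anti[of "\<lfloor>\<theta> * b\<rfloor>" y] \<delta> by linarith
  qed
  then show ?thesis by (simp add: u_def)
qed

text \<open>Both lattice neighbours of \<open>x\<close> lie within \<open>1 / \<theta>\<close>,
  where the mean changes by at most \<open>1 / \<theta>\<close>, and interpolation is a convex
  combination.\<close>

lemma profile_close:
  assumes m: "1 \<le> m" and chi: "limit_angle m chi" and \<theta>: "0 < \<theta>"
    and close: "\<And>y. \<bar>real (particle_count l y) / \<theta> - multicrit_mean m (of_int y / \<theta>)\<bar> \<le> \<eta>"
  shows "\<bar>profile l \<theta> x - limit_profile m chi x\<bar> \<le> 2 * (\<eta> + 1 / \<theta>)"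
proof -
  let ?g = "multicrit_mean m"
  define y where "y = \<lfloor>\<theta> * x\<rfloor>"
  define f where "f = frac (\<theta> * x)"
  have f: "0 \<le> f" "f < 1" by (auto simp: f_def frac_lt_1)
  have "of_int y \<le> \<theta> * x" "\<theta> * x \<le> of_int (y + 1)"
    unfolding y_def by linarith+
  then have yx: "of_int y / \<theta> \<le> x" "x \<le> of_int (y + 1) / \<theta>"
    using \<theta> by (simp_all add: field_simps)
  have step: "of_int (y + 1) / \<theta> = of_int y / \<theta> + 1 / \<theta>"
    by (simp add: add_divide_distrib)
  define A where "A = real (particle_count l y) / \<theta> - ?g x"
  define B where "B = real (particle_count l (y + 1)) / \<theta> - ?g x"
  have A: "\<bar>A\<bar> \<le> \<eta> + 1 / \<theta>"
    using close[of y] multicrit_mean_lipschitz[OF yx(1), of m] multicrit_mean_antimono[OF yx(1), of m] yx step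
    unfolding A_def by linarith
  have B: "\<bar>B\<bar> \<le> \<eta> + 1 / \<theta>"
    using close[of "y + 1"] multicrit_mean_lipschitz[OF yx(2), of m] multicrit_mean_antimono[OF yx(2), of m] yx step
    unfolding B_def by linarith
  have "profile l \<theta> x - limit_profile m chi x = 2 * ((1 - f) * A + f * B)"
    unfolding profile_eq[OF \<theta>] limit_profile_eq[OF m chi] A_def B_def f_def y_def by (simp add: algebra_simps)
  also have "\<bar>\<dots>\<bar> \<le> 2 * ((1 - f) * \<bar>A\<bar> + f * \<bar>B\<bar>)"
    using f abs_triangle_ineq[of "(1 - f) * A" "f * B"] by (simp add: abs_mult)
  also have "\<dots> \<le> 2 * ((1 - f) * (\<eta> + 1 / \<theta>) + f * (\<eta> + 1 / \<theta>))"
    using f A B by (intro mult_left_mono add_mono) auto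
  also have "\<dots> = 2 * (\<eta> + 1 / \<theta>)"
    by (simp only: distrib_right[symmetric]) simp
  finally show ?thesis .
qed

lemma sup_deviation_tendsto_0:
  assumes m: "1 \<le> m" and chi: "limit_angle m chi" and \<epsilon>: "0 < \<epsilon>"
  shows "((\<lambda>\<theta>::real. measure (multicrit_measure m \<theta>)
      {l \<in> partitions. (SUP x. ereal \<bar>profile l \<theta> x - limit_profile m chi x\<bar>) > ereal \<epsilon>})
    \<longlongrightarrow> 0) at_top"
proof -
  define b where "b = multicrit_edge m"
  have b: "0 < b" unfolding b_def by (rule multicrit_edge_pos[OF m])
  \<comment> \<open>Makes the mesh \<open>\<delta>\<close> at most \<open>\<epsilon> / 8\<close>.
    With \<open>\<epsilon> / 8\<close> at the grid points and
    \<open>1 / \<theta> \<le> \<epsilon> / 8\<close> the total error is at most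
    \<open>2 * (3 * \<epsilon> / 8) < \<epsilon>\<close>.\<close>
  define K where "K = nat \<lceil>2 * b / (\<epsilon> / 8)\<rceil>"
  define \<delta> where "\<delta> = 2 * b / real K"
  have "0 < 2 * b / (\<epsilon> / 8)" using b \<epsilon> by simp
  then have K: "0 < K" "2 * b / (\<epsilon> / 8) \<le> real K" unfolding K_def by linarith+
  have \<delta>: "0 < \<delta>" "\<delta> \<le> \<epsilon> / 8" "2 * b = real K * \<delta>"
    using K b \<epsilon> by (auto simp: \<delta>_def field_simps)
  define X where "X i = - b + real i * \<delta>" for i
  define Bad where "Bad \<theta> i = {l \<in> partitions. \<epsilon> / 8 \<le> \<bar>real (particle_count l \<lfloor>\<theta> * X i\<rfloor>) / \<theta> - multicrit_mean m (X i)\<bar>}" for \<theta> i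
  have e8: "0 < \<epsilon> / 8" using \<epsilon> by simp
  define Q where "Q i \<kappa> \<longleftrightarrow> (\<forall>\<^sub>F \<theta> in at_top. \<forall>F. finite F \<longrightarrow> F \<subseteq> Bad \<theta> i \<longrightarrow>
      (\<Sum>l\<in>F. multicrit_weight m \<theta> l) \<le> 2 * exp (- \<kappa> * \<theta>))" for i \<kappa>
  have "\<exists>\<kappa>. 0 < \<kappa> \<and> Q i \<kappa>" for i
    unfolding Q_def Bad_def by (rule deviation_bound[OF m e8, of "X i"], rule exI, rule conjI)
  then obtain \<kappa> where \<kappa>: "\<And>i. 0 < \<kappa> i" "\<And>i. Q i (\<kappa> i)"
    by metis
  have all: "\<forall>\<^sub>F \<theta> in at_top. \<forall>i\<in>{..K}. \<forall>F. finite F \<longrightarrow> F \<subseteq> Bad \<theta> i \<longrightarrow> (\<Sum>l\<in>F. multicrit_weight m \<theta> l) \<le> 2 * exp (- \<kappa> i * \<theta>)"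
    using \<kappa>(2)[unfolded Q_def] by (intro eventually_ball_finite) auto
  have big: "\<forall>\<^sub>F \<theta> in at_top. 8 / \<epsilon> \<le> \<theta>"
    by (rule eventually_ge_at_top)
  show ?thesis
  proof (rule tendsto_sandwich[OF _ _ tendsto_const])
    show "((\<lambda>\<theta>. \<Sum>i\<le>K. 2 * exp (- \<kappa> i * \<theta>)) \<longlongrightarrow> 0) at_top"
    proof (rule tendsto_null_sum)
      fix i
      have "filterlim (\<lambda>\<theta>. - \<kappa> i * \<theta>) at_bot at_top"
        using \<kappa>(1)[of i] by (intro filterlim_tendsto_neg_mult_at_bot[OF tendsto_const] filterlim_ident) auto
      then have "((\<lambda>\<theta>. exp (- \<kappa> i * \<theta>)) \<longlongrightarrow> 0) at_top"
        by (rule filterlim_compose[OF exp_at_bot])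
      from tendsto_mult_right_zero[OF this, of 2]
      show "((\<lambda>\<theta>. 2 * exp (- \<kappa> i * \<theta>)) \<longlongrightarrow> 0) at_top" .
    qed
    show "\<forall>\<^sub>F \<theta> in at_top. measure (multicrit_measure m \<theta>)
      {l \<in> partitions. (SUP x. ereal \<bar>profile l \<theta> x - limit_profile m chi x\<bar>) > ereal \<epsilon>}
      \<le> (\<Sum>i\<le>K. 2 * exp (- \<kappa> i * \<theta>))"
      using all big
    proof eventually_elim
      case (elim \<theta>)
      have "0 < 8 / \<epsilon>" using \<epsilon> by simp
      then have \<theta>0: "0 < \<theta>"
        using elim(2) by linarith
      then have \<theta>: "0 < \<theta>" "1 / \<theta> \<le> \<epsilon> / 8"
        using elim(2) \<epsilon> by (simp_all add: field_simps)
      let ?E = "{l \<in> partitions. (SUP x. ereal \<bar>profile l \<theta> x - limit_profile m chi x\<bar>) > ereal \<epsilon>}"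
      have sub: "?E \<subseteq> (\<Union>i\<in>{..K}. Bad \<theta> i)"
      proof (rule subsetI, rule ccontr)
        fix l assume l: "l \<in> ?E" and not: "l \<notin> (\<Union>i\<in>{..K}. Bad \<theta> i)"
        then have part: "l \<in> partitions" by simp
        have grid: "\<bar>real (particle_count l \<lfloor>\<theta> * (- b + real i * \<delta>)\<rfloor>) / \<theta> - multicrit_mean m (- b + real i * \<delta>)\<bar> < \<epsilon> / 8"
          if "i \<le> K" for i
          using not that part by (auto simp: Bad_def X_def not_le)
        have close: "\<bar>real (particle_count l y) / \<theta> - multicrit_mean m (of_int y / \<theta>)\<bar> \<le> \<epsilon> / 8 + \<delta>" for y
          by (rule lattice_close[OF m part \<theta>(1) \<delta>(1) K(1) b_def \<delta>(3) grid])
        have "\<bar>profile l \<theta> x - limit_profile m chi x\<bar> \<le> \<epsilon>" for x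
        proof (rule order.trans[OF profile_close[OF m chi \<theta>(1) close, of x]])
          have "\<epsilon> / 8 + \<delta> + 1 / \<theta> \<le> \<epsilon> / 8 + \<epsilon> / 8 + \<epsilon> / 8"
            by (intro add_mono order.refl \<delta>(2) \<theta>(2))
          then show "2 * (\<epsilon> / 8 + \<delta> + 1 / \<theta>) \<le> \<epsilon>"
            using \<epsilon> by simp
        qed
        then have "(SUP x. ereal \<bar>profile l \<theta> x - limit_profile m chi x\<bar>) \<le> ereal \<epsilon>"
          by (intro SUP_least) simp
        then show False using l by auto
      qed
      show ?case
      proof (rule measure_multicrit_le)
        show "0 \<le> (\<Sum>i\<le>K. 2 * exp (- \<kappa> i * \<theta>))" by (intro sum_nonneg) auto
        fix F assume F: "finite F" "F \<subseteq> ?E"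
        \<comment> \<open>Union bound on finite sums: each \<open>l \<in> F\<close> is charged to
          every grid point at which it is bad, and there is at least one.\<close>
        have "(\<Sum>l\<in>F. multicrit_weight m \<theta> l) \<le> (\<Sum>l\<in>F. \<Sum>i\<le>K. if l \<in> Bad \<theta> i then multicrit_weight m \<theta> l else 0)"
        proof (rule sum_mono)
          fix l assume "l \<in> F"
          then obtain i where i: "i \<in> {..K}" "l \<in> Bad \<theta> i" using F(2) sub by blast
          then show "multicrit_weight m \<theta> l \<le> (\<Sum>i\<le>K. if l \<in> Bad \<theta> i then multicrit_weight m \<theta> l else 0)"
            using member_le_sum[of i "{..K}" "\<lambda>i. if l \<in> Bad \<theta> i then multicrit_weight m \<theta> l else 0"]
            by (auto simp: multicrit_weight_nonneg)
        qed
        also have "\<dots> = (\<Sum>i\<le>K. \<Sum>l\<in>F. if l \<in> Bad \<theta> i then multicrit_weight m \<theta> l else 0)"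
          by (rule sum.swap)
        also have "\<dots> = (\<Sum>i\<le>K. \<Sum>l\<in>{l \<in> F. l \<in> Bad \<theta> i}. multicrit_weight m \<theta> l)"
          using F(1) by (simp add: sum.inter_filter)
        also have "\<dots> \<le> (\<Sum>i\<le>K. 2 * exp (- \<kappa> i * \<theta>))"
        proof (rule sum_mono)
          fix i assume "i \<in> {..K}"
          moreover have "finite {l \<in> F. l \<in> Bad \<theta> i}" "{l \<in> F. l \<in> Bad \<theta> i} \<subseteq> Bad \<theta> i"
            using F(1) by auto
          ultimately show "(\<Sum>l\<in>{l \<in> F. l \<in> Bad \<theta> i}. multicrit_weight m \<theta> l) \<le> 2 * exp (- \<kappa> i * \<theta>)"
            using elim(1) by blast
        qed
        finally show "(\<Sum>l\<in>F. multicrit_weight m \<theta> l) \<le> (\<Sum>i\<le>K. 2 * exp (- \<kappa> i * \<theta>))" .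
      qed auto
    qed
  qed (auto intro!: always_eventually)
qed

theorem corollary8:
  fixes m :: nat
  assumes "m \<ge> 1"
  shows "(\<exists>chi. limit_angle m chi) \<and>
    (\<forall>chi. limit_angle m chi \<longrightarrow>
      (\<forall>\<epsilon>>0.
        ((\<lambda>\<theta>::real. measure (multicrit_measure m \<theta>)
            {l \<in> partitions.
              (SUP x. ereal \<bar>profile l \<theta> x - limit_profile m chi x\<bar>) > ereal \<epsilon>})
          \<longlongrightarrow> 0) at_top))"
proof (intro conjI allI impI)
  show "\<exists>chi. limit_angle m chi"
    by (rule limit_angle_exists[OF assms])
qed (rule sup_deviation_tendsto_0[OF assms])

end
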